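(* Let $0<r_{\min}<r_{\max}$, $t_{\max}>0$, $N=2$, with shape parameters $\eta_1=1$ and $\eta_2>1$, and let $G_1,G_2:[0,t_{\max}]\to\mathbb R$ be positive $C^1$ growth rates having constant ratio $\frac{g_1}{g_2}$, i.e. there are constants $g_1,g_2>0$ with $g_2G_1(t)=g_1G_2(t)$ for all $t\in[0,t_{\max}]$. Let $r_0=r_{\min}-\max_{i\in\{1,2\}}\int_0^{t_{\max}}G_i(s)\,ds$ and $r_1=r_{\max}$, and let the operator $\mathcal K$ and the transport system (T) be as defined in the context. Let $\psi_0=(\psi_{0,1},\psi_{0,2})$ with $\psi_{0,i}\in H^2((r_0,r_1);\mathbb R)$ and $\psi_{0,i}(r)=0$ for $r_0\le r<r_{\min}-\int_0^{t_{\max}}G_i(s)\,ds$ ($i=1,2$), be such that the solution $\psi=(\psi_1,\psi_2)$ of (T) with initial condition $\psi_0$ satisfies the boundary condition $$\psi_i(t,r_{\max})=0\qquad\forall t\in[0,t_{\max}],\ \forall i\in\{1,2\}.$$ Then $$\big(\forall t\in[0,t_{\max}],\ \mathcal K\psi(t,\cdot)=0\big)\ \Longrightarrow\ \psi_0=0 .$$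
   Context: Let $\ell_{\max}=2r_{\max}\max(\eta_1,\eta_2)$, $X=L^2((r_0,r_1);\mathbb R)$, $Y=L^2((0,\ell_{\max});\mathbb R)$. Kernels. For $\eta>0$ let $\alpha_\eta(\phi,\theta)=\frac{\cos^2\phi}{\cos^2\theta+\eta^2\sin^2\theta}+\sin^2\phi$. For $r\in[r_{\min},r_{\max}]$ and $\ell\in[0,2r_{\max}\eta_i]$, $$k_i(\ell,r)=1-\int_0^{2\pi}\int_0^{\pi}\sqrt{1-\left(\tfrac{\ell}{2r}\right)^2\alpha_{\eta_i}(\phi,\theta)}\;\frac{\sin\theta}{4\pi}\,d\theta\,d\phi,$$ the square root being $0$ when its argument is negative; and $k_i(\ell,r)=0$ if $r\notin[r_{\min},r_{\max}]$ or $\ell\notin[0,2r_{\max}\eta_i]$. Operator. $\mathcal K:X^2\to Y$, $(\mathcal K\psi)(\ell)=\sum_{i=1}^2\int_{r_{\min}}^{r_{\max}}k_i(\ell,r)\psi_i(r)\,dr$. System (T): $\frac{\partial\psi_i}{\partial t}(t,r)+G_i(t)\frac{\partial\psi_i}{\partial r}(t,r)=0$ for $t\in(0,t_{\max})$, $r\in(r_0,r_1)$, $i=1,2$, with $\psi(0,\cdot)=\psi_0$ and periodic boundary conditions $\psi(t,r_0)=\psi(t,r_1)$. Its solution is the unique $\psi\in C^0([0,t_{\max}];X^2)$ with $\psi(0)=\psi_0$ such that for all $\varphi\in\mathcal D^2$, $\mathcal D=\{\varphi\in X:\varphi'\in X,\ \varphi(r_0)=\varphi(r_1)\}$, the map $t\mapsto\langle\psi(t),\varphi\rangle_{X^2}$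 is $C^1$ with derivative $\langle\psi(t),G(t)\varphi'\rangle_{X^2}$, where $G=\mathrm{diag}(G_1,G_2)$; equivalently $\psi_i(t,r)=\psi_{0,i}\big(r-\int_0^tG_i(s)\,ds\big)$, with the argument understood modulo $r_1-r_0$. The value $\psi_i(t,r_{\max})$ is understood as the left limit at $r=r_{\max}$. *)

theory Defs
  imports "HOL-Analysis.Analysis"
begin

text \<open>
  Elements of \<open>L\<^sup>2\<close> and of the Sobolev spaces are represented by functions. Equality of two
  elements is equality almost everywhere, and no definition below depends on the representative,
  except \<open>periodic_H1\<close>, where the continuous one is singled out.
  Pairs indexed by \<open>i = 1, 2\<close> are functions on the two-element type \<open>2\<close>.
\<close>

definition L2 :: "real \<Rightarrow> real \<Rightarrow> (real \<Rightarrow> real) set" where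
  "L2 a b = {f. f \<in> borel_measurable (lebesgue_on {a<..<b}) \<and>
                integrable (lebesgue_on {a<..<b}) (\<lambda>x. (f x)\<^sup>2)}"

definition X2_inner ::
  "real \<Rightarrow> real \<Rightarrow> (2 \<Rightarrow> real \<Rightarrow> real) \<Rightarrow> (2 \<Rightarrow> real \<Rightarrow> real) \<Rightarrow> real" where
  "X2_inner a b f g = (\<Sum>i\<in>UNIV. LINT x|lebesgue_on {a<..<b}. f i x * g i x)"

definition X2_norm :: "real \<Rightarrow> real \<Rightarrow> (2 \<Rightarrow> real \<Rightarrow> real) \<Rightarrow> real" where
  "X2_norm a b f = sqrt (X2_inner a b f f)"

definition X2_eq ::
  "real \<Rightarrow> real \<Rightarrow> (2 \<Rightarrow> real \<Rightarrow> real) \<Rightarrow> (2 \<Rightarrow> real \<Rightarrow> real) \<Rightarrow> bool" where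
  "X2_eq a b f g \<longleftrightarrow> (\<forall>i. AE x in lebesgue_on {a<..<b}. f i x = g i x)"

definition test_function :: "real \<Rightarrow> real \<Rightarrow> (real \<Rightarrow> real) \<Rightarrow> bool" where
  "test_function a b \<phi> \<longleftrightarrow>
     (\<forall>n x. (deriv ^^ n) \<phi> differentiable (at x)) \<and>
     (\<exists>c d. a < c \<and> d < b \<and> (\<forall>x. \<phi> x \<noteq> 0 \<longrightarrow> x \<in> {c..d}))"

definition has_L2_weak_deriv ::
  "real \<Rightarrow> real \<Rightarrow> (real \<Rightarrow> real) \<Rightarrow> (real \<Rightarrow> real) \<Rightarrow> bool" where
  "has_L2_weak_deriv a b u v \<longleftrightarrow> u \<in> L2 a b \<and> v \<in> L2 a b \<and>
     (\<forall>\<phi>. test_function a b \<phi> \<longrightarrow>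
        (LINT x|lebesgue_on {a<..<b}. u x * deriv \<phi> x) =
        - (LINT x|lebesgue_on {a<..<b}. v x * \<phi> x))"

text \<open>\<open>sobolev_H k a b\<close> is \<open>H\<^sup>k((a,b);\<real>)\<close>.\<close>

primrec sobolev_H :: "nat \<Rightarrow> real \<Rightarrow> real \<Rightarrow> (real \<Rightarrow> real) set" where
  "sobolev_H 0 a b = L2 a b"
| "sobolev_H (Suc k) a b = {u. \<exists>v\<in>sobolev_H k a b. has_L2_weak_deriv a b u v}"

text \<open>
  The space \<open>\<D>\<close>. Every element of \<open>H\<^sup>1((a,b))\<close> has exactly one representative that is
  continuous on \<open>[a,b]\<close>; the boundary values are those of this representative.
\<close>

definition periodic_H1 :: "real \<Rightarrow> real \<Rightarrow> (real \<Rightarrow> real) set" where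
  "periodic_H1 a b = {\<phi> \<in> sobolev_H 1 a b. continuous_on {a..b} \<phi> \<and> \<phi> a = \<phi> b}"

text \<open>
  \<open>f\<close> is \<open>C\<^sup>1\<close> on \<open>S\<close> with derivative \<open>f'\<close>, one-sided at the end points of an interval.
  The library's \<open>C1_differentiable_on\<close> would ask for two-sided derivatives there.
\<close>

definition has_C1_deriv_on :: "(real \<Rightarrow> real) \<Rightarrow> (real \<Rightarrow> real) \<Rightarrow> real set \<Rightarrow> bool" where
  "has_C1_deriv_on f f' S \<longleftrightarrow>
     (\<forall>t\<in>S. (f has_real_derivative f' t) (at t within S)) \<and> continuous_on S f'"

definition C1_on :: "(real \<Rightarrow> real) \<Rightarrow> real set \<Rightarrow> bool" where
  "C1_on f S \<longleftrightarrow> (\<exists>f'. has_C1_deriv_on f f' S)"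

text \<open>The left limit at \<open>b\<close> of a function on \<open>(a,b)\<close> that is given up to null sets.\<close>

definition has_left_value :: "real \<Rightarrow> real \<Rightarrow> (real \<Rightarrow> real) \<Rightarrow> real \<Rightarrow> bool" where
  "has_left_value a b f l \<longleftrightarrow>
     (\<exists>g. (AE x in lebesgue_on {a<..<b}. f x = g x) \<and> (g \<longlongrightarrow> l) (at_left b))"

text \<open>\<open>\<psi> t i r\<close> stands for \<open>\<psi>\<^sub>i(t,r)\<close>; only \<open>t \<in> [0,T]\<close> matters.\<close>

definition transport_solution ::
  "real \<Rightarrow> real \<Rightarrow> real \<Rightarrow> (2 \<Rightarrow> real \<Rightarrow> real) \<Rightarrow> (2 \<Rightarrow> real \<Rightarrow> real)
     \<Rightarrow> (real \<Rightarrow> 2 \<Rightarrow> real \<Rightarrow> real) \<Rightarrow> bool" where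
  "transport_solution T a b G \<psi>0 \<psi> \<longleftrightarrow>
     (\<forall>t\<in>{0..T}. \<forall>i. \<psi> t i \<in> L2 a b) \<and>
     (\<forall>t\<in>{0..T}. ((\<lambda>s. X2_norm a b (\<lambda>i r. \<psi> s i r - \<psi> t i r)) \<longlongrightarrow> 0) (at t within {0..T})) \<and>
     X2_eq a b (\<psi> 0) \<psi>0 \<and>
     (\<forall>\<phi> \<phi>'. (\<forall>i. \<phi> i \<in> periodic_H1 a b \<and> has_L2_weak_deriv a b (\<phi> i) (\<phi>' i)) \<longrightarrow>
        has_C1_deriv_on (\<lambda>t. X2_inner a b (\<psi> t) \<phi>)
                        (\<lambda>t. X2_inner a b (\<psi> t) (\<lambda>i r. G i t * \<phi>' i r)) {0..T})"

definition alpha :: "real \<Rightarrow> real \<Rightarrow> real \<Rightarrow> real" where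
  "alpha \<eta> \<phi> \<theta> = (cos \<phi>)\<^sup>2 / ((cos \<theta>)\<^sup>2 + \<eta>\<^sup>2 * (sin \<theta>)\<^sup>2) + (sin \<phi>)\<^sup>2"

text \<open>The \<open>max 0\<close> is needed because \<open>sqrt\<close> is odd, hence negative at negative arguments.\<close>

definition kernel :: "real \<Rightarrow> real \<Rightarrow> real \<Rightarrow> real \<Rightarrow> real \<Rightarrow> real" where
  "kernel rmin rmax \<eta> l r =
     (if r \<in> {rmin..rmax} \<and> l \<in> {0..2 * rmax * \<eta>} then
        1 - integral {0..2 * pi} (\<lambda>\<phi>. integral {0..pi} (\<lambda>\<theta>.
              sqrt (max 0 (1 - (l / (2 * r))\<^sup>2 * alpha \<eta> \<phi> \<theta>)) * (sin \<theta> / (4 * pi))))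
      else 0)"

definition K_op ::
  "real \<Rightarrow> real \<Rightarrow> (2 \<Rightarrow> real) \<Rightarrow> (2 \<Rightarrow> real \<Rightarrow> real) \<Rightarrow> real \<Rightarrow> real" where
  "K_op rmin rmax \<eta> \<psi> l =
     (\<Sum>i\<in>UNIV. LINT r|lebesgue_on {rmin..rmax}. kernel rmin rmax (\<eta> i) l r * \<psi> i r)"

end

theory Submission
  imports Defs
begin

text \<open>
  Testing the transport equation with trigonometric functions shows that \<open>\<psi>\<^sub>i(t)\<close> is the cyclic shift of
  \<open>\<psi>\<^sub>0\<^sub>,\<^sub>i\<close> by \<open>\<integral>\<^sub>0\<^sup>t G\<^sub>i = g\<^sub>i \<tau>(t)\<close>. The vanishing left values at \<open>r\<^sub>m\<^sub>a\<^sub>x\<close> make \<open>\<psi>\<^sub>0\<^sub>,\<^sub>i\<close> vanish on the last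
  stretch of length \<open>g\<^sub>i \<tau>(T)\<close>, so that nothing leaves through \<open>r\<^sub>m\<^sub>a\<^sub>x\<close>.

  For \<open>\<ell> < 2 r\<^sub>m\<^sub>i\<^sub>n\<close> the kernels are power series in \<open>(\<ell> / 2r)\<^sup>2\<close>; the coefficients of \<open>k\<^sub>2\<close> are those of \<open>k\<^sub>1\<close>
  times the averages \<open>a\<^sub>n\<close> of \<open>\<alpha>\<^sup>n\<close> over the sphere. Hence \<open>\<K>\<psi>(t) = 0\<close> gives, for all \<open>n \<ge> 1\<close> and all \<open>t\<close>,
  \<open>\<integral> r\<^sup>-\<^sup>2\<^sup>n \<psi>\<^sub>1(t,r) dr + a\<^sub>n \<integral> r\<^sup>-\<^sup>2\<^sup>n \<psi>\<^sub>2(t,r) dr = 0\<close> over \<open>[r\<^sub>m\<^sub>i\<^sub>n, r\<^sub>m\<^sub>a\<^sub>x]\<close>.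
  After smoothing in \<open>\<tau>\<close>, the leading asymptotics for \<open>n \<rightarrow> \<infinity>\<close> is governed by the values at \<open>r\<^sub>m\<^sub>i\<^sub>n\<close>; since
  \<open>a\<^sub>n \<rightarrow> 0\<close> but \<open>n a\<^sub>n \<rightarrow> \<infinity>\<close>, both values vanish, so nothing ever enters through \<open>r\<^sub>m\<^sub>i\<^sub>n\<close>. The relation can
  then be expanded in powers of \<open>\<tau>\<close>. The coefficient of \<open>\<tau>\<^sup>2\<close> and the relation for \<open>n + 1\<close> form a
  linear system for the moments of order \<open>2n + 2\<close> with determinant \<open>a\<^sub>n g\<^sub>2\<^sup>2 - a\<^sub>n\<^sub>+\<^sub>1 g\<^sub>1\<^sup>2\<close>, which is nonzero for
  large \<open>n\<close> because \<open>a\<^sub>n\<^sub>+\<^sub>1 / a\<^sub>n\<close> is nondecreasing, smaller than \<open>1\<close> and tends to \<open>1\<close>. So all high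
  moments vanish, and the Stone--Weierstrass theorem gives \<open>\<psi>\<^sub>0 = 0\<close>.
\<close>

section \<open>Functions determined by integrals\<close>

text \<open>The positive part \<open>p\<close> and the negative part \<open>q\<close> are densities
  of measures that agree on all open intervals, an intersection-stable generator of the Borel sets.
  So the measures, and with them the densities, coincide; as \<open>p\<close> and \<open>q\<close>
  are never both positive, both vanish.\<close>

lemma AE_zero_of_interval_integrals:
  fixes f :: "real \<Rightarrow> real"
  assumes f: "integrable lborel f"
    and zero: "\<And>a b. a < b \<Longrightarrow> (LINT x|lborel. f x * indicator {a<..<b} x) = 0"
  shows "AE x in lborel. f x = 0"
proof -
  define p where "p = (\<lambda>x. max 0 (f x))"
  define q where "q = (\<lambda>x. max 0 (- f x))"
  have fm: "f \<in> borel_measurable borel"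
    using borel_measurable_integrable[OF f] by simp
  have pq: "integrable lborel p" "integrable lborel q"
    using f by (auto simp: p_def q_def)
  have pm [measurable]: "p \<in> borel_measurable borel" "q \<in> borel_measurable borel"
    using fm by (auto simp: p_def q_def)
  have ind: "integrable lborel (\<lambda>x. h x * indicator {a<..<b} x)"
    if "integrable lborel h" for h :: "real \<Rightarrow> real" and a b
    using integrable_mult_indicator[of "{a<..<b}" lborel h] that by (simp add: mult.commute)
  have eq: "(\<integral>\<^sup>+ x. ennreal (p x) * indicator {a<..<b} x \<partial>lborel) =
            (\<integral>\<^sup>+ x. ennreal (q x) * indicator {a<..<b} x \<partial>lborel)" for a b
  proof (cases "a < b")
    case True
    have *: "(\<integral>\<^sup>+ x. ennreal (h x) * indicator {a<..<b} x \<partial>lborel) =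
        ennreal (LINT x|lborel. h x * indicator {a<..<b} x)"
      if "integrable lborel h" "\<And>x. h x \<ge> 0" for h
      using that ind[OF that(1)]
      by (subst nn_integral_eq_integral[symmetric])
         (auto intro!: nn_integral_cong simp: indicator_def)
    have "f = (\<lambda>x. p x - q x)"
      by (auto simp: p_def q_def)
    then have "(LINT x|lborel. p x * indicator {a<..<b} x - q x * indicator {a<..<b} x) = 0"
      using zero[OF True] by (simp add: left_diff_distrib)
    then have "(LINT x|lborel. p x * indicator {a<..<b} x) = (LINT x|lborel. q x * indicator {a<..<b} x)"
      by (subst (asm) Bochner_Integration.integral_diff) (auto intro!: ind pq)
    then show ?thesis
      using *[OF pq(1)] *[OF pq(2)] by (simp add: p_def q_def)
  qed (auto simp: indicator_def)
  have fin: "(\<integral>\<^sup>+ x. ennreal (p x) \<partial>lborel) \<noteq> \<infinity>"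
    using pq(1) by (auto simp: real_integrable_def)
  have "density lborel p = density lborel q"
  proof (rule measure_eqI_generator_eq[of "range (\<lambda>(a, b). box a b)" UNIV])
    show "Int_stable (range (\<lambda>(a, b). box a b :: real set))"
      by (auto simp: Int_stable_def Int_interval)
    show "sets (density lborel p) = sigma_sets UNIV (range (\<lambda>(a, b). box a b))"
      "sets (density lborel q) = sigma_sets UNIV (range (\<lambda>(a, b). box a b))"
      by (simp_all add: borel_eq_box)
    show "range (\<lambda>n::nat. box (- real n) (real n)) \<subseteq> range (\<lambda>(a, b). box a b)" by auto
    show "(\<Union>n::nat. box (- real n) (real n)) = UNIV"
    proof -
      have "\<exists>n::nat. - real n < x \<and> x < real n" for x
        using reals_Archimedean2[of "\<bar>x\<bar>"] by (metis abs_less_iff minus_less_iff)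
      then show ?thesis by auto
    qed
    show "emeasure (density lborel p) (box (- real i) (real i)) \<noteq> \<infinity>" for i :: nat
    proof -
      have "(\<integral>\<^sup>+ x. ennreal (p x) * indicator (box (- real i) (real i)) x \<partial>lborel)
          \<le> (\<integral>\<^sup>+ x. ennreal (p x) \<partial>lborel)"
        by (intro nn_integral_mono) (auto simp: indicator_def)
      then show ?thesis
        using fin by (auto simp: emeasure_density top_unique)
    qed
    show "emeasure (density lborel p) X = emeasure (density lborel q) X"
      if "X \<in> range (\<lambda>(a, b). box a b)" for X
      using that eq by (auto simp: emeasure_density)
  qed simp
  then have "AE x in lborel. ennreal (p x) = ennreal (q x)"
    by (subst (asm) finite_density_unique) (use fin in auto)
  then show ?thesis
    by eventually_elim (auto simp: p_def q_def max_def split: if_splits)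
qed

text \<open>Dominated convergence passes from Lipschitz functions to indicators of subintervals. The
  constant \<open>C\<close> may vary with the test function, since the approximating slopes are
  unbounded.\<close>

lemma AE_zero_of_Lipschitz_tests:
  fixes f :: "real \<Rightarrow> real"
  assumes f: "integrable lborel f"
    and zero: "\<And>u C. (\<And>x y. \<bar>u x - u y\<bar> \<le> C * \<bar>x - y\<bar>) \<Longrightarrow> (\<And>x. x \<notin> {a<..<b} \<Longrightarrow> u x = 0)
      \<Longrightarrow> (LINT x|lborel. f x * u x) = 0"
  shows "AE x in lborel. x \<in> {a<..<b} \<longrightarrow> f x = 0"
proof -
  have fm [measurable]: "f \<in> borel_measurable borel"
    using borel_measurable_integrable[OF f] by simp
  have "AE x in lborel. f x * indicator {a<..<b} x = 0"
  proof (rule AE_zero_of_interval_integrals)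
    show "integrable lborel (\<lambda>x. f x * indicator {a<..<b} x)"
      using integrable_mult_indicator[of "{a<..<b}" lborel f] f by (simp add: mult.commute)
    fix c0 d0 :: real
    \<comment> \<open>Cutting \<open>(c0, d0)\<close> down to \<open>(a, b)\<close> keeps the
      trapezoids supported in \<open>(a, b)\<close>; if \<open>c \<ge> d\<close> they vanish
      identically.\<close>
    define c where "c = max a c0"
    define d where "d = min b d0"
    \<comment> \<open>Trapezoids increasing to the indicator of \<open>(c, d)\<close>.\<close>
    define u where "u = (\<lambda>k::nat. \<lambda>x::real. max 0 (min 1 (real k * min (x - c) (d - x))))"
    have clamp: "\<bar>max 0 (min 1 p) - max 0 (min 1 q)\<bar> \<le> \<bar>p - q\<bar>" for p q :: real
      by linarith
    have "(LINT x|lborel. f x * u k x) = 0" for k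
    proof (rule zero)
      fix x y :: real
      have "\<bar>min (x - c) (d - x) - min (y - c) (d - y)\<bar> \<le> \<bar>x - y\<bar>" by linarith
      then have "real k * \<bar>min (x - c) (d - x) - min (y - c) (d - y)\<bar> \<le> real k * \<bar>x - y\<bar>"
        by (rule mult_left_mono) simp
      then have "\<bar>real k * min (x - c) (d - x) - real k * min (y - c) (d - y)\<bar> \<le> real k * \<bar>x - y\<bar>"
        by (simp add: right_diff_distrib[symmetric] abs_mult)
      then show "\<bar>u k x - u k y\<bar> \<le> real k * \<bar>x - y\<bar>"
        using clamp[of "real k * min (x - c) (d - x)" "real k * min (y - c) (d - y)"]
        unfolding u_def by (rule order_trans[rotated])
    next
      fix x assume "x \<notin> {a<..<b}"
      then have "min (x - c) (d - x) \<le> 0" by (auto simp: c_def d_def)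
      then have "real k * min (x - c) (d - x) \<le> 0" by (simp add: mult_le_0_iff)
      then show "u k x = 0" by (simp add: u_def)
    qed
    moreover have "(\<lambda>k. LINT x|lborel. f x * u k x) \<longlonglongrightarrow> (LINT x|lborel. f x * indicator {c<..<d} x)"
    proof (rule integral_dominated_convergence[where w="\<lambda>x. \<bar>f x\<bar>"])
      show "AE x in lborel. (\<lambda>k. f x * u k x) \<longlonglongrightarrow> f x * indicator {c<..<d} x"
      proof (intro AE_I2 tendsto_mult tendsto_const)
        fix x
        define m where "m = min (x - c) (d - x)"
        show "(\<lambda>k. u k x) \<longlonglongrightarrow> indicator {c<..<d} x"
        proof (cases "m > 0")
          case True
          obtain N :: nat where N: "real N > 1 / m" using reals_Archimedean2 by blast
          have "u k x = 1" if "k \<ge> N" for k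
          proof -
            have "real k > 1 / m" using N that by (smt (verit) of_nat_mono)
            then have "real k * m \<ge> 1" using True by (simp add: field_simps)
            then show ?thesis by (simp add: u_def m_def[symmetric])
          qed
          then have "eventually (\<lambda>k. u k x = 1) sequentially"
            by (auto simp: eventually_sequentially)
          moreover have "indicator {c<..<d} x = (1::real)"
            using True by (auto simp: m_def)
          ultimately show ?thesis by (simp add: tendsto_eventually)
        next
          case False
          then have "real k * m \<le> 0" for k by (simp add: mult_le_0_iff)
          then have "u k x = 0" for k unfolding u_def m_def[symmetric]
            by (metis max.orderE min.coboundedI2)
          moreover have "indicator {c<..<d} x = (0::real)"
            using False by (auto simp: m_def)
          ultimately show ?thesis by simp
        qed
      qed
      show "AE x in lborel. norm (f x * u k x) \<le> \<bar>f x\<bar>" for k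
        by (auto simp: u_def abs_mult mult_left_le)
    qed (use f in \<open>auto simp: u_def\<close>)
    ultimately have "(LINT x|lborel. f x * indicator {c<..<d} x) = 0"
      by (simp add: LIMSEQ_const_iff)
    moreover have "indicator {a<..<b} x * indicator {c0<..<d0} x = (indicator {c<..<d} x :: real)" for x
      by (auto simp: c_def d_def indicator_def)
    ultimately show "(LINT x|lborel. f x * indicator {a<..<b} x * indicator {c0<..<d0} x) = 0"
      by (simp add: mult.assoc)
  qed
  then show ?thesis
    by eventually_elim (auto simp: indicator_def split: if_splits)
qed

lemma Lipschitz_continuous_on:
  fixes u :: "real \<Rightarrow> real"
  assumes u: "\<And>x y. \<bar>u x - u y\<bar> \<le> C * \<bar>x - y\<bar>"
  shows "continuous_on S u"
proof (rule lipschitz_on_continuous_on)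
  show "\<bar>C\<bar>-lipschitz_on S u"
  proof (rule lipschitz_onI)
    fix x y
    have "C * \<bar>x - y\<bar> \<le> \<bar>C\<bar> * \<bar>x - y\<bar>" by (intro mult_right_mono) auto
    then show "dist (u x) (u y) \<le> \<bar>C\<bar> * dist x y"
      using u[of x y] by (simp add: dist_real_def)
  qed simp
qed

lemma integrable_mult_bounded:
  fixes f v :: "'a \<Rightarrow> real"
  assumes f: "integrable M f" and [measurable]: "v \<in> borel_measurable M"
    and v: "\<And>x. f x \<noteq> 0 \<Longrightarrow> \<bar>v x\<bar> \<le> C"
  shows "integrable M (\<lambda>x. f x * v x)"
proof (rule Bochner_Integration.integrable_bound[OF integrable_mult_right[OF f, of C]])
  note [measurable] = borel_measurable_integrable[OF f]
  show "(\<lambda>x. f x * v x) \<in> borel_measurable M" by measurable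
  show "AE x in M. norm (f x * v x) \<le> norm (C * f x)"
  proof (intro AE_I2)
    fix x
    show "norm (f x * v x) \<le> norm (C * f x)"
    proof (cases "f x = 0")
      case False
      have "\<bar>f x\<bar> * \<bar>v x\<bar> \<le> \<bar>f x\<bar> * \<bar>C\<bar>" using v[OF False] by (intro mult_left_mono) auto
      then show ?thesis by (simp add: abs_mult mult.commute)
    qed simp
  qed
qed

lemma integral_mult_bound:
  fixes f v :: "'a \<Rightarrow> real"
  assumes f: "integrable M f" and vm: "v \<in> borel_measurable M"
    and v: "\<And>x. f x \<noteq> 0 \<Longrightarrow> \<bar>v x\<bar> \<le> C"
  shows "\<bar>LINT x|M. f x * v x\<bar> \<le> C * (LINT x|M. \<bar>f x\<bar>)"
proof -
  have "\<bar>LINT x|M. f x * v x\<bar> \<le> (LINT x|M. \<bar>f x * v x\<bar>)" by (rule integral_abs_bound)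
  also have "\<dots> \<le> (LINT x|M. C * \<bar>f x\<bar>)"
  proof (rule integral_mono)
    fix x
    show "\<bar>f x * v x\<bar> \<le> C * \<bar>f x\<bar>"
    proof (cases "f x = 0")
      case False
      then show ?thesis using mult_right_mono[OF v[OF False], of "\<bar>f x\<bar>"] by (simp add: abs_mult mult.commute)
    qed simp
  qed (use f integrable_mult_bounded[OF assms] in auto)
  finally show ?thesis by simp
qed

text \<open>Uniform approximation on the support of \<open>f\<close> costs at most \<open>e\<close>
  times the L1 norm of \<open>f\<close>. This reduces testing with continuous functions to testing
  with a dense algebra.\<close>

lemma integral_mult_eq_0_of_approx:
  fixes f u :: "'a \<Rightarrow> real"
  assumes f: "integrable M f" and um: "u \<in> borel_measurable M"
    and u: "\<And>x. f x \<noteq> 0 \<Longrightarrow> \<bar>u x\<bar> \<le> C"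
    and approx: "\<And>e. e > 0 \<Longrightarrow> \<exists>w\<in>borel_measurable M.
      (\<forall>x. f x \<noteq> 0 \<longrightarrow> \<bar>u x - w x\<bar> \<le> e) \<and> (LINT x|M. f x * w x) = 0"
  shows "(LINT x|M. f x * u x) = 0"
proof -
  define J where "J = (LINT x|M. \<bar>f x\<bar>)"
  have J: "J \<ge> 0" by (simp add: J_def)
  have small: "\<bar>LINT x|M. f x * u x\<bar> \<le> e * J" if e: "e > 0" for e
  proof -
    obtain w where wm: "w \<in> borel_measurable M" and w: "\<And>x. f x \<noteq> 0 \<Longrightarrow> \<bar>u x - w x\<bar> \<le> e"
      and w0: "(LINT x|M. f x * w x) = 0"
      using approx[OF e] by blast
    have dm: "(\<lambda>x. u x - w x) \<in> borel_measurable M" using um wm by simp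
    have i1: "integrable M (\<lambda>x. f x * (u x - w x))" by (rule integrable_mult_bounded[OF f dm w])
    have i2: "integrable M (\<lambda>x. f x * u x)" by (rule integrable_mult_bounded[OF f um u])
    have i3: "integrable M (\<lambda>x. f x * w x)"
      using Bochner_Integration.integrable_diff[OF i2 i1] by (simp add: algebra_simps)
    have "(LINT x|M. f x * (u x - w x)) = (LINT x|M. f x * u x) - (LINT x|M. f x * w x)"
      unfolding right_diff_distrib by (rule Bochner_Integration.integral_diff[OF i2 i3])
    then show ?thesis using integral_mult_bound[OF f dm w] w0 by (simp add: J_def)
  qed
  have "\<bar>LINT x|M. f x * u x\<bar> \<le> 0"
  proof (rule field_le_epsilon)
    fix e :: real assume "e > 0"
    \<comment> \<open>The summand \<open>1\<close> guards against \<open>J = 0\<close>.\<close>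
    have "\<bar>LINT x|M. f x * u x\<bar> \<le> e / (J + 1) * J" using J \<open>e > 0\<close> by (intro small) auto
    also have "\<dots> \<le> e" using J \<open>e > 0\<close> by (auto simp: field_simps)
    finally show "\<bar>LINT x|M. f x * u x\<bar> \<le> 0 + e" by simp
  qed
  then show ?thesis by simp
qed

text \<open>Identity theorem from zeros that merely accumulate at \<open>0\<close> from the right.
  If all coefficients below \<open>m\<close> vanish, \<open>S x / x ^ m\<close> tends to
  \<open>A m\<close> as \<open>x\<close> tends to \<open>0\<close>, and a nonzero limit would
  exclude such zeros.\<close>

lemma powser_coeff_eq_0:
  fixes A :: "nat \<Rightarrow> real"
  assumes "0 < \<rho>"
    and sums: "\<And>x. 0 < x \<Longrightarrow> x < \<rho> \<Longrightarrow> (\<lambda>k. A k * x ^ k) sums S x"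
    and zero: "\<exists>\<^sub>F x in at_right 0. S x = 0"
  shows "A k = 0"
proof (induction k rule: less_induct)
  case (less m)
  let ?B = "\<lambda>k. A (k + m)"
  have shift: "(\<lambda>k. ?B k * x ^ k) sums (S x / x ^ m)" if "0 < x" "x < \<rho>" for x
  proof -
    have "(\<lambda>k. A (k + m) * x ^ (k + m)) sums S x"
      using sums_split_initial_segment[OF sums[OF that], of m] less by simp
    then have "(\<lambda>k. (A (k + m) * x ^ (k + m)) / x ^ m) sums (S x / x ^ m)"
      by (rule sums_divide)
    moreover have "(A (k + m) * x ^ (k + m)) / x ^ m = ?B k * x ^ k" for k
      using that by (simp add: power_add)
    ultimately show ?thesis by simp
  qed
  \<comment> \<open>The series is given for positive arguments only; convergence at \<open>r\<close>
    supplies it for all arguments of absolute value below \<open>r\<close>.\<close>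
  define r where "r = \<rho> / 2"
  have r: "0 < r" "r < \<rho>" using assms(1) by (auto simp: r_def)
  have summ: "summable (\<lambda>k. ?B k * x ^ k)" if "norm x < r" for x
    using powser_inside[of ?B r x] shift[OF r] that r by (simp add: sums_iff)
  have lim: "((\<lambda>x. \<Sum>k. ?B k * x ^ k) \<longlongrightarrow> ?B 0) (at 0)"
    by (rule powser_limit_0[OF r(1)]) (use summ in \<open>auto intro: summable_sums\<close>)
  show ?case
  proof (rule ccontr)
    assume "A m \<noteq> 0"
    then have "\<forall>\<^sub>F x in at 0. (\<Sum>k. ?B k * x ^ k) \<noteq> 0"
      using tendsto_imp_eventually_ne[OF lim, of 0] by simp
    then have "\<forall>\<^sub>F x in at_right 0. (\<Sum>k. ?B k * x ^ k) \<noteq> 0"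
      by (simp add: eventually_at_split)
    moreover have "\<forall>\<^sub>F x in at_right 0. 0 < x \<and> x < \<rho>"
      using eventually_at_right_real[OF assms(1)] by simp
    ultimately have "\<forall>\<^sub>F x in at_right 0. S x \<noteq> 0"
    proof eventually_elim
      case (elim x)
      then show ?case using sums_unique[OF shift[of x]] by auto
    qed
    with zero show False by (simp add: frequently_def)
  qed
qed

text \<open>The terms are dominated by
  \<open>\<bar>c k\<bar> * (x * Q) ^ k * \<bar>F y\<bar>\<close>, whose integrals are summable
  because \<open>x * Q < 1\<close>; so sum and integral may be exchanged.\<close>

lemma powser_integral_sums:
  fixes F q :: "'a \<Rightarrow> real" and c :: "nat \<Rightarrow> real"
  assumes F: "integrable M F" and q [measurable]: "q \<in> borel_measurable M"
    and Q: "AE y in M. F y \<noteq> 0 \<longrightarrow> \<bar>q y\<bar> \<le> Q" and "0 \<le> Q"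
    and c: "\<And>z. 0 \<le> z \<Longrightarrow> z < 1 \<Longrightarrow> summable (\<lambda>k. \<bar>c k\<bar> * z ^ k)"
    and x: "0 \<le> x" "x * Q < 1"
  shows "(\<lambda>k. (c k * (LINT y|M. F y * q y ^ k)) * x ^ k) sums
      (LINT y|M. F y * (\<Sum>k. c k * (x * q y) ^ k))"
proof -
  note [measurable] = borel_measurable_integrable[OF F]
  have bound: "AE y in M. norm (F y * (c k * (x * q y) ^ k)) \<le> (\<bar>c k\<bar> * (x * Q) ^ k) * \<bar>F y\<bar>" for k
    using Q
  proof eventually_elim
    case (elim y)
    show ?case
    proof (cases "F y = 0")
      case False
      then have "\<bar>x * q y\<bar> ^ k \<le> (x * Q) ^ k"
        using elim x by (intro power_mono) (auto simp: abs_mult intro!: mult_left_mono)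
      then have "\<bar>c k\<bar> * \<bar>x * q y\<bar> ^ k * \<bar>F y\<bar> \<le> (\<bar>c k\<bar> * (x * Q) ^ k) * \<bar>F y\<bar>"
        by (intro mult_right_mono mult_left_mono) auto
      then show ?thesis by (simp add: abs_mult power_abs mult_ac)
    qed simp
  qed
  have xQ: "0 \<le> x * Q" using assms by simp
  have int: "integrable M (\<lambda>y. F y * (c k * (x * q y) ^ k))" for k
    by (rule Bochner_Integration.integrable_bound[OF integrable_mult_right[OF integrable_abs[OF F], of "\<bar>c k\<bar> * (x * Q) ^ k"]])
       (use bound[of k] xQ in \<open>auto simp: abs_mult power_abs abs_of_nonneg zero_le_mult_iff\<close>)
  have all: "AE y in M. \<forall>k. norm (F y * (c k * (x * q y) ^ k)) \<le> (\<bar>c k\<bar> * (x * Q) ^ k) * \<bar>F y\<bar>"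
    using bound by (simp add: AE_all_countable)
  have sm: "summable (\<lambda>k. (\<bar>c k\<bar> * (x * Q) ^ k) * C)" for C
    using c[OF xQ x(2)] by (rule summable_mult2)
  have AEsum: "AE y in M. summable (\<lambda>k. norm (F y * (c k * (x * q y) ^ k)))"
    using all
  proof eventually_elim
    case (elim y)
    show ?case
      by (rule summable_comparison_test'[OF sm[of "\<bar>F y\<bar>"], of 0]) (use elim in simp)
  qed
  have sums: "(\<lambda>k. LINT y|M. F y * (c k * (x * q y) ^ k)) sums
      (LINT y|M. (\<Sum>k. F y * (c k * (x * q y) ^ k)))"
  proof (rule sums_integral[OF int AEsum])
    show "summable (\<lambda>k. LINT y|M. norm (F y * (c k * (x * q y) ^ k)))"
    proof (rule summable_comparison_test'[OF sm[of "LINT y|M. \<bar>F y\<bar>"], of 0])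
      fix k
      have "(LINT y|M. norm (F y * (c k * (x * q y) ^ k))) \<le> (LINT y|M. (\<bar>c k\<bar> * (x * Q) ^ k) * \<bar>F y\<bar>)"
        by (rule integral_mono_AE[OF integrable_norm[OF int] _ bound]) (use F in simp)
      then show "norm (LINT y|M. norm (F y * (c k * (x * q y) ^ k))) \<le> (\<bar>c k\<bar> * (x * Q) ^ k) * (LINT y|M. \<bar>F y\<bar>)"
        by simp
    qed
  qed
  have "(LINT y|M. (\<Sum>k. F y * (c k * (x * q y) ^ k))) = (LINT y|M. F y * (\<Sum>k. c k * (x * q y) ^ k))"
  proof (rule integral_cong_AE)
    show "AE y in M. (\<Sum>k. F y * (c k * (x * q y) ^ k)) = F y * (\<Sum>k. c k * (x * q y) ^ k)"
      using AEsum
    proof eventually_elim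
      case (elim y)
      show ?case
      proof (cases "F y = 0")
        case False
        have "summable (\<lambda>k. F y * (c k * (x * q y) ^ k))"
          using elim by (rule summable_norm_cancel)
        then have "summable (\<lambda>k. c k * (x * q y) ^ k)"
          using False by (simp add: summable_cmult_iff)
        then show ?thesis by (rule suminf_mult)
      qed simp
    qed
  qed measurable
  moreover have "(LINT y|M. F y * (c k * (x * q y) ^ k)) = (c k * (LINT y|M. F y * q y ^ k)) * x ^ k" for k
  proof -
    have "(LINT y|M. F y * (c k * (x * q y) ^ k)) = (LINT y|M. (c k * x ^ k) * (F y * q y ^ k))"
      by (intro Bochner_Integration.integral_cong) (auto simp: power_mult_distrib)
    then show ?thesis by simp
  qed
  ultimately show ?thesis using sums by simp
qed

text \<open>Polynomials in \<open>(1 / x)\<^sup>2\<close> form an algebra that separates the points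
  of \<open>{a..b}\<close>, since \<open>0 < a\<close>. To use only exponents from
  \<open>2 * N\<close> on, the function \<open>x ^ (2 * N) * u x\<close> is approximated and the
  factor divided out again.\<close>

lemma AE_zero_of_inverse_power_moments:
  fixes f :: "real \<Rightarrow> real"
  assumes f: "integrable lborel f" and supp: "\<And>x. x \<notin> {a..b} \<Longrightarrow> f x = 0" and "0 < a"
    and zero: "\<And>n. N \<le> n \<Longrightarrow> (LINT x|lborel. f x * (1 / x) ^ (2 * n)) = 0"
  shows "AE x in lborel. f x = 0"
proof -
  have f_nz: "x \<in> {a..b}" if "f x \<noteq> 0" for x using supp that by blast
  have pw: "\<bar>(1 / x) ^ k\<bar> \<le> (1 / a) ^ k" if "x \<in> {a..b}" for x and k :: nat
    using that \<open>0 < a\<close> unfolding power_abs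
    by (intro power_mono) (auto simp: field_simps)
  have poly0: "(LINT x|lborel. f x * ((1 / x) ^ (2 * N) * poly p ((1 / x)\<^sup>2))) = 0" for p :: "real poly"
  proof -
    have "(LINT x|lborel. f x * ((1 / x) ^ (2 * N) * poly p ((1 / x)\<^sup>2))) =
        (LINT x|lborel. (\<Sum>j\<le>degree p. coeff p j * (f x * (1 / x) ^ (2 * (N + j)))))"
      by (intro Bochner_Integration.integral_cong)
         (auto simp: poly_altdef sum_distrib_left power_mult[symmetric] power_add algebra_simps)
    also have "\<dots> = (\<Sum>j\<le>degree p. (LINT x|lborel. coeff p j * (f x * (1 / x) ^ (2 * (N + j)))))"
    proof (rule Bochner_Integration.integral_sum)
      fix j
      have "integrable lborel (\<lambda>x. f x * (1 / x) ^ (2 * (N + j)))"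
        by (rule integrable_mult_bounded[OF f _ pw[OF f_nz]]) auto
      then show "integrable lborel (\<lambda>x. coeff p j * (f x * (1 / x) ^ (2 * (N + j))))" by simp
    qed
    also have "\<dots> = 0"
      by (simp only: integral_mult_right_zero zero le_add1 mult_zero_right sum.neutral_const)
    finally show ?thesis .
  qed
  have "AE x in lborel. x \<in> {a<..<b} \<longrightarrow> f x = 0"
  proof (rule AE_zero_of_Lipschitz_tests[OF f])
    fix u C assume u: "\<And>x y. \<bar>u x - u y\<bar> \<le> C * \<bar>x - y\<bar>" and "\<And>x. x \<notin> {a<..<b} \<Longrightarrow> u x = 0"
    have cu: "continuous_on S u" for S by (rule Lipschitz_continuous_on[OF u])
    have "bounded (u ` {a..b})" by (intro compact_imp_bounded compact_continuous_image cu compact_Icc)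
    then obtain B where B: "\<And>x. x \<in> {a..b} \<Longrightarrow> \<bar>u x\<bar> \<le> B"
      unfolding bounded_iff by (metis imageI real_norm_def)
    show "(LINT x|lborel. f x * u x) = 0"
    proof (rule integral_mult_eq_0_of_approx[OF f _ B[OF f_nz]])
      show "u \<in> borel_measurable lborel" using cu by (simp add: borel_measurable_continuous_onI)
    next
      fix e0 :: real assume "e0 > 0"
      \<comment> \<open>Undoing the factor \<open>x ^ (2 * N)\<close> magnifies errors by at most
        \<open>(1 / a) ^ (2 * N)\<close>, which this choice compensates.\<close>
      define e where "e = e0 * a ^ (2 * N)"
      have e: "e > 0" using \<open>e0 > 0\<close> \<open>0 < a\<close> by (simp add: e_def)
      have "\<exists>g. (\<exists>p::real poly. \<forall>x. g x = poly p ((1 / x)\<^sup>2)) \<and> (\<forall>x\<in>{a..b}. \<bar>x ^ (2 * N) * u x - g x\<bar> < e)"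
      proof (rule Stone_Weierstrass_HOL)
        show "continuous_on {a..b} (\<lambda>x. x ^ (2 * N) * u x)" by (intro continuous_intros cu)
        show "\<exists>p. \<forall>x. c = poly p ((1 / x)\<^sup>2)" for c :: real
          by (rule exI[of _ "[:c:]"]) simp
        show "continuous_on {a..b} g" if "\<exists>p. \<forall>x. g x = poly p ((1 / x)\<^sup>2)" for g :: "real \<Rightarrow> real"
        proof -
          from that obtain p where "g = (\<lambda>x. poly p ((1 / x)\<^sup>2))" by auto
          then show ?thesis using \<open>0 < a\<close> by (auto intro!: continuous_intros)
        qed
        show "\<exists>p. \<forall>x. g x + h x = poly p ((1 / x)\<^sup>2)"
          if "(\<exists>p. \<forall>x. g x = poly p ((1 / x)\<^sup>2)) \<and> (\<exists>p. \<forall>x. h x = poly p ((1 / x)\<^sup>2))"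
          for g h :: "real \<Rightarrow> real"
          using that by (metis poly_add)
        show "\<exists>p. \<forall>x. g x * h x = poly p ((1 / x)\<^sup>2)"
          if "(\<exists>p. \<forall>x. g x = poly p ((1 / x)\<^sup>2)) \<and> (\<exists>p. \<forall>x. h x = poly p ((1 / x)\<^sup>2))"
          for g h :: "real \<Rightarrow> real"
          using that by (metis poly_mult)
        show "\<exists>g. (\<exists>p. \<forall>x. g x = poly p ((1 / x)\<^sup>2)) \<and> g x \<noteq> g y"
          if "x \<in> {a..b} \<and> y \<in> {a..b} \<and> x \<noteq> y" for x y
        proof (intro exI[of _ "\<lambda>x. (1 / x)\<^sup>2"] conjI exI[of _ "[:0, 1:]"] allI)
          show "(1 / x)\<^sup>2 \<noteq> (1 / y)\<^sup>2"
            using that \<open>0 < a\<close> by (auto simp: power_divide field_simps power2_eq_iff)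
        qed auto
      qed (use e in auto)
      then obtain p :: "real poly" where p: "\<And>x. x \<in> {a..b} \<Longrightarrow> \<bar>x ^ (2 * N) * u x - poly p ((1 / x)\<^sup>2)\<bar> < e"
        by metis
      have est: "\<bar>u x - (1 / x) ^ (2 * N) * poly p ((1 / x)\<^sup>2)\<bar> \<le> e0" if x: "x \<in> {a..b}" for x
      proof -
        have "u x - (1 / x) ^ (2 * N) * poly p ((1 / x)\<^sup>2) =
            (x ^ (2 * N) * u x - poly p ((1 / x)\<^sup>2)) * (1 / x) ^ (2 * N)"
          using x \<open>0 < a\<close> by (simp add: field_simps power_one_over)
        then have "\<bar>u x - (1 / x) ^ (2 * N) * poly p ((1 / x)\<^sup>2)\<bar> =
            \<bar>x ^ (2 * N) * u x - poly p ((1 / x)\<^sup>2)\<bar> * \<bar>(1 / x) ^ (2 * N)\<bar>"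
          by (simp only: abs_mult)
        also have "\<dots> \<le> e * (1 / a) ^ (2 * N)"
          using p[OF x] pw[OF x, of "2 * N"] by (intro mult_mono) auto
        also have "\<dots> = e0" using \<open>0 < a\<close> by (simp add: e_def power_one_over)
        finally show ?thesis .
      qed
      have [measurable]: "poly p \<in> borel_measurable borel"
        by (intro borel_measurable_continuous_onI continuous_intros)
      show "\<exists>w\<in>borel_measurable lborel. (\<forall>x. f x \<noteq> 0 \<longrightarrow> \<bar>u x - w x\<bar> \<le> e0) \<and> (LINT x|lborel. f x * w x) = 0"
        using est f_nz poly0[of p]
        by (intro bexI[of _ "\<lambda>x. (1 / x) ^ (2 * N) * poly p ((1 / x)\<^sup>2)"]) auto
    qed
  qed
  then have "AE x in lborel. x \<noteq> a \<and> x \<noteq> b \<longrightarrow> f x = 0"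
    by eventually_elim (use supp in force)
  moreover have "AE x in lborel. x \<noteq> a" "AE x in lborel. x \<noteq> b"
    by (auto intro: AE_lborel_singleton)
  ultimately show ?thesis by eventually_elim auto
qed

text \<open>The map \<open>e\<close> wraps \<open>{a..b}\<close> around the unit circle and glues
  the end points. Test functions vanish at both ends, hence factor through the circle, where the
  Stone-Weierstrass theorem approximates them by real trigonometric polynomials.\<close>

lemma AE_zero_of_Fourier_coefficients:
  fixes f :: "real \<Rightarrow> real"
  assumes f: "integrable lborel f" and supp: "\<And>x. x \<notin> {a..b} \<Longrightarrow> f x = 0" and "a < b"
    and \<omega>: "\<omega> = 2 * pi / (b - a)"
    and cos0: "\<And>k::nat. (LINT x|lborel. f x * cos (real k * \<omega> * x)) = 0"
    and sin0: "\<And>k::nat. (LINT x|lborel. f x * sin (real k * \<omega> * x)) = 0"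
  shows "AE x in lborel. f x = 0"
proof -
  note [measurable] = borel_measurable_integrable[OF f]
  have f_nz: "x \<in> {a..b}" if "f x \<noteq> 0" for x using supp that by blast
  have \<omega>0: "\<omega> > 0" using \<omega> \<open>a < b\<close> by simp
  define e where "e = (\<lambda>x. cis (\<omega> * (x - a)))"
  have e1: "norm (e x) = 1" for x by (simp add: e_def)
  have ce: "continuous_on S e" for S
    unfolding e_def by (intro continuous_intros)
  have cint: "complex_integrable lborel (\<lambda>x. complex_of_real (f x) * cis (v x))"
    if [measurable]: "v \<in> borel_measurable borel" for v
  proof (rule Bochner_Integration.integrable_bound[OF f])
    have "(\<lambda>x. cis (v x)) \<in> borel_measurable borel"
      by (rule borel_measurable_continuous_on[of cis]) (auto intro!: continuous_intros)
    then show "(\<lambda>x. complex_of_real (f x) * cis (v x)) \<in> borel_measurable lborel"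
      by simp
  qed (auto simp: norm_mult)
  have Re_cis: "(LINT x|lborel. complex_of_real (f x) * cis (v x)) =
      Complex (LINT x|lborel. f x * cos (v x)) (LINT x|lborel. f x * sin (v x))"
    if [measurable]: "v \<in> borel_measurable borel" for v
    by (rule complex_eqI)
       (simp_all add: cint[OF that] flip: integral_Re integral_Im)
  have coeff_nat: "(LINT x|lborel. complex_of_real (f x) * cis (of_int j * \<omega> * x)) = 0" for j :: int
  proof (cases "j \<ge> 0")
    case True
    then show ?thesis
      using cos0[of "nat j"] sin0[of "nat j"] by (subst Re_cis) (auto simp: complex_eq_iff)
  next
    case False
    then show ?thesis
      using cos0[of "nat (- j)"] sin0[of "nat (- j)"] by (subst Re_cis) (auto simp: complex_eq_iff)
  qed
  have coeff0: "(LINT x|lborel. complex_of_real (f x) * (e x powi j)) = 0" for j :: int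
  proof -
    have "complex_of_real (f x) * (e x powi j) =
        cis (- (of_int j * \<omega> * a)) * (complex_of_real (f x) * cis (of_int j * \<omega> * x))" for x
      by (simp add: e_def cis_power_int cis_mult algebra_simps)
    then show ?thesis using coeff_nat[of j] by (simp only: integral_mult_right_zero mult_zero_right)
  qed
  \<comment> \<open>A real trigonometric polynomial is encoded as a real function \<open>h\<close>
    for which \<open>z ^ K * h z\<close> is a polynomial on the circle; dividing by
    \<open>z ^ K\<close> expresses it through integer powers of \<open>e x\<close>.\<close>
  have trig0: "(LINT x|lborel. f x * h (e x)) = 0"
    if h: "\<And>z. z \<in> sphere 0 1 \<Longrightarrow> z ^ K * complex_of_real (h z) = poly p z" for h p K
  proof -
    have hx: "complex_of_real (h (e x)) = (\<Sum>j\<le>degree p. coeff p j * e x powi (int j - int K))" for x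
    proof -
      have ex: "e x \<noteq> 0" by (simp add: e_def)
      have "complex_of_real (h (e x)) = poly p (e x) / e x ^ K"
        using h[of "e x"] e1[of x] ex by (simp add: field_simps)
      also have "\<dots> = (\<Sum>j\<le>degree p. coeff p j * e x powi (int j - int K))"
        using ex by (simp add: poly_altdef sum_divide_distrib power_int_diff)
      finally show ?thesis .
    qed
    have "complex_of_real (LINT x|lborel. f x * h (e x)) = (LINT x|lborel. complex_of_real (f x * h (e x)))"
      by (rule integral_complex_of_real[symmetric])
    also have "\<dots> = (LINT x|lborel. (\<Sum>j\<le>degree p. coeff p j * (complex_of_real (f x) * e x powi (int j - int K))))"
      by (simp add: hx sum_distrib_left mult_ac)
    also have "\<dots> = (\<Sum>j\<le>degree p. (LINT x|lborel. coeff p j * (complex_of_real (f x) * e x powi (int j - int K))))"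
    proof (rule Bochner_Integration.integral_sum)
      fix j
      have "complex_integrable lborel (\<lambda>x. complex_of_real (f x) * e x powi (int j - int K))"
        unfolding e_def cis_power_int by (rule cint) simp
      then show "complex_integrable lborel (\<lambda>x. coeff p j * (complex_of_real (f x) * e x powi (int j - int K)))"
        by simp
    qed
    also have "\<dots> = 0" by (simp add: coeff0)
    finally show ?thesis by simp
  qed
  \<comment> \<open>A section of \<open>e\<close> with values in \<open>[a, b)\<close>; it jumps at
    \<open>z = 1\<close>.\<close>
  define q where "q = (\<lambda>z. a + Arg2pi z / \<omega>)"
  have q: "q z \<in> {a..b} \<and> e (q z) = z" if "norm z = 1" for z
  proof -
    have "Arg2pi z / \<omega> \<le> 2 * pi / \<omega>" using Arg2pi_lt_2pi[of z] \<omega>0 by (intro divide_right_mono) auto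
    then have "Arg2pi z / \<omega> \<le> b - a" using \<omega> \<open>a < b\<close> by simp
    moreover have "Arg2pi z / \<omega> \<ge> 0" using Arg2pi_ge_0[of z] \<omega>0 by simp
    moreover have "e (q z) = z"
      using that Arg2pi_eq[of z] \<omega>0 by (simp add: e_def q_def cis_conv_exp mult.commute)
    ultimately show ?thesis by (auto simp: q_def)
  qed
  have "AE x in lborel. x \<in> {a<..<b} \<longrightarrow> f x = 0"
  proof (rule AE_zero_of_Lipschitz_tests[OF f])
    fix u C assume u: "\<And>x y. \<bar>u x - u y\<bar> \<le> C * \<bar>x - y\<bar>" and uz: "\<And>x. x \<notin> {a<..<b} \<Longrightarrow> u x = 0"
    have cu: "continuous_on S u" for S by (rule Lipschitz_continuous_on[OF u])
    have "bounded (u ` {a..b})" by (intro compact_imp_bounded compact_continuous_image cu compact_Icc)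
    then obtain B where B: "\<And>x. x \<in> {a..b} \<Longrightarrow> \<bar>u x\<bar> \<le> B"
      unfolding bounded_iff by (metis imageI real_norm_def)
    \<comment> \<open>Only at \<open>b\<close> does \<open>q\<close> miss the original point: there
      \<open>q (e b) = a\<close>, and \<open>u\<close> vanishes at both ends.\<close>
    have uq: "u (q (e x)) = u x" if x: "x \<in> {a..b}" for x
    proof (cases "x = b")
      case True
      then have "e x = 1" using \<omega> \<open>a < b\<close> by (simp add: e_def)
      then show ?thesis using True uz[of a] uz[of b] by (simp add: q_def Arg2pi_of_real[of 1, simplified])
    next
      case False
      have "\<omega> * (x - a) < \<omega> * (b - a)" using False x \<omega>0 by (intro mult_strict_left_mono) auto
      also have "\<dots> = 2 * pi" using \<omega> \<open>a < b\<close> by simp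
      finally have "Arg2pi (e x) = \<omega> * (x - a)"
        using x \<omega>0 by (intro Arg2pi_unique[of 1]) (auto simp: e_def cis_conv_exp)
      then show ?thesis using \<omega>0 by (simp add: q_def)
    qed
    show "(LINT x|lborel. f x * u x) = 0"
    proof (rule integral_mult_eq_0_of_approx[OF f _ B[OF f_nz]])
      show "u \<in> borel_measurable lborel" using cu by (simp add: borel_measurable_continuous_onI)
    next
      fix d :: real assume d: "d > 0"
      \<comment> \<open>Although \<open>q\<close> is discontinuous, \<open>u \<circ> q\<close> is
        continuous: the preimage of a closed set is the image under \<open>e\<close> of a compact
        set.\<close>
      have cU: "continuous_on (sphere 0 1) (\<lambda>z. u (q z))"
        unfolding continuous_closedin_preimage_eq
      proof (intro allI impI)
        fix T :: "real set" assume T: "closed T"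
        have "sphere 0 1 \<inter> (\<lambda>z. u (q z)) -` T = e ` ({a..b} \<inter> u -` T)"
        proof (intro equalityI subsetI)
          fix z assume "z \<in> sphere 0 1 \<inter> (\<lambda>z. u (q z)) -` T"
          then show "z \<in> e ` ({a..b} \<inter> u -` T)" using q[of z] by (intro image_eqI[of _ _ "q z"]) auto
        qed (auto simp: e1 uq)
        moreover have "compact ({a..b} \<inter> u -` T)"
          using continuous_closed_preimage[OF cu[of "{a..b}"] closed_atLeastAtMost T]
          by (auto simp: compact_eq_bounded_closed intro: bounded_subset[OF bounded_closed_interval[of a b]])
        ultimately have "closed (sphere 0 1 \<inter> (\<lambda>z. u (q z)) -` T)"
          by (simp add: compact_imp_closed compact_continuous_image[OF ce])
        then show "closedin (top_of_set (sphere 0 1)) (sphere 0 1 \<inter> (\<lambda>z. u (q z)) -` T)"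
          by (auto intro: closed_subset)
      qed
      let ?P = "\<lambda>g. continuous_on (sphere 0 1) g \<and>
        (\<exists>p K. \<forall>z\<in>sphere 0 1. z ^ K * complex_of_real (g z) = poly p z)"
      have "\<exists>g. ?P g \<and> (\<forall>z\<in>sphere 0 1. \<bar>u (q z) - g z\<bar> < d)"
      proof (rule Stone_Weierstrass_HOL)
        show "?P (\<lambda>z. c)" for c
          by (intro conjI exI[of _ "[:complex_of_real c:]"] exI[of _ 0]) auto
        show "continuous_on (sphere 0 1) g" if "?P g" for g using that by blast
        show "?P (\<lambda>z. g z + h z)" if gh: "?P g \<and> ?P h" for g h
        proof -
          from gh obtain p K p' K' where
            1: "\<And>z. z \<in> sphere 0 1 \<Longrightarrow> z ^ K * complex_of_real (g z) = poly p z" and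
            2: "\<And>z. z \<in> sphere 0 1 \<Longrightarrow> z ^ K' * complex_of_real (h z) = poly p' z" by blast
          then have "\<forall>z\<in>sphere 0 1. z ^ (K + K') * complex_of_real (g z + h z) = poly (p * monom 1 K' + p' * monom 1 K) z"
            by (simp add: poly_monom power_add algebra_simps flip: 1 2)
          moreover have "continuous_on (sphere 0 1) (\<lambda>z. g z + h z)" using gh by (intro continuous_intros) auto
          ultimately show ?thesis by blast
        qed
        show "?P (\<lambda>z. g z * h z)" if gh: "?P g \<and> ?P h" for g h
        proof -
          from gh obtain p K p' K' where
            1: "\<And>z. z \<in> sphere 0 1 \<Longrightarrow> z ^ K * complex_of_real (g z) = poly p z" and
            2: "\<And>z. z \<in> sphere 0 1 \<Longrightarrow> z ^ K' * complex_of_real (h z) = poly p' z" by blast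
          then have "\<forall>z\<in>sphere 0 1. z ^ (K + K') * complex_of_real (g z * h z) = poly (p * p') z"
            by (simp add: power_add algebra_simps flip: 1 2)
          moreover have "continuous_on (sphere 0 1) (\<lambda>z. g z * h z)" using gh by (intro continuous_intros) auto
          ultimately show ?thesis by blast
        qed
        show "\<exists>g. ?P g \<and> g z \<noteq> g w" if zw: "z \<in> sphere 0 1 \<and> w \<in> sphere 0 1 \<and> z \<noteq> w" for z w :: complex
        proof -
          have inv: "z * cnj z = 1" if "z \<in> sphere 0 1" for z
            using that complex_norm_square[of z] by simp
          \<comment> \<open>On the circle \<open>cnj z\<close> is the inverse of \<open>z\<close>,
            so \<open>z * Re z\<close> and \<open>z * Im z\<close> become quadratic polynomials in
            \<open>z\<close>. Together \<open>Re\<close> and \<open>Im\<close> separate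
            points.\<close>
          have "?P Re"
          proof (intro conjI exI[of _ "[:1/2, 0, 1/2:]"] exI[of _ 1] ballI)
            fix z :: complex assume z: "z \<in> sphere 0 1"
            have "complex_of_real (Re z) = (z + cnj z) / 2" by (simp add: complex_add_cnj)
            then show "z ^ 1 * complex_of_real (Re z) = poly [:1/2, 0, 1/2:] z"
              using inv[OF z] by (simp add: algebra_simps add_divide_distrib)
          qed (intro continuous_intros)
          moreover have "?P Im"
          proof (intro conjI exI[of _ "[:\<i>/2, 0, -\<i>/2:]"] exI[of _ 1] ballI)
            fix z :: complex assume z: "z \<in> sphere 0 1"
            have Im: "complex_of_real (Im z) = (z - cnj z) * (-\<i>/2)" by (simp add: complex_eq_iff)
            have "z ^ 1 * complex_of_real (Im z) = z * z * (-\<i>/2) + z * cnj z * (\<i>/2)"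
              unfolding Im by (simp add: field_simps)
            also have "\<dots> = poly [:\<i>/2, 0, -\<i>/2:] z"
              unfolding inv[OF z] by (simp add: algebra_simps)
            finally show "z ^ 1 * complex_of_real (Im z) = poly [:\<i>/2, 0, -\<i>/2:] z" .
          qed (intro continuous_intros)
          ultimately show ?thesis using zw by (metis complex_eqI)
        qed
      qed (use d cU in auto)
      then obtain g p K where cg: "continuous_on (sphere 0 1) g"
        and g: "\<And>z. z \<in> sphere 0 1 \<Longrightarrow> z ^ K * complex_of_real (g z) = poly p z"
        and gd: "\<And>z. z \<in> sphere 0 1 \<Longrightarrow> \<bar>u (q z) - g z\<bar> < d"
        by metis
      have "continuous_on UNIV (\<lambda>x. g (e x))"
        by (rule continuous_on_compose2[OF cg ce]) (auto simp: e1)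
      then have "(\<lambda>x. g (e x)) \<in> borel_measurable lborel" by (simp add: borel_measurable_continuous_onI)
      moreover have "\<bar>u x - g (e x)\<bar> \<le> d" if "f x \<noteq> 0" for x
        using gd[of "e x"] uq[OF f_nz[OF that]] by (simp add: e1)
      moreover have "(LINT x|lborel. f x * g (e x)) = 0" by (rule trig0[OF g])
      ultimately show "\<exists>w\<in>borel_measurable lborel. (\<forall>x. f x \<noteq> 0 \<longrightarrow> \<bar>u x - w x\<bar> \<le> d) \<and> (LINT x|lborel. f x * w x) = 0"
        by (intro bexI[of _ "\<lambda>x. g (e x)"]) auto
    qed
  qed
  then have "AE x in lborel. x \<noteq> a \<and> x \<noteq> b \<longrightarrow> f x = 0"
    by eventually_elim (use supp in force)
  moreover have "AE x in lborel. x \<noteq> a" "AE x in lborel. x \<noteq> b"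
    by (auto intro: AE_lborel_singleton)
  ultimately show ?thesis by eventually_elim auto
qed

section \<open>The transport equation\<close>

lemma AE_lebesgue_on_iff:
  assumes "S \<in> sets borel"
  shows "(AE x in lebesgue_on S. P x) \<longleftrightarrow> (AE x in lborel. x \<in> S \<longrightarrow> P x)"
  using assms by (simp add: AE_restrict_space_iff AE_completion_iff)

text \<open>Passage from Lebesgue measurable functions on \<open>S\<close> to Borel functions on the
  line, where Fubini's theorem and affine substitutions are applied.\<close>

lemma integral_lebesgue_on_eq:
  fixes f h :: "real \<Rightarrow> real"
  assumes S [measurable]: "S \<in> sets borel" and f: "f \<in> borel_measurable (lebesgue_on S)"
    and h [measurable]: "h \<in> borel_measurable borel"
    and eq: "AE x in lborel. x \<in> S \<longrightarrow> f x = h x"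
  shows "(LINT x|lebesgue_on S. f x) = (LINT x|lborel. indicator S x * h x)"
proof -
  have hl: "h \<in> borel_measurable (lebesgue_on S)"
    by (rule measurable_restrict_space1) (simp add: measurable_completion)
  have "(LINT x|lebesgue_on S. f x) = (LINT x|lebesgue_on S. h x)"
    by (rule integral_cong_AE[OF f hl]) (use eq in \<open>simp add: AE_lebesgue_on_iff\<close>)
  also have "\<dots> = (LINT x|lebesgue. indicator S x * h x)"
    by (subst integral_restrict_space) auto
  also have "\<dots> = (LINT x|lborel. indicator S x * h x)"
    by (rule integral_completion) simp
  finally show ?thesis .
qed

text \<open>On a bounded interval square integrability implies integrability, by
  \<open>\<bar>y\<bar> \<le> 1 + y\<^sup>2\<close>. Extension by zero lets all later shifts take
  place on the whole line.\<close>

lemma L2_borel_representative: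
  assumes f: "f \<in> L2 a b"
  obtains h where "h \<in> borel_measurable borel" "integrable lborel h"
    "\<And>x. x \<notin> {a<..<b} \<Longrightarrow> h x = 0" "AE x in lborel. x \<in> {a<..<b} \<longrightarrow> f x = h x"
proof -
  let ?S = "{a<..<b}"
  have fm: "f \<in> borel_measurable (lebesgue_on ?S)" and f2: "integrable (lebesgue_on ?S) (\<lambda>x. (f x)\<^sup>2)"
    using f by (auto simp: L2_def)
  have "(\<lambda>x. indicator ?S x * f x) \<in> borel_measurable lebesgue"
    using fm by (subst (asm) borel_measurable_restrict_space_iff) auto
  then obtain g where g [measurable]: "g \<in> borel_measurable borel"
    and fg: "AE x in lborel. indicator ?S x * f x = g x"
    using completion_ex_borel_measurable_real by fastforce
  define h where "h = (\<lambda>x. indicator ?S x * g x)"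
  have hm [measurable]: "h \<in> borel_measurable borel" by (simp add: h_def)
  have eq: "AE x in lborel. x \<in> ?S \<longrightarrow> f x = h x"
    using fg by eventually_elim (auto simp: h_def)
  have "integrable lebesgue (\<lambda>x. indicator ?S x * (f x)\<^sup>2)"
    using f2 by (subst (asm) integrable_restrict_space) auto
  moreover have "AE x in lebesgue. indicator ?S x * (f x)\<^sup>2 = (h x)\<^sup>2"
    using eq unfolding AE_completion_iff by eventually_elim (auto simp: h_def indicator_def)
  ultimately have "integrable lebesgue (\<lambda>x. (h x)\<^sup>2)"
    by (subst integrable_cong_AE[symmetric, where f="\<lambda>x. indicator ?S x * (f x)\<^sup>2"])
       (auto simp: borel_measurable_integrable measurable_completion)
  then have h2: "integrable lborel (\<lambda>x. (h x)\<^sup>2)"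
    by (subst (asm) integrable_completion) auto
  have "integrable lborel (\<lambda>x. indicator ?S x + (h x)\<^sup>2)"
    by (intro Bochner_Integration.integrable_add h2) (cases "a < b", auto)
  then have "integrable lborel h"
  proof (rule Bochner_Integration.integrable_bound)
    show "AE x in lborel. norm (h x) \<le> norm (indicator ?S x + (h x)\<^sup>2)"
    proof (intro AE_I2)
      fix x
      have "\<bar>y\<bar> \<le> 1 + y\<^sup>2" for y :: real
      proof -
        have "0 \<le> (1 - \<bar>y\<bar>)\<^sup>2" by simp
        then have "2 * \<bar>y\<bar> \<le> 1 + y\<^sup>2" by (simp add: power2_diff)
        then show ?thesis by linarith
      qed
      then show "norm (h x) \<le> norm (indicator ?S x + (h x)\<^sup>2)"
        by (auto simp: h_def indicator_def)
    qed
  qed simp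
  with hm eq show thesis by (intro that[of h]) (auto simp: h_def)
qed

lemma continuous_imp_L2:
  assumes "continuous_on {a..b} f"
  shows "f \<in> L2 a b"
proof -
  have int: "integrable (lebesgue_on {a<..<b}) g" if "continuous_on {a..b} g" for g :: "real \<Rightarrow> real"
  proof -
    have "set_integrable lborel {a..b} g" using that by (rule borel_integrable_atLeastAtMost')
    then have "set_integrable lborel {a<..<b} g" by (rule set_integrable_subset) auto
    then have "set_integrable lebesgue {a<..<b} g"
      unfolding set_integrable_def by (subst integrable_completion) auto
    then show ?thesis by (simp add: integrable_restrict_space set_integrable_def)
  qed
  show ?thesis unfolding L2_def
    using int[OF assms] int[of "\<lambda>x. (f x)\<^sup>2"] assms
    by (auto intro: borel_measurable_integrable continuous_intros)
qed

lemma integral_lebesgue_on_Ioo: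
  fixes f :: "real \<Rightarrow> real"
  assumes "continuous_on {a..b} f"
  shows "(LINT x|lebesgue_on {a<..<b}. f x) = integral {a..b} f"
proof -
  have "set_integrable lborel {a..b} f" using assms by (rule borel_integrable_atLeastAtMost')
  then have "set_integrable lborel {a<..<b} f" by (rule set_integrable_subset) auto
  then have "set_integrable lebesgue {a<..<b} f"
    unfolding set_integrable_def by (subst integrable_completion) auto
  then have "integrable (lebesgue_on {a<..<b}) f" by (simp add: integrable_restrict_space set_integrable_def)
  then show ?thesis
    by (subst lebesgue_integral_eq_integral) (auto simp: integral_open_interval_real)
qed

text \<open>Integration by parts; there are no boundary terms because test functions vanish at
  \<open>a\<close> and \<open>b\<close>.\<close>

lemma has_L2_weak_deriv_classical:
  assumes "a < b" and der: "\<And>x. (\<phi> has_real_derivative \<phi>' x) (at x)" and c': "continuous_on UNIV \<phi>'"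
  shows "has_L2_weak_deriv a b \<phi> \<phi>'"
  unfolding has_L2_weak_deriv_def
proof (intro conjI allI impI)
  have c: "continuous_on S \<phi>" for S
    using der by (meson DERIV_continuous_on has_field_derivative_at_within)
  note c' = continuous_on_subset[OF c' subset_UNIV]
  show "\<phi> \<in> L2 a b" "\<phi>' \<in> L2 a b" using c c' by (auto intro: continuous_imp_L2)
  fix \<zeta> assume test: "test_function a b \<zeta>"
  then have d0: "(deriv ^^ n) \<zeta> differentiable (at x)" for n x by (simp add: test_function_def)
  have d: "(\<zeta> has_real_derivative deriv \<zeta> x) (at x)" for x
    using d0[of 0 x] by (simp add: DERIV_deriv_iff_real_differentiable)
  have "isCont (deriv \<zeta>) x" for x
    using d0[of 1 x] by (simp add: differentiable_imp_continuous_within)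
  then have cd: "continuous_on S (deriv \<zeta>)" for S by (simp add: continuous_at_imp_continuous_on)
  have cz: "continuous_on S \<zeta>" for S
    using d by (meson DERIV_continuous_on has_field_derivative_at_within)
  have ab: "\<zeta> a = 0" "\<zeta> b = 0" using test by (force simp: test_function_def)+
  have "((\<lambda>x. \<phi> x * deriv \<zeta> x + \<phi>' x * \<zeta> x) has_integral (\<phi> b * \<zeta> b - \<phi> a * \<zeta> a)) {a..b}"
  proof (rule fundamental_theorem_of_calculus)
    fix x
    have "((\<lambda>x. \<phi> x * \<zeta> x) has_real_derivative (\<phi> x * deriv \<zeta> x + \<phi>' x * \<zeta> x)) (at x)"
      using DERIV_mult[OF der d] by (simp add: mult.commute add.commute)
    then show "((\<lambda>x. \<phi> x * \<zeta> x) has_vector_derivative (\<phi> x * deriv \<zeta> x + \<phi>' x * \<zeta> x)) (at x within {a..b})"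
      by (auto simp: has_real_derivative_iff_has_vector_derivative intro: has_vector_derivative_at_within)
  qed (use \<open>a < b\<close> in simp)
  then have "integral {a..b} (\<lambda>x. \<phi> x * deriv \<zeta> x + \<phi>' x * \<zeta> x) = 0"
    using ab by (simp add: integral_unique)
  moreover have "integral {a..b} (\<lambda>x. \<phi> x * deriv \<zeta> x + \<phi>' x * \<zeta> x) =
      integral {a..b} (\<lambda>x. \<phi> x * deriv \<zeta> x) + integral {a..b} (\<lambda>x. \<phi>' x * \<zeta> x)"
    by (intro Henstock_Kurzweil_Integration.integral_add integrable_continuous_real continuous_intros c c' cd cz)
  ultimately show "(LINT x|lebesgue_on {a<..<b}. \<phi> x * deriv \<zeta> x) = - (LINT x|lebesgue_on {a<..<b}. \<phi>' x * \<zeta> x)"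
    by (simp add: integral_lebesgue_on_Ioo continuous_on_mult c c' cd cz)
qed

lemma X2_inner_single:
  "X2_inner a b f (\<lambda>j r. if j = i then u r else 0) = (LINT r|lebesgue_on {a<..<b}. f i r * u r)"
proof -
  have "(LINT r|lebesgue_on {a<..<b}. f j r * (if j = i then u r else 0)) =
      (if j = i then (LINT r|lebesgue_on {a<..<b}. f i r * u r) else 0)" for j
    by simp
  then show ?thesis by (simp add: X2_inner_def)
qed

text \<open>A test pair that is zero in the other component decouples the system. Continuously
  differentiable \<open>u\<close> are enough, since only trigonometric functions will be
  inserted.\<close>

lemma transport_solution_test:
  assumes sol: "transport_solution T a b G \<psi>0 \<psi>" and "a < b"
    and der: "\<And>x. (u has_real_derivative u' x) (at x)" and c': "continuous_on UNIV u'" and per: "u a = u b"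
    and t: "t \<in> {0..T}"
  shows "((\<lambda>t. LINT r|lebesgue_on {a<..<b}. \<psi> t i r * u r) has_real_derivative
      G i t * (LINT r|lebesgue_on {a<..<b}. \<psi> t i r * u' r)) (at t within {0..T})"
proof -
  have c: "continuous_on S u" for S
    using der by (meson DERIV_continuous_on has_field_derivative_at_within)
  have w: "has_L2_weak_deriv a b u u'" by (rule has_L2_weak_deriv_classical[OF \<open>a < b\<close> der c'])
  have z: "has_L2_weak_deriv a b (\<lambda>_. 0) (\<lambda>_. 0)" by (rule has_L2_weak_deriv_classical[OF \<open>a < b\<close>]) auto
  have H1: "v \<in> periodic_H1 a b" if "has_L2_weak_deriv a b v v'" "continuous_on {a..b} v" "v a = v b" for v v'
    using that unfolding periodic_H1_def One_nat_def sobolev_H.simps by (auto simp: has_L2_weak_deriv_def)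
  let ?\<phi> = "\<lambda>j r. if j = i then u r else 0" and ?\<phi>' = "\<lambda>j r. if j = i then u' r else 0"
  have adm: "\<forall>j. ?\<phi> j \<in> periodic_H1 a b \<and> has_L2_weak_deriv a b (?\<phi> j) (?\<phi>' j)"
  proof
    fix j
    show "?\<phi> j \<in> periodic_H1 a b \<and> has_L2_weak_deriv a b (?\<phi> j) (?\<phi>' j)"
      using H1[OF w c per] H1[OF z] w z by (cases "j = i") simp_all
  qed
  have weak: "has_C1_deriv_on (\<lambda>t. X2_inner a b (\<psi> t) \<phi>)
      (\<lambda>t. X2_inner a b (\<psi> t) (\<lambda>i r. G i t * \<phi>' i r)) {0..T}"
    if "\<forall>i. \<phi> i \<in> periodic_H1 a b \<and> has_L2_weak_deriv a b (\<phi> i) (\<phi>' i)" for \<phi> \<phi>'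
    using sol that by (simp add: transport_solution_def)
  have "has_C1_deriv_on (\<lambda>t. X2_inner a b (\<psi> t) ?\<phi>)
      (\<lambda>t. X2_inner a b (\<psi> t) (\<lambda>j r. G j t * ?\<phi>' j r)) {0..T}"
    by (rule weak[of ?\<phi> ?\<phi>', OF adm])
  then have "((\<lambda>t. X2_inner a b (\<psi> t) ?\<phi>) has_real_derivative X2_inner a b (\<psi> t) (\<lambda>j r. G j t * ?\<phi>' j r)) (at t within {0..T})"
    using t unfolding has_C1_deriv_on_def by blast
  moreover have "X2_inner a b (\<psi> t) (\<lambda>j r. G j t * ?\<phi>' j r) = X2_inner a b (\<psi> t) (\<lambda>j r. if j = i then G i t * u' r else 0)"
    by (rule arg_cong[where f="X2_inner a b (\<psi> t)"]) (auto simp: fun_eq_iff)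
  ultimately show ?thesis by (simp add: X2_inner_single mult.left_commute)
qed

text \<open>The pair \<open>(A, B)\<close> solves \<open>A' = - G i * k * \<omega> * B\<close> and
  \<open>B' = G i * k * \<omega> * A\<close>, so it rotates by the angle
  \<open>k * \<omega> * S t\<close>. Rotating back gives constants, which \<open>S 0 = 0\<close>
  identifies with the values at time \<open>0\<close>.\<close>

lemma transport_Fourier_coefficients:
  fixes k :: nat
  assumes sol: "transport_solution T a b G \<psi>0 \<psi>" and "a < b" and \<omega>: "\<omega> = 2 * pi / (b - a)"
    and S0: "S 0 = 0" and S: "\<And>t. t \<in> {0..T} \<Longrightarrow> (S has_real_derivative G i t) (at t within {0..T})"
    and t: "t \<in> {0..T}"
  defines "A \<equiv> \<lambda>t. LINT r|lebesgue_on {a<..<b}. \<psi> t i r * cos (real k * \<omega> * r)"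
    and "B \<equiv> \<lambda>t. LINT r|lebesgue_on {a<..<b}. \<psi> t i r * sin (real k * \<omega> * r)"
  shows "A t = A 0 * cos (real k * \<omega> * S t) - B 0 * sin (real k * \<omega> * S t)"
    and "B t = B 0 * cos (real k * \<omega> * S t) + A 0 * sin (real k * \<omega> * S t)"
proof -
  let ?k = "real k * \<omega>"
  have ab: "?k * b = ?k * a + 2 * real k * pi" using \<open>a < b\<close> by (simp add: \<omega> field_simps)
  have per: "cos (?k * a) = cos (?k * b)" "sin (?k * a) = sin (?k * b)"
    unfolding ab cos_add sin_add by (simp_all add: cos_2npi sin_2npi del: mult.assoc)
  have dA: "(A has_real_derivative G i t * (- ?k * B t)) (at t within {0..T})" if "t \<in> {0..T}" for t
  proof -
    have "(A has_real_derivative G i t * (LINT r|lebesgue_on {a<..<b}. \<psi> t i r * (- ?k * sin (?k * r)))) (at t within {0..T})"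
      unfolding A_def
      by (rule transport_solution_test[OF sol \<open>a < b\<close> _ _ per(1) that])
         (auto intro!: derivative_eq_intros continuous_intros)
    moreover have "(LINT r|lebesgue_on {a<..<b}. \<psi> t i r * (- ?k * sin (?k * r))) = - ?k * B t"
      unfolding B_def by (subst integral_mult_right_zero[symmetric]) (simp add: mult_ac)
    ultimately show ?thesis by simp
  qed
  have dB: "(B has_real_derivative G i t * (?k * A t)) (at t within {0..T})" if "t \<in> {0..T}" for t
  proof -
    have "(B has_real_derivative G i t * (LINT r|lebesgue_on {a<..<b}. \<psi> t i r * (?k * cos (?k * r)))) (at t within {0..T})"
      unfolding B_def
      by (rule transport_solution_test[OF sol \<open>a < b\<close> _ _ per(2) that])
         (auto intro!: derivative_eq_intros continuous_intros)
    moreover have "(LINT r|lebesgue_on {a<..<b}. \<psi> t i r * (?k * cos (?k * r))) = ?k * A t"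
      unfolding A_def by (subst integral_mult_right_zero[symmetric]) (simp add: mult_ac)
    ultimately show ?thesis by simp
  qed
  let ?c = "\<lambda>t. cos (?k * S t)" and ?s = "\<lambda>t. sin (?k * S t)"
  have 0: "0 \<in> {0..T}" using t by simp
  have "\<exists>c. \<forall>t\<in>{0..T}. A t * ?c t + B t * ?s t = c"
    by (rule has_field_derivative_zero_constant)
       (auto intro!: derivative_eq_intros dA dB S simp: algebra_simps)
  then obtain ce1 where "\<And>t. t \<in> {0..T} \<Longrightarrow> A t * ?c t + B t * ?s t = ce1" by blast
  from this[OF t] this[OF 0] have e1: "A t * ?c t + B t * ?s t = A 0" using S0 by simp
  have "\<exists>c. \<forall>t\<in>{0..T}. B t * ?c t - A t * ?s t = c"
    by (rule has_field_derivative_zero_constant)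
       (auto intro!: derivative_eq_intros dA dB S simp: algebra_simps)
  then obtain ce2 where "\<And>t. t \<in> {0..T} \<Longrightarrow> B t * ?c t - A t * ?s t = ce2" by blast
  from this[OF t] this[OF 0] have e2: "B t * ?c t - A t * ?s t = B 0" using S0 by simp
  have rot: "x = p * c - q * s \<and> y = q * c + p * s"
    if e: "x * c + y * s = p" "y * c - x * s = q" and "c\<^sup>2 + s\<^sup>2 = 1" for x y p q c s :: real
  proof -
    have "p * c - q * s = x * (c\<^sup>2 + s\<^sup>2)" "q * c + p * s = y * (c\<^sup>2 + s\<^sup>2)"
      unfolding e[symmetric] by (simp_all add: algebra_simps power2_eq_square)
    then show ?thesis using that by simp
  qed
  show "A t = A 0 * ?c t - B 0 * ?s t" "B t = B 0 * ?c t + A 0 * ?s t"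
    using rot[OF e1 e2] by simp_all
qed

text \<open>\<open>hs\<close> is \<open>h\<close> moved to the right by \<open>s\<close> modulo
  \<open>b - a\<close>: the first summand is the part still below \<open>b\<close>, the second the
  part re-entering at \<open>a\<close>. Against a periodic \<open>w\<close> the pieces reassemble
  from \<open>y < b - s\<close> and \<open>y > b - s\<close>, losing a single point.\<close>

lemma cyclic_shift:
  fixes h w :: "real \<Rightarrow> real"
  assumes h: "integrable lborel h" and supp: "\<And>x. x \<notin> {a<..<b} \<Longrightarrow> h x = 0"
    and s: "0 \<le> s" "s < b - a"
    and w: "w \<in> borel_measurable borel" and per: "\<And>x. w (x + (b - a)) = w x" and bd: "\<And>x. \<bar>w x\<bar> \<le> C"
  defines "hs \<equiv> \<lambda>r. h (r - s) * indicator {..<b} r + h (r - s + (b - a)) * indicator {a<..} r"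
  shows "integrable lborel hs" and "(LINT r|lborel. hs r * w r) = (LINT y|lborel. h y * w (y + s))"
proof -
  note [measurable] = borel_measurable_integrable[OF h] w
  define h1 where "h1 = (\<lambda>r. h (r - s) * indicator {..<b} r)"
  define h2 where "h2 = (\<lambda>r. h (r - s + (b - a)) * indicator {a<..} r)"
  have sh: "integrable lborel (\<lambda>r. h (r + d))" for d
    using lborel_integrable_real_affine[OF h, of 1 d] by (simp add: add.commute)
  have i1: "integrable lborel h1" unfolding h1_def
    by (rule integrable_mult_bounded[where C=1]) (use sh[of "- s"] in auto)
  have i2: "integrable lborel h2" unfolding h2_def
    by (rule integrable_mult_bounded[where C=1]) (use sh[of "- s + (b - a)"] in \<open>auto simp: algebra_simps\<close>)
  have hs: "hs = (\<lambda>r. h1 r + h2 r)" by (simp add: hs_def h1_def h2_def)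
  then show "integrable lborel hs" using i1 i2 by simp
  have "(LINT r|lborel. hs r * w r) = (LINT r|lborel. h1 r * w r) + (LINT r|lborel. h2 r * w r)"
    unfolding hs distrib_right
    by (intro Bochner_Integration.integral_add integrable_mult_bounded[where C=C] i1 i2) (auto simp: bd)
  also have "(LINT r|lborel. h1 r * w r) = (LINT y|lborel. h y * (indicator {..<b - s} y * w (y + s)))"
    by (subst lborel_integral_real_affine[where c=1 and t=s])
       (auto simp: h1_def indicator_def add.commute intro!: Bochner_Integration.integral_cong)
  also have "(LINT r|lborel. h2 r * w r) = (LINT y|lborel. h y * (indicator {b - s<..} y * w (y + s)))"
  proof -
    have "w (s - (b - a) + y) = w (y + s)" for y
      using per[of "s - (b - a) + y"] by (simp add: algebra_simps)
    then show ?thesis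
      by (subst lborel_integral_real_affine[where c=1 and t="s - (b - a)"])
         (auto simp: h2_def indicator_def algebra_simps intro!: Bochner_Integration.integral_cong)
  qed
  also have "(LINT y|lborel. h y * (indicator {..<b - s} y * w (y + s))) + (LINT y|lborel. h y * (indicator {b - s<..} y * w (y + s))) =
      (LINT y|lborel. h y * (indicator {..<b - s} y * w (y + s)) + h y * (indicator {b - s<..} y * w (y + s)))"
    by (rule Bochner_Integration.integral_add[symmetric]; rule integrable_mult_bounded[OF h, where C=C])
       (auto simp: bd indicator_def intro: order_trans[OF abs_ge_zero bd])
  also have "\<dots> = (LINT y|lborel. h y * w (y + s))"
  proof (rule integral_cong_AE)
    show "AE y in lborel. h y * (indicator {..<b - s} y * w (y + s)) + h y * (indicator {b - s<..} y * w (y + s)) = h y * w (y + s)"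
      using AE_lborel_singleton[of "b - s"] by eventually_elim (auto simp: indicator_def)
  qed measurable
  finally show "(LINT r|lborel. hs r * w r) = (LINT y|lborel. h y * w (y + s))" .
qed

text \<open>Both sides have the same Fourier coefficients on \<open>(a, b)\<close>, by the rotation
  formula and the addition theorems. Because \<open>S t < b - a\<close> the profile wraps around at
  most once, so two summands describe the shift.\<close>

lemma transport_solution_representation:
  assumes sol: "transport_solution T a b G \<psi>0 \<psi>" and "a < b"
    and S0: "S 0 = 0" and S: "\<And>t. t \<in> {0..T} \<Longrightarrow> (S has_real_derivative G i t) (at t within {0..T})"
    and t: "t \<in> {0..T}" and St: "0 \<le> S t" "S t < b - a"
    and p: "p \<in> borel_measurable borel" "integrable lborel p" "\<And>x. x \<notin> {a<..<b} \<Longrightarrow> p x = 0"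
      "AE x in lborel. x \<in> {a<..<b} \<longrightarrow> \<psi> t i x = p x"
    and h: "h \<in> borel_measurable borel" "integrable lborel h" "\<And>x. x \<notin> {a<..<b} \<Longrightarrow> h x = 0"
      "AE x in lborel. x \<in> {a<..<b} \<longrightarrow> \<psi>0 i x = h x"
  shows "AE r in lborel. p r = h (r - S t) * indicator {..<b} r + h (r - S t + (b - a)) * indicator {a<..} r"
proof -
  define hs where "hs = (\<lambda>r. h (r - S t) * indicator {..<b} r + h (r - S t + (b - a)) * indicator {a<..} r)"
  have 0: "0 \<in> {0..T}" using t by simp
  have meas: "\<psi> s i \<in> borel_measurable (lebesgue_on {a<..<b})" if "s \<in> {0..T}" for s
    using sol that by (auto simp: transport_solution_def L2_def)
  have init: "AE x in lborel. x \<in> {a<..<b} \<longrightarrow> \<psi> 0 i x = h x"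
  proof -
    have "AE x in lborel. x \<in> {a<..<b} \<longrightarrow> \<psi> 0 i x = \<psi>0 i x"
      using sol by (simp add: transport_solution_def X2_eq_def AE_lebesgue_on_iff)
    then show ?thesis using h(4) by eventually_elim auto
  qed
  have repr: "(LINT r|lebesgue_on {a<..<b}. \<psi> s i r * u r) = (LINT r|lborel. k r * u r)"
    if s: "s \<in> {0..T}" and k: "k \<in> borel_measurable borel" "\<And>x. x \<notin> {a<..<b} \<Longrightarrow> k x = 0"
      "AE x in lborel. x \<in> {a<..<b} \<longrightarrow> \<psi> s i x = k x" and u: "continuous_on UNIV u" for s k u
  proof -
    have um: "u \<in> borel_measurable borel" using u by (rule borel_measurable_continuous_onI)
    then have "u \<in> borel_measurable (lebesgue_on {a<..<b})"
      by (intro measurable_restrict_space1) (simp add: measurable_completion)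
    then have "(LINT r|lebesgue_on {a<..<b}. \<psi> s i r * u r) = (LINT r|lborel. indicator {a<..<b} r * (k r * u r))"
      using k um meas[OF s] by (intro integral_lebesgue_on_eq) (auto elim!: eventually_mono)
    also have "\<dots> = (LINT r|lborel. k r * u r)"
    proof (intro Bochner_Integration.integral_cong refl)
      show "indicator {a<..<b} r * (k r * u r) = k r * u r" for r
        using k(2)[of r] by (cases "r \<in> {a<..<b}") auto
    qed
    finally show ?thesis .
  qed
  define \<omega> where "\<omega> = 2 * pi / (b - a)"
  have per: "cos (real k * \<omega> * (x + (b - a))) = cos (real k * \<omega> * x)"
    "sin (real k * \<omega> * (x + (b - a))) = sin (real k * \<omega> * x)" for k x
  proof -
    have "real k * \<omega> * (x + (b - a)) = real k * \<omega> * x + 2 * real k * pi"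
      using \<open>a < b\<close> by (simp add: \<omega>_def field_simps)
    then show "cos (real k * \<omega> * (x + (b - a))) = cos (real k * \<omega> * x)"
      "sin (real k * \<omega> * (x + (b - a))) = sin (real k * \<omega> * x)"
      unfolding cos_add sin_add by (simp_all only: cos_add sin_add cos_2npi sin_2npi mult_1_right mult_zero_right diff_zero add_0_right)
  qed
  have hsi: "integrable lborel hs"
    unfolding hs_def
    by (rule cyclic_shift(1)[OF h(2,3) St, where w="\<lambda>_. 0" and C=0]) auto
  have iw: "integrable lborel (\<lambda>x. f x * w (real k * \<omega> * x))"
    if "integrable lborel f" "w = sin \<or> w = cos" for f w and k :: nat
    using that by (intro integrable_mult_bounded[where C=1]) auto
  have coef: "(LINT r|lborel. (p r - hs r) * cos (real k * \<omega> * r)) = 0"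
    "(LINT r|lborel. (p r - hs r) * sin (real k * \<omega> * r)) = 0" for k :: nat
  proof -
    let ?c = "\<lambda>x. cos (real k * \<omega> * x)" and ?s = "\<lambda>x. sin (real k * \<omega> * x)"
    have cc: "continuous_on UNIV ?c" "continuous_on UNIV ?s" by (intro continuous_intros)+
    have R: "(LINT r|lebesgue_on {a<..<b}. \<psi> t i r * ?c r) = (LINT r|lborel. p r * ?c r)"
      "(LINT r|lebesgue_on {a<..<b}. \<psi> t i r * ?s r) = (LINT r|lborel. p r * ?s r)"
      "(LINT r|lebesgue_on {a<..<b}. \<psi> 0 i r * ?c r) = (LINT r|lborel. h r * ?c r)"
      "(LINT r|lebesgue_on {a<..<b}. \<psi> 0 i r * ?s r) = (LINT r|lborel. h r * ?s r)"
      subgoal by (rule repr[OF t p(1,3,4) cc(1)])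
      subgoal by (rule repr[OF t p(1,3,4) cc(2)])
      subgoal by (rule repr[OF 0 h(1,3) init cc(1)])
      subgoal by (rule repr[OF 0 h(1,3) init cc(2)])
      done
    note F = transport_Fourier_coefficients[OF sol \<open>a < b\<close> \<omega>_def S0 S t, of k, unfolded R]
    have "(LINT r|lborel. hs r * ?c r) = (LINT y|lborel. h y * ?c (y + S t))"
      unfolding hs_def
      by (rule cyclic_shift(2)[OF h(2,3) St, where w="?c" and C=1]) (simp_all add: per)
    also have "\<dots> = (LINT y|lborel. ?c (S t) * (h y * ?c y) - ?s (S t) * (h y * ?s y))"
      by (simp add: distrib_left cos_add algebra_simps)
    also have "\<dots> = ?c (S t) * (LINT y|lborel. h y * ?c y) - ?s (S t) * (LINT y|lborel. h y * ?s y)"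
      using iw[OF h(2)] by (subst Bochner_Integration.integral_diff) auto
    finally have 1: "(LINT r|lborel. hs r * ?c r) = (LINT r|lborel. p r * ?c r)"
      using F(1) by (simp add: mult.commute)
    have "(LINT r|lborel. hs r * ?s r) = (LINT y|lborel. h y * ?s (y + S t))"
      unfolding hs_def
      by (rule cyclic_shift(2)[OF h(2,3) St, where w="?s" and C=1]) (simp_all add: per)
    also have "\<dots> = (LINT y|lborel. ?c (S t) * (h y * ?s y) + ?s (S t) * (h y * ?c y))"
      by (simp add: distrib_left sin_add algebra_simps)
    also have "\<dots> = ?c (S t) * (LINT y|lborel. h y * ?s y) + ?s (S t) * (LINT y|lborel. h y * ?c y)"
      using iw[OF h(2)] by (subst Bochner_Integration.integral_add) auto
    finally have 2: "(LINT r|lborel. hs r * ?s r) = (LINT r|lborel. p r * ?s r)"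
      using F(2) by (simp add: mult.commute)
    show "(LINT r|lborel. (p r - hs r) * ?c r) = 0" "(LINT r|lborel. (p r - hs r) * ?s r) = 0"
      using 1 2 iw[OF p(2)] iw[OF hsi] by (simp_all add: left_diff_distrib)
  qed
  have "AE x in lborel. p x - hs x = 0"
  proof (rule AE_zero_of_Fourier_coefficients[OF _ _ \<open>a < b\<close> \<omega>_def coef])
    show "integrable lborel (\<lambda>x. p x - hs x)" using p(2) hsi by simp
    show "p x - hs x = 0" if "x \<notin> {a..b}" for x
      using that St p(3)[of x] h(3)[of "x - S t"] h(3)[of "x - S t + (b - a)"]
      by (auto simp: hs_def indicator_def)
  qed
  then show ?thesis by eventually_elim (simp add: hs_def)
qed

section \<open>Averages over orientations\<close>

text \<open>\<open>sin \<theta> / (4 * pi)\<close> is the density of the uniform probability measure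
  on the sphere in these angles.\<close>

definition dir_avg :: "real \<Rightarrow> (real \<Rightarrow> real) \<Rightarrow> real" where
  "dir_avg \<eta> u = integral {0..2 * pi} (\<lambda>\<phi>. integral {0..pi} (\<lambda>\<theta>. u (alpha \<eta> \<phi> \<theta>) * (sin \<theta> / (4 * pi))))"

lemma alpha_denominator_ge_1:
  fixes \<eta> \<theta> :: real
  assumes "\<eta> \<ge> 1" shows "(cos \<theta>)\<^sup>2 + \<eta>\<^sup>2 * (sin \<theta>)\<^sup>2 \<ge> 1"
proof -
  have "1 * (sin \<theta>)\<^sup>2 \<le> \<eta>\<^sup>2 * (sin \<theta>)\<^sup>2"
    using assms by (intro mult_right_mono) (auto simp: one_le_power)
  then show ?thesis using sin_cos_squared_add[of \<theta>] by linarith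
qed

lemma alpha_bounds:
  assumes "\<eta> \<ge> 1"
  shows "(sin \<phi>)\<^sup>2 \<le> alpha \<eta> \<phi> \<theta>" and "alpha \<eta> \<phi> \<theta> \<le> 1"
proof -
  let ?D = "(cos \<theta>)\<^sup>2 + \<eta>\<^sup>2 * (sin \<theta>)\<^sup>2"
  have D: "?D \<ge> 1" by (rule alpha_denominator_ge_1[OF assms])
  show "(sin \<phi>)\<^sup>2 \<le> alpha \<eta> \<phi> \<theta>" using D by (simp add: alpha_def)
  have "(cos \<phi>)\<^sup>2 / ?D \<le> (cos \<phi>)\<^sup>2 / 1" using D by (intro divide_left_mono) auto
  then show "alpha \<eta> \<phi> \<theta> \<le> 1"
    using sin_cos_squared_add[of \<phi>] unfolding alpha_def by linarith
qed

lemma alpha_nonneg: "\<eta> \<ge> 1 \<Longrightarrow> 0 \<le> alpha \<eta> \<phi> \<theta>"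
  using alpha_bounds(1) zero_le_power2 order_trans by blast

lemma alpha_sphere [simp]: "alpha 1 \<phi> \<theta> = 1"
  by (simp add: alpha_def)

context
  fixes \<eta> :: real
  assumes \<eta>: "\<eta> \<ge> 1"
begin

lemma continuous_dir_avg_integrand:
  assumes "continuous_on UNIV u"
  shows "continuous_on S (\<lambda>(\<phi>, \<theta>). u (alpha \<eta> \<phi> \<theta>) * (sin \<theta> / (4 * pi)))"
proof -
  have "(cos \<theta>)\<^sup>2 + \<eta>\<^sup>2 * (sin \<theta>)\<^sup>2 \<noteq> 0" for \<theta> using alpha_denominator_ge_1[OF \<eta>, of \<theta>] by linarith
  then have "continuous_on S (\<lambda>x. alpha \<eta> (fst x) (snd x))"
    unfolding alpha_def by (intro continuous_intros) auto
  then have "continuous_on S (\<lambda>x. u (alpha \<eta> (fst x) (snd x)))"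
    by (rule continuous_on_compose2[OF assms]) auto
  then show ?thesis unfolding case_prod_beta by (intro continuous_intros) auto
qed

lemma dir_avg_inner_integrable:
  assumes "continuous_on UNIV u"
  shows "(\<lambda>\<theta>. u (alpha \<eta> \<phi> \<theta>) * (sin \<theta> / (4 * pi))) integrable_on {0..pi}"
proof (rule integrable_continuous_real)
  have "continuous_on {0..pi} ((\<lambda>(\<phi>, \<theta>). u (alpha \<eta> \<phi> \<theta>) * (sin \<theta> / (4 * pi))) \<circ> Pair \<phi>)"
    by (intro continuous_on_compose continuous_intros continuous_dir_avg_integrand assms)
  then show "continuous_on {0..pi} (\<lambda>\<theta>. u (alpha \<eta> \<phi> \<theta>) * (sin \<theta> / (4 * pi)))" by (simp add: o_def)
qed

lemma dir_avg_outer_integrable: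
  assumes "continuous_on UNIV u"
  shows "(\<lambda>\<phi>. integral {0..pi} (\<lambda>\<theta>. u (alpha \<eta> \<phi> \<theta>) * (sin \<theta> / (4 * pi)))) integrable_on {a..b}"
  using integral_continuous_on_param[OF continuous_dir_avg_integrand[OF assms], of "{a..b}" 0 pi]
  by (intro integrable_continuous_real) simp

lemma integral_sin_0_pi: "integral {0..pi} (\<lambda>\<theta>. c * (sin \<theta> / (4 * pi))) = c / (2 * pi)"
proof -
  have "((\<lambda>\<theta>. c * (sin \<theta> / (4 * pi))) has_integral (c * (- cos pi / (4 * pi)) - c * (- cos 0 / (4 * pi)))) {0..pi}"
    by (rule fundamental_theorem_of_calculus)
       (auto intro!: derivative_eq_intros simp flip: has_real_derivative_iff_has_vector_derivative)
  then show ?thesis by (simp add: integral_unique field_simps)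
qed

lemma dir_avg_const [simp]: "dir_avg \<eta> (\<lambda>_. c) = c"
  by (simp add: dir_avg_def integral_sin_0_pi)

lemma dir_avg_add:
  assumes "continuous_on UNIV u" "continuous_on UNIV v"
  shows "dir_avg \<eta> (\<lambda>a. u a + v a) = dir_avg \<eta> u + dir_avg \<eta> v"
proof -
  let ?I = "\<lambda>u \<phi>. integral {0..pi} (\<lambda>\<theta>. u (alpha \<eta> \<phi> \<theta>) * (sin \<theta> / (4 * pi)))"
  have "?I (\<lambda>a. u a + v a) \<phi> = ?I u \<phi> + ?I v \<phi>" for \<phi>
    unfolding distrib_right
    by (rule Henstock_Kurzweil_Integration.integral_add[OF dir_avg_inner_integrable dir_avg_inner_integrable]) fact+
  then show ?thesis
    unfolding dir_avg_def
    using Henstock_Kurzweil_Integration.integral_add[OF dir_avg_outer_integrable[OF assms(1)] dir_avg_outer_integrable[OF assms(2)]]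
    by simp
qed

lemma dir_avg_cmult: "dir_avg \<eta> (\<lambda>a. c * u a) = c * dir_avg \<eta> u"
  by (simp add: dir_avg_def mult.assoc)

lemma dir_avg_mono:
  assumes u: "continuous_on UNIV u" and v: "continuous_on UNIV v"
    and le: "\<And>a. 0 \<le> a \<Longrightarrow> a \<le> 1 \<Longrightarrow> u a \<le> v a"
  shows "dir_avg \<eta> u \<le> dir_avg \<eta> v"
  unfolding dir_avg_def
proof (rule integral_le[OF dir_avg_outer_integrable[OF u] dir_avg_outer_integrable[OF v]])
  fix \<phi>
  show "integral {0..pi} (\<lambda>\<theta>. u (alpha \<eta> \<phi> \<theta>) * (sin \<theta> / (4 * pi))) \<le>
      integral {0..pi} (\<lambda>\<theta>. v (alpha \<eta> \<phi> \<theta>) * (sin \<theta> / (4 * pi)))"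
    by (rule integral_le[OF dir_avg_inner_integrable[OF u] dir_avg_inner_integrable[OF v]])
       (intro mult_right_mono le alpha_nonneg[OF \<eta>] alpha_bounds(2)[OF \<eta>] divide_nonneg_pos,
        auto intro: sin_ge_zero)
qed

lemma dir_avg_sum:
  assumes "\<And>k. k \<in> A \<Longrightarrow> continuous_on UNIV (u k)" "finite A"
  shows "dir_avg \<eta> (\<lambda>a. \<Sum>k\<in>A. u k a) = (\<Sum>k\<in>A. dir_avg \<eta> (u k))"
  using assms(2,1)
  by (induction rule: finite_induct) (auto simp: dir_avg_add continuous_on_sum)

lemma dir_avg_diff_le:
  assumes u: "continuous_on UNIV u" and v: "continuous_on UNIV v"
    and le: "\<And>a. 0 \<le> a \<Longrightarrow> a \<le> 1 \<Longrightarrow> \<bar>u a - v a\<bar> \<le> e"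
  shows "\<bar>dir_avg \<eta> u - dir_avg \<eta> v\<bar> \<le> e"
proof -
  have "dir_avg \<eta> u \<le> dir_avg \<eta> (\<lambda>a. v a + e)"
    using le by (intro dir_avg_mono u continuous_intros v) (auto simp: abs_le_iff algebra_simps)
  moreover have "dir_avg \<eta> v \<le> dir_avg \<eta> (\<lambda>a. u a + e)"
    using le by (intro dir_avg_mono v continuous_intros u) (auto simp: abs_le_iff algebra_simps)
  ultimately show ?thesis using u v by (simp add: dir_avg_add)
qed

section \<open>Decay and convexity of the moments of \<open>alpha\<close>\<close>

definition moment :: "nat \<Rightarrow> real" where
  "moment n = dir_avg \<eta> (\<lambda>a. a ^ n)"

lemma moment_0 [simp]: "moment 0 = 1"
  by (simp add: moment_def)

lemma moment_bounds: "0 \<le> moment n" "moment n \<le> 1"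
proof -
  have c: "continuous_on UNIV (\<lambda>a::real. a ^ n)" by (intro continuous_intros)
  show "0 \<le> moment n" "moment n \<le> 1"
    using dir_avg_mono[OF _ c, of "\<lambda>_. 0"] dir_avg_mono[OF c, of "\<lambda>_. 1"]
    by (auto simp: moment_def power_le_one)
qed

lemma moment_Suc_le: "moment (Suc n) \<le> moment n"
  unfolding moment_def
  by (rule dir_avg_mono) (auto simp: mult_left_le_one_le intro!: continuous_intros)

text \<open>Cauchy--Schwarz: the average of \<open>a ^ n * (a - s)\<^sup>2\<close> is nonnegative for all \<open>s\<close>.\<close>

lemma moment_log_convex: "(moment (Suc n))\<^sup>2 \<le> moment n * moment (n + 2)"
proof -
  let ?A = "moment n" and ?B = "moment (Suc n)" and ?C = "moment (n + 2)"
  have q: "0 \<le> ?C + (- 2 * s) * ?B + s\<^sup>2 * ?A" for s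
  proof -
    have "dir_avg \<eta> (\<lambda>_. 0) \<le> dir_avg \<eta> (\<lambda>a. (a ^ (n + 2) + (- 2 * s) * a ^ Suc n) + s\<^sup>2 * a ^ n)"
    proof (rule dir_avg_mono)
      fix a :: real assume "0 \<le> a"
      then have "0 \<le> a ^ n * (a - s)\<^sup>2" by simp
      also have "\<dots> = (a ^ (n + 2) + (- 2 * s) * a ^ Suc n) + s\<^sup>2 * a ^ n"
        by (simp add: power2_eq_square algebra_simps)
      finally show "0 \<le> (a ^ (n + 2) + (- 2 * s) * a ^ Suc n) + s\<^sup>2 * a ^ n" .
    qed (intro continuous_intros)+
    also have "\<dots> = ?C + (- 2 * s) * ?B + s\<^sup>2 * ?A"
      unfolding moment_def
      by (subst dir_avg_add dir_avg_cmult; (intro continuous_intros)?)+ simp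
    finally show ?thesis by simp
  qed
  show ?thesis
  proof (cases "?A = 0")
    case True
    then show ?thesis using moment_Suc_le[of n] moment_bounds[of "Suc n"] by simp
  next
    case False
    then have A: "?A > 0" using moment_bounds[of n] by simp
    \<comment> \<open>\<open>s = ?B / ?A\<close> minimises the quadratic.\<close>
    have "?C + (- 2 * (?B / ?A)) * ?B + (?B / ?A)\<^sup>2 * ?A = ?C - ?B\<^sup>2 / ?A"
      using A by (simp add: field_simps power2_eq_square)
    then have "?B\<^sup>2 / ?A \<le> ?C" using q[of "?B / ?A"] by linarith
    then show ?thesis using A by (simp add: field_simps)
  qed
qed

text \<open>\<open>alpha\<close> is at least \<open>(sin \<phi>)\<^sup>2\<close>, which is at least
  \<open>1 - \<delta>\<^sup>2\<close> for \<open>\<phi>\<close> within \<open>\<delta>\<close> of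
  \<open>pi / 2\<close>. Integrating over this band of width \<open>2 * \<delta>\<close> alone gives
  the order \<open>1 / sqrt n\<close>.\<close>

lemma moment_lower_bound:
  assumes "n \<ge> 1"
  shows "1 / (2 * pi * sqrt (2 * real n)) \<le> moment n"
proof -
  \<comment> \<open>Chosen so that Bernoulli's inequality gives
    \<open>(1 - \<delta>\<^sup>2) ^ n \<ge> 1 / 2\<close>.\<close>
  define \<delta> where "\<delta> = 1 / sqrt (2 * real n)"
  have "sqrt 1 \<le> sqrt (2 * real n)" using assms by (intro real_sqrt_le_mono) simp
  then have \<delta>: "0 < \<delta>" "\<delta> \<le> 1" using assms by (auto simp: \<delta>_def)
  have \<delta>2: "\<delta>\<^sup>2 = 1 / (2 * real n)" using assms by (simp add: \<delta>_def power_divide)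
  let ?I = "{pi / 2 - \<delta>..pi / 2 + \<delta>}"
  let ?f = "\<lambda>\<phi>. integral {0..pi} (\<lambda>\<theta>. alpha \<eta> \<phi> \<theta> ^ n * (sin \<theta> / (4 * pi)))"
  have fi: "?f integrable_on {a..b}" for a b
    by (rule dir_avg_outer_integrable) (intro continuous_intros)
  have ii: "(\<lambda>\<theta>. alpha \<eta> \<phi> \<theta> ^ n * (sin \<theta> / (4 * pi))) integrable_on {0..pi}" for \<phi>
    by (rule dir_avg_inner_integrable) (intro continuous_intros)
  have ge: "1 / 2 / (2 * pi) \<le> ?f \<phi>" if "\<phi> \<in> ?I" for \<phi>
  proof -
    have "\<bar>cos \<phi>\<bar> \<le> \<bar>pi / 2 - \<phi>\<bar>" using abs_sin_x_le_abs_x[of "pi / 2 - \<phi>"] by (simp add: sin_diff)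
    also have "\<dots> \<le> \<delta>" using that by auto
    finally have "\<bar>cos \<phi>\<bar>\<^sup>2 \<le> \<delta>\<^sup>2" by (intro power_mono) auto
    then have s: "1 - \<delta>\<^sup>2 \<le> (sin \<phi>)\<^sup>2" using sin_cos_squared_add[of \<phi>] unfolding power2_abs by linarith
    have "1 / 2 = 1 + real n * (- \<delta>\<^sup>2)" using assms by (simp add: \<delta>2)
    also have "\<dots> \<le> (1 + - \<delta>\<^sup>2) ^ n"
      using \<delta> power_le_one[of \<delta> 2] by (intro Bernoulli_inequality) simp
    also have "\<dots> \<le> ((sin \<phi>)\<^sup>2) ^ n" using s \<delta> power_le_one[of \<delta> 2] by (intro power_mono) auto
    finally have half: "1 / 2 \<le> ((sin \<phi>)\<^sup>2) ^ n" .
    have "1 / 2 / (2 * pi) = integral {0..pi} (\<lambda>\<theta>. 1 / 2 * (sin \<theta> / (4 * pi)))"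
      by (rule integral_sin_0_pi[symmetric])
    also have "\<dots> \<le> ?f \<phi>"
    proof (rule integral_le[OF _ ii])
      show "(\<lambda>\<theta>. 1 / 2 * (sin \<theta> / (4 * pi))) integrable_on {0..pi}"
        by (intro integrable_continuous_real continuous_intros) simp
      fix \<theta> assume \<theta>: "\<theta> \<in> {0..pi}"
      have "((sin \<phi>)\<^sup>2) ^ n \<le> alpha \<eta> \<phi> \<theta> ^ n" by (intro power_mono alpha_bounds(1)[OF \<eta>]) simp
      then show "1 / 2 * (sin \<theta> / (4 * pi)) \<le> alpha \<eta> \<phi> \<theta> ^ n * (sin \<theta> / (4 * pi))"
        using half \<theta> by (intro mult_right_mono divide_nonneg_pos) (auto intro: sin_ge_zero)
    qed
    finally show ?thesis .
  qed
  have sub: "?I \<subseteq> {0..2 * pi}" using \<delta> pi_ge_two by auto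
  have "1 / (2 * pi * sqrt (2 * real n)) = integral ?I (\<lambda>_. 1 / 2 / (2 * pi))"
    using \<delta> by (simp add: \<delta>_def field_simps)
  also have "\<dots> \<le> integral ?I ?f" by (rule integral_le) (use fi ge in auto)
  also have "\<dots> \<le> integral {0..2 * pi} ?f"
  proof (rule integral_subset_le[OF sub fi fi])
    show "\<forall>\<phi>\<in>{0..2 * pi}. 0 \<le> ?f \<phi>"
      by (intro ballI Henstock_Kurzweil_Integration.integral_nonneg ii mult_nonneg_nonneg zero_le_power
          alpha_nonneg[OF \<eta>] divide_nonneg_pos) (auto intro: sin_ge_zero)
  qed
  finally show ?thesis by (simp add: moment_def dir_avg_def)
qed

lemma moment_pos: "0 < moment n"
proof (cases "n \<ge> 1")
  case True
  have "0 < 1 / (2 * pi * sqrt (2 * real n))" using True by simp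
  then show ?thesis using moment_lower_bound[OF True] by linarith
next
  case False
  then show ?thesis by (simp add: not_le)
qed

text \<open>The lower bound of order \<open>1 / sqrt n\<close> leaves a factor
  \<open>sqrt n\<close>.\<close>

lemma filterlim_mult_moment_at_top: "filterlim (\<lambda>n. real n * moment n) at_top sequentially"
proof (rule filterlim_at_top_mono)
  have "filterlim (\<lambda>n. sqrt (real n)) at_top sequentially"
    by (rule filterlim_compose[OF sqrt_at_top filterlim_real_sequentially])
  then show "filterlim (\<lambda>n. (1 / (2 * pi * sqrt 2)) * sqrt (real n)) at_top sequentially"
    by (intro filterlim_tendsto_pos_mult_at_top[OF tendsto_const]) auto
  show "\<forall>\<^sub>F n in sequentially. (1 / (2 * pi * sqrt 2)) * sqrt (real n) \<le> real n * moment n"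
    using eventually_ge_at_top[of 1]
  proof eventually_elim
    case (elim n)
    have "(1 / (2 * pi * sqrt 2)) * sqrt (real n) = real n * (1 / (2 * pi * sqrt (2 * real n)))"
      using elim real_sqrt_mult_self[of "real n"] by (simp add: real_sqrt_mult field_simps)
    also have "\<dots> \<le> real n * moment n" using moment_lower_bound[OF elim] by (intro mult_left_mono) auto
    finally show ?case .
  qed
qed

text \<open>\<open>alpha\<close> attains its maximum \<open>1\<close> only where \<open>cos \<phi> = 0\<close> or \<open>sin \<theta> = 0\<close>.\<close>

lemma moment_tendsto_0:
  assumes "\<eta> > 1"
  shows "moment \<longlonglongrightarrow> 0"
proof -
  let ?f = "\<lambda>n \<phi>. integral {0..pi} (\<lambda>\<theta>. alpha \<eta> \<phi> \<theta> ^ n * (sin \<theta> / (4 * pi)))"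
  let ?g = "\<lambda>\<phi>. if cos \<phi> = 0 then 1 / (2 * pi) else (0::real)"
  have int: "(\<lambda>\<theta>. alpha \<eta> \<phi> \<theta> ^ n * (sin \<theta> / (4 * pi))) integrable_on {0..pi}" for \<phi> n
    by (rule dir_avg_inner_integrable) (intro continuous_intros)
  have sin_int: "(\<lambda>\<theta>. sin \<theta> / (4 * pi)) integrable_on {0..pi}"
    by (intro integrable_continuous_real continuous_intros) simp
  have le: "norm (alpha \<eta> \<phi> \<theta> ^ n * (sin \<theta> / (4 * pi))) \<le> sin \<theta> / (4 * pi)" if "\<theta> \<in> {0..pi}" for \<phi> \<theta> n
    using that alpha_nonneg[OF \<eta>, of \<phi> \<theta>] alpha_bounds(2)[OF \<eta>, of \<phi> \<theta>] sin_ge_zero[of \<theta>]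
    by (simp add: abs_mult power_abs power_le_one mult_left_le_one_le divide_right_mono)
  \<comment> \<open>Dominated convergence in \<open>\<theta>\<close> first: unless
    \<open>cos \<phi> = 0\<close> the integrand tends to zero, and where
    \<open>sin \<theta> = 0\<close> the weight itself is zero.\<close>
  have inner: "(\<lambda>n. ?f n \<phi>) \<longlonglongrightarrow> ?g \<phi>" for \<phi>
  proof (cases "cos \<phi> = 0")
    case True
    then have "alpha \<eta> \<phi> \<theta> = 1" for \<theta>
      using sin_cos_squared_add[of \<phi>] by (simp add: alpha_def)
    then show ?thesis using True integral_sin_0_pi[of 1] by simp
  next
    case False
    have "(\<lambda>n. ?f n \<phi>) \<longlonglongrightarrow> integral {0..pi} (\<lambda>\<theta>. 0 :: real)"
    proof (rule dominated_convergence(2)[OF int sin_int le])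
      fix \<theta> assume \<theta>: "\<theta> \<in> {0..pi}"
      show "(\<lambda>n. alpha \<eta> \<phi> \<theta> ^ n * (sin \<theta> / (4 * pi))) \<longlonglongrightarrow> 0"
      proof (cases "sin \<theta> = 0")
        case False
        have "1 * (sin \<theta>)\<^sup>2 < \<eta>\<^sup>2 * (sin \<theta>)\<^sup>2"
          using assms False by (intro mult_strict_right_mono) (auto simp: one_less_power)
        then have D: "1 < (cos \<theta>)\<^sup>2 + \<eta>\<^sup>2 * (sin \<theta>)\<^sup>2" using sin_cos_squared_add[of \<theta>] by linarith
        have "(cos \<phi>)\<^sup>2 / ((cos \<theta>)\<^sup>2 + \<eta>\<^sup>2 * (sin \<theta>)\<^sup>2) < (cos \<phi>)\<^sup>2 / 1"
          using D \<open>cos \<phi> \<noteq> 0\<close> by (intro divide_strict_left_mono) auto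
        then have "alpha \<eta> \<phi> \<theta> < 1" using sin_cos_squared_add[of \<phi>] unfolding alpha_def by linarith
        then have "(\<lambda>n. alpha \<eta> \<phi> \<theta> ^ n) \<longlonglongrightarrow> 0"
          using alpha_nonneg[OF \<eta>, of \<phi> \<theta>] by (intro LIMSEQ_power_zero) auto
        then show ?thesis by (intro tendsto_mult_left_zero)
      qed simp
    qed
    then show ?thesis using False by simp
  qed
  have "moment \<longlonglongrightarrow> integral {0..2 * pi} ?g"
    unfolding moment_def[abs_def] dir_avg_def
  proof (rule dominated_convergence(2)[where h="\<lambda>_. 1 / (2 * pi)"])
    show "?f n integrable_on {0..2 * pi}" for n
      by (rule dir_avg_outer_integrable) (intro continuous_intros)
    show "norm (?f n \<phi>) \<le> 1 / (2 * pi)" for n \<phi>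
      using integral_norm_bound_integral[OF int sin_int le, of \<phi> n] integral_sin_0_pi[of 1] by simp
    show "(\<lambda>n. ?f n \<phi>) \<longlonglongrightarrow> ?g \<phi>" for \<phi> by (rule inner)
  qed auto
  also have "integral {0..2 * pi} ?g = integral {0..2 * pi} (\<lambda>_. 0)"
  \<comment> \<open>The limit lives on the zeros of \<open>cos\<close>; the indices from
    \<open>- 1\<close> to \<open>2\<close> cover all those in \<open>{0..2 * pi}\<close>.\<close>
  proof (rule integral_spike[of "(\<lambda>i::int. of_int i * pi + pi / 2) ` {- 1..2}"])
    fix \<phi> assume \<phi>: "\<phi> \<in> {0..2 * pi} - (\<lambda>i::int. of_int i * pi + pi / 2) ` {- 1..2}"
    show "0 = ?g \<phi>"
    proof (rule ccontr)
      assume "0 \<noteq> ?g \<phi>"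
      then obtain i :: int where i: "\<phi> = of_int i * pi + pi / 2"
        by (auto simp: cos_zero_iff_int2 split: if_splits)
      have "- 1 \<le> i" "i \<le> 2"
      proof -
        have "0 \<le> \<phi>" "\<phi> \<le> 2 * pi" using \<phi> by auto
        then have "(- 1) * pi \<le> of_int i * pi" "of_int i * pi \<le> 2 * pi"
          using i pi_gt_zero by linarith+
        then show "- 1 \<le> i" "i \<le> 2"
          unfolding mult_le_cancel_right_pos[OF pi_gt_zero] by linarith+
      qed
      then show False using \<phi> i by auto
    qed
  qed (simp add: negligible_finite)
  finally show ?thesis by simp
qed

text \<open>For \<open>z < 1\<close> the binomial series of \<open>sqrt (1 - z * a)\<close>
  converges uniformly in \<open>a \<in> {0..1}\<close>, with the tail of the absolute series at
  \<open>a = 1\<close> as error bound. So the average may be taken term by term.\<close>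

lemma dir_avg_sqrt_sums:
  assumes z: "0 \<le> z" "z < 1"
  shows "(\<lambda>k. ((1/2) gchoose k) * (- 1) ^ k * moment k * z ^ k) sums
    dir_avg \<eta> (\<lambda>a. sqrt (max 0 (1 - z * a)))"
proof -
  let ?b = "\<lambda>k. ((1/2) gchoose k) :: real"
  have sq: "(\<lambda>k. ?b k * (- (z * a)) ^ k) sums sqrt (max 0 (1 - z * a))" if "0 \<le> a" "a \<le> 1" for a
  proof -
    have "z * a \<le> z * 1" using that z by (intro mult_left_mono) auto
    then have "\<bar>- (z * a)\<bar> < 1" "max 0 (1 - z * a) = 1 - z * a" using that z by auto
    then show ?thesis using sqrt_series[of "- (z * a)"] by simp
  qed
  have summ: "summable (\<lambda>k. \<bar>?b k\<bar> * z ^ k)"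
  proof -
    obtain y where y: "z < y" "y < 1" using dense[OF z(2)] by blast
    have "summable (\<lambda>k. ?b k * y ^ k)" using sqrt_series[of y] y z by (auto simp: sums_iff)
    then have "summable (\<lambda>k. norm (?b k * z ^ k))" by (rule powser_insidea) (use y z in auto)
    then show ?thesis using z by (simp add: abs_mult)
  qed
  let ?P = "\<lambda>N a. \<Sum>k<N. ?b k * (- (z * a)) ^ k"
  let ?R = "\<lambda>N. (\<Sum>k. \<bar>?b (k + N)\<bar> * z ^ (k + N))"
  have avgP: "dir_avg \<eta> (?P N) = (\<Sum>k<N. ?b k * (- 1) ^ k * moment k * z ^ k)" for N
  proof -
    have "?P N = (\<lambda>a. \<Sum>k<N. (?b k * (- 1) ^ k * z ^ k) * a ^ k)"
      by (intro ext sum.cong) (auto simp: power_mult_distrib power_minus[of "z * _"])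
    then have "dir_avg \<eta> (?P N) = dir_avg \<eta> (\<lambda>a. \<Sum>k<N. (?b k * (- 1) ^ k * z ^ k) * a ^ k)"
      by (simp only:)
    also have "\<dots> = (\<Sum>k<N. dir_avg \<eta> (\<lambda>a. (?b k * (- 1) ^ k * z ^ k) * a ^ k))"
      by (intro dir_avg_sum continuous_intros) auto
    also have "\<dots> = (\<Sum>k<N. ?b k * (- 1) ^ k * moment k * z ^ k)"
      unfolding dir_avg_cmult moment_def by (simp add: mult_ac)
    finally show ?thesis .
  qed
  have "\<bar>(\<Sum>k<N. ?b k * (- 1) ^ k * moment k * z ^ k) - dir_avg \<eta> (\<lambda>a. sqrt (max 0 (1 - z * a)))\<bar> \<le> ?R N" for N
    unfolding avgP[symmetric]
  proof (rule dir_avg_diff_le)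
    fix a :: real assume a: "0 \<le> a" "a \<le> 1"
    have tail: "(\<lambda>k. ?b (k + N) * (- (z * a)) ^ (k + N)) sums (sqrt (max 0 (1 - z * a)) - ?P N a)"
      using sums_split_initial_segment[OF sq[OF a]] .
    have "\<bar>sqrt (max 0 (1 - z * a)) - ?P N a\<bar> = \<bar>\<Sum>k. ?b (k + N) * (- (z * a)) ^ (k + N)\<bar>"
      using tail by (simp add: sums_iff)
    also have "\<dots> \<le> ?R N"
      unfolding real_norm_def[symmetric]
    proof (rule norm_suminf_le)
      fix k
      have "(z * a) ^ (k + N) \<le> z ^ (k + N)"
        using a z by (intro power_mono) (auto simp: mult_left_le)
      then show "norm (?b (k + N) * (- (z * a)) ^ (k + N)) \<le> norm (?b (k + N)) * z ^ (k + N)"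
        using a z by (auto simp: abs_mult power_abs intro!: mult_left_mono)
    next
      show "summable (\<lambda>k. norm (?b (k + N)) * z ^ (k + N))"
        using summable_ignore_initial_segment[OF summ] by simp
    qed
    finally show "\<bar>?P N a - sqrt (max 0 (1 - z * a))\<bar> \<le> ?R N" by (simp add: abs_minus_commute)
  qed (intro continuous_intros)+
  then have "\<forall>\<^sub>F N in sequentially. norm ((\<Sum>k<N. ?b k * (- 1) ^ k * moment k * z ^ k) - dir_avg \<eta> (\<lambda>a. sqrt (max 0 (1 - z * a)))) \<le> ?R N"
    unfolding real_norm_def by (rule always_eventually[OF allI])
  moreover have "?R \<longlonglongrightarrow> 0"
    by (rule suminf_exist_split2[OF summ])
  ultimately have "(\<lambda>N. (\<Sum>k<N. ?b k * (- 1) ^ k * moment k * z ^ k) - dir_avg \<eta> (\<lambda>a. sqrt (max 0 (1 - z * a)))) \<longlonglongrightarrow> 0"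
    by (rule Lim_null_comparison)
  then show ?thesis by (simp add: sums_def LIM_zero_iff)
qed

end

section \<open>Moment relations\<close>

text \<open>By \<open>conv\<close> the ratios are nondecreasing. If the value \<open>\<rho>\<close>
  occurred infinitely often, it would bound all ratios and lie below \<open>1\<close>, so
  \<open>a\<close> would decay geometrically, against \<open>inf\<close>.\<close>

lemma eventually_ratio_ne:
  fixes a :: "nat \<Rightarrow> real"
  assumes pos: "\<And>n. a n > 0" and lim: "a \<longlonglongrightarrow> 0"
    and inf: "filterlim (\<lambda>n. real n * a n) at_top sequentially"
    and conv: "\<And>n. (a (Suc n))\<^sup>2 \<le> a n * a (n + 2)"
  shows "\<forall>\<^sub>F n in sequentially. a (Suc n) \<noteq> \<rho> * a n"
proof -
  define r where "r = (\<lambda>n. a (Suc n) / a n)"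
  have a_Suc: "a (Suc n) = r n * a n" for n using pos[of n] by (simp add: r_def)
  have "mono r"
  proof (rule mono_iff_le_Suc[THEN iffD2], rule allI)
    fix n
    show "r n \<le> r (Suc n)"
      using conv[of n] pos[of n] pos[of "Suc n"] by (simp add: r_def field_simps power2_eq_square)
  qed
  then have mono: "r m \<le> r n" if "m \<le> n" for m n using that by (rule monoD)
  \<comment> \<open>A ratio of at least \<open>1\<close> would persist by monotonicity, and
    \<open>a\<close> could not tend to \<open>0\<close>.\<close>
  have ratio_lt_1: "r n < 1" for n
  proof (rule ccontr)
    assume "\<not> r n < 1"
    then have "a (n + m) \<ge> a n" for m
    proof (induction m)
      case (Suc m)
      have "1 * a (n + m) \<le> r (n + m) * a (n + m)"
        using Suc.prems mono[of n "n + m"] pos[of "n + m"] by (intro mult_right_mono) auto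
      then show ?case using Suc a_Suc[of "n + m"] by simp
    qed simp
    then have "\<forall>\<^sub>F m in sequentially. a n \<le> a m"
      by (metis eventually_sequentiallyI le_add_diff_inverse)
    then have "a n \<le> 0" using lim by (intro tendsto_lowerbound[OF lim]) auto
    with pos[of n] show False by simp
  qed
  show ?thesis
  proof (rule ccontr)
    assume "\<not> ?thesis"
    then have freq: "\<exists>\<^sub>F n in sequentially. a (Suc n) = \<rho> * a n" by (simp add: frequently_def)
    have r\<rho>: "r n = \<rho>" if "a (Suc n) = \<rho> * a n" for n using that pos[of n] by (simp add: r_def)
    have "r n \<le> \<rho>" for n
      using freq r\<rho> mono unfolding frequently_sequentially by metis
    moreover have "r n > 0" for n using pos by (simp add: r_def)
    moreover obtain n where "r n = \<rho>" using freq r\<rho> by (auto dest: frequently_ex)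
    ultimately have \<rho>: "0 < \<rho>" "\<rho> < 1" and le: "\<And>n. r n \<le> \<rho>" using ratio_lt_1 by metis+
    have geo: "a n \<le> \<rho> ^ n * a 0" for n
    proof (induction n)
      case (Suc n)
      have "a (Suc n) \<le> \<rho> * a n" unfolding a_Suc using le pos[of n] by (intro mult_right_mono) auto
      also have "\<dots> \<le> \<rho> * (\<rho> ^ n * a 0)" using Suc \<rho> by (intro mult_left_mono) auto
      finally show ?case by simp
    qed simp
    have "(\<lambda>n. (real n * \<rho> ^ n) * a 0) \<longlonglongrightarrow> 0 * a 0"
      using \<rho> by (intro tendsto_intros powser_times_n_limit_0) auto
    then have "\<forall>\<^sub>F n in sequentially. (real n * \<rho> ^ n) * a 0 < 1"
      by (rule order_tendstoD) simp
    moreover have "\<forall>\<^sub>F n in sequentially. 1 \<le> real n * a n"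
      using inf by (simp add: filterlim_at_top)
    ultimately have "\<forall>\<^sub>F n in sequentially. False"
    proof eventually_elim
      case (elim n)
      have "real n * a n \<le> real n * (\<rho> ^ n * a 0)" using geo[of n] by (intro mult_left_mono) auto
      with elim show False by (simp add: mult.assoc)
    qed
    then show False by simp
  qed
qed

text \<open>Comparing coefficients of \<open>\<tau> ^ 2\<close> raises the exponent
  \<open>2 * n\<close> to \<open>2 * n + 2\<close> but keeps the factor \<open>a n\<close>, whereas
  the relation at \<open>\<tau> = 0\<close> for \<open>Suc n\<close> has the factor
  \<open>a (Suc n)\<close>. For large \<open>n\<close> these equations are independent. The first
  order would lead to odd exponents, for which no relation at \<open>\<tau> = 0\<close> is
  given.\<close>

lemma two_functions_zero_of_shifted_moments:
  fixes F1 F2 :: "real \<Rightarrow> real" and a :: "nat \<Rightarrow> real"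
  assumes F: "integrable lborel F1" "integrable lborel F2"
    and supp: "\<And>y. y \<notin> {rmin..R} \<Longrightarrow> F1 y = 0" "\<And>y. y \<notin> {rmin..R} \<Longrightarrow> F2 y = 0"
    and "0 < rmin" and g: "0 < g1" "0 < g2" and "0 < \<sigma>"
    and a: "\<And>n. a n > 0" "a \<longlonglongrightarrow> 0" "filterlim (\<lambda>n. real n * a n) at_top sequentially"
      "\<And>n. (a (Suc n))\<^sup>2 \<le> a n * a (n + 2)"
    and zero: "\<And>n \<tau>. n \<ge> 1 \<Longrightarrow> 0 \<le> \<tau> \<Longrightarrow> \<tau> < \<sigma> \<Longrightarrow>
      (LINT y|lborel. F1 y * (1 / (y + g1 * \<tau>)) ^ (2 * n)) +
      a n * (LINT y|lborel. F2 y * (1 / (y + g2 * \<tau>)) ^ (2 * n)) = 0"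
  shows "AE y in lborel. F1 y = 0" and "AE y in lborel. F2 y = 0"
proof -
  define m where "m = (\<lambda>F n. LINT y|lborel. F y * (1 / y) ^ (2 * n) :: real)"
  have base: "m F1 n + a n * m F2 n = 0" if "n \<ge> 1" for n
    using zero[OF that order_refl \<open>0 < \<sigma>\<close>] by (simp only: m_def mult_zero_right add_0_right)
  have second: "g1\<^sup>2 * m F1 (Suc n) + a n * (g2\<^sup>2 * m F2 (Suc n)) = 0" if n: "n \<ge> 1" for n
  proof -
    let ?c = "\<lambda>k. (- real (2 * n)) gchoose k"
    have csum: "summable (\<lambda>k. \<bar>?c k\<bar> * z ^ k)" if z: "0 \<le> z" "z < 1" for z
    proof -
      obtain y where y: "z < y" "y < 1" using dense[OF z(2)] by blast
      have "summable (\<lambda>k. ?c k * y ^ k)" using gen_binomial_real[of y "- real (2 * n)"] y that by (auto simp: sums_iff)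
      then have "summable (\<lambda>k. norm (?c k * z ^ k))" by (rule powser_insidea) (use y that in auto)
      then show ?thesis using that by (simp add: abs_mult)
    qed
    \<comment> \<open>\<open>(1 / (y + g * \<tau>)) ^ (2 * n)\<close> is
      \<open>(1 / y) ^ (2 * n)\<close> times a binomial series in \<open>\<tau> * (g / y)\<close>,
      and \<open>y \<ge> rmin\<close> on the support of \<open>F\<close> gives a common radius of
      convergence.\<close>
    have expand: "(\<lambda>k. (?c k * (LINT y|lborel. (F y * (1 / y) ^ (2 * n)) * (g / y) ^ k)) * \<tau> ^ k) sums
        (LINT y|lborel. F y * (1 / (y + g * \<tau>)) ^ (2 * n))"
      if F: "integrable lborel F" and supp: "\<And>y. y \<notin> {rmin..R} \<Longrightarrow> F y = 0" and "0 < g"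
        and \<tau>: "0 \<le> \<tau>" "\<tau> * (g / rmin) < 1" for F g \<tau>
    proof -
      note [measurable] = borel_measurable_integrable[OF F]
      have nz: "rmin \<le> y" if "F y \<noteq> 0" for y using supp[of y] that by auto
      have i: "integrable lborel (\<lambda>y. F y * (1 / y) ^ (2 * n))"
      proof (rule integrable_mult_bounded[OF F, where C="(1 / rmin) ^ (2 * n)"])
        fix y assume "F y \<noteq> 0"
        then show "\<bar>(1 / y) ^ (2 * n)\<bar> \<le> (1 / rmin) ^ (2 * n)"
          using nz[of y] \<open>0 < rmin\<close> unfolding power_abs by (intro power_mono) (auto simp: field_simps)
      qed simp
      have "(\<lambda>k. (?c k * (LINT y|lborel. (F y * (1 / y) ^ (2 * n)) * (g / y) ^ k)) * \<tau> ^ k) sums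
        (LINT y|lborel. (F y * (1 / y) ^ (2 * n)) * (\<Sum>k. ?c k * (\<tau> * (g / y)) ^ k))"
      proof (rule powser_integral_sums[OF i, where Q="g / rmin"])
        show "AE y in lborel. F y * (1 / y) ^ (2 * n) \<noteq> 0 \<longrightarrow> \<bar>g / y\<bar> \<le> g / rmin"
          using nz \<open>0 < rmin\<close> \<open>0 < g\<close> by (intro AE_I2) (force simp: field_simps)
      qed (use csum \<tau> \<open>0 < rmin\<close> \<open>0 < g\<close> in auto)
      also have "(LINT y|lborel. (F y * (1 / y) ^ (2 * n)) * (\<Sum>k. ?c k * (\<tau> * (g / y)) ^ k)) =
          (LINT y|lborel. F y * (1 / (y + g * \<tau>)) ^ (2 * n))"
      proof (intro Bochner_Integration.integral_cong refl)
        fix y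
        show "(F y * (1 / y) ^ (2 * n)) * (\<Sum>k. ?c k * (\<tau> * (g / y)) ^ k) = F y * (1 / (y + g * \<tau>)) ^ (2 * n)"
        proof (cases "F y = 0")
          case False
          then have y: "rmin \<le> y" "0 < y" using nz \<open>0 < rmin\<close> by force+
          have z: "0 \<le> \<tau> * (g / y)" "\<tau> * (g / y) < 1"
          proof -
            have "\<tau> * (g / y) \<le> \<tau> * (g / rmin)"
              using y \<tau> \<open>0 < rmin\<close> \<open>0 < g\<close> by (intro mult_left_mono divide_left_mono) auto
            then show "\<tau> * (g / y) < 1" using \<tau> by simp
          qed (use y \<tau> \<open>0 < g\<close> in simp)
          have "(\<Sum>k. ?c k * (\<tau> * (g / y)) ^ k) = (1 + \<tau> * (g / y)) powr (- real (2 * n))"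
            using gen_binomial_real[of "\<tau> * (g / y)" "- real (2 * n)"] z by (simp add: sums_iff)
          also have "\<dots> = (1 / (1 + \<tau> * (g / y))) ^ (2 * n)"
            using z by (simp only: powr_minus powr_realpow) (simp add: powr_realpow power_one_over inverse_eq_divide)
          finally have "(1 / y) ^ (2 * n) * (\<Sum>k. ?c k * (\<tau> * (g / y)) ^ k) =
              ((1 / y) * (1 / (1 + \<tau> * (g / y)))) ^ (2 * n)"
            by (simp only: power_mult_distrib)
          also have "(1 / y) * (1 / (1 + \<tau> * (g / y))) = 1 / (y + g * \<tau>)"
            using y by (simp add: field_simps)
          finally show ?thesis by (simp add: mult.assoc)
        qed simp
      qed
      finally show ?thesis .
    qed
    define X where "X = (\<lambda>F g k. LINT y|lborel. (F y * (1 / y) ^ (2 * n)) * (g / y) ^ k :: real)"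
    \<comment> \<open>Below \<open>\<rho>\<close> the relation is available and both binomial series
      converge on the supports.\<close>
    define \<rho> where "\<rho> = min \<sigma> (min (rmin / g1) (rmin / g2))"
    have \<rho>: "0 < \<rho>" using \<open>0 < \<sigma>\<close> \<open>0 < rmin\<close> g by (simp add: \<rho>_def)
    have "?c 2 * (X F1 g1 2 + a n * X F2 g2 2) = 0"
    proof (rule powser_coeff_eq_0[OF \<rho>, where S="\<lambda>_. 0" and k=2 and A="\<lambda>k. ?c k * (X F1 g1 k + a n * X F2 g2 k)"])
      fix \<tau> assume \<tau>: "0 < \<tau>" "\<tau> < \<rho>"
      have lt: "\<tau> * (g1 / rmin) < 1" "\<tau> * (g2 / rmin) < 1"
        using \<tau> g \<open>0 < rmin\<close> by (auto simp: \<rho>_def field_simps)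
      have "(\<lambda>k. (?c k * X F1 g1 k) * \<tau> ^ k + a n * ((?c k * X F2 g2 k) * \<tau> ^ k)) sums
        ((LINT y|lborel. F1 y * (1 / (y + g1 * \<tau>)) ^ (2 * n)) +
         a n * (LINT y|lborel. F2 y * (1 / (y + g2 * \<tau>)) ^ (2 * n)))"
        unfolding X_def using \<tau> lt
        by (intro sums_add sums_mult expand F supp g) auto
      moreover have "(LINT y|lborel. F1 y * (1 / (y + g1 * \<tau>)) ^ (2 * n)) +
         a n * (LINT y|lborel. F2 y * (1 / (y + g2 * \<tau>)) ^ (2 * n)) = 0"
        by (rule zero[OF n]) (use \<tau> in \<open>auto simp: \<rho>_def\<close>)
      ultimately show "(\<lambda>k. (?c k * (X F1 g1 k + a n * X F2 g2 k)) * \<tau> ^ k) sums 0"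
        by (simp add: algebra_simps)
    qed simp
    \<comment> \<open>The coefficient equals \<open>n * (2 * n + 1)\<close>.\<close>
    moreover have "?c 2 \<noteq> 0" using n by (simp add: gbinomial_prod_rev numeral_2_eq_2)
    moreover have "X F g 2 = g\<^sup>2 * m F (Suc n)" for F g
    proof -
      have "X F g 2 = (LINT y|lborel. g\<^sup>2 * (F y * (1 / y) ^ (2 * Suc n)))"
        unfolding X_def by (intro Bochner_Integration.integral_cong) (auto simp: power_divide power2_eq_square mult_ac)
      then show ?thesis unfolding m_def by (simp only: integral_mult_right_zero)
    qed
    ultimately show ?thesis by simp
  qed
  have "\<forall>\<^sub>F n in sequentially. a (Suc n) \<noteq> (g2\<^sup>2 / g1\<^sup>2) * a n"
    by (rule eventually_ratio_ne[OF a])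
  then obtain N0 where N0: "\<And>n. n \<ge> N0 \<Longrightarrow> a (Suc n) \<noteq> (g2\<^sup>2 / g1\<^sup>2) * a n"
    by (auto simp: eventually_sequentially)
  \<comment> \<open>The moments of index \<open>n\<close> come from \<open>k = n - 1\<close>; the
    offset \<open>2\<close> yields both \<open>k \<ge> N0\<close> and
    \<open>k \<ge> 1\<close>.\<close>
  have m0: "m F2 n = 0 \<and> m F1 n = 0" if "n \<ge> N0 + 2" for n
  proof -
    define k where "k = n - 1"
    have n: "n = Suc k" and k: "k \<ge> N0" "k \<ge> 1" using that by (auto simp: k_def)
    have 1: "m F1 (Suc k) = - (a (Suc k) * m F2 (Suc k))" using base[of "Suc k"] by simp
    \<comment> \<open>Eliminating \<open>m F1\<close> leaves the determinant of the system as a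
      factor.\<close>
    have "(a k * g2\<^sup>2 - a (Suc k) * g1\<^sup>2) * m F2 (Suc k) = 0"
      using second[OF k(2)] unfolding 1 by (simp add: algebra_simps)
    moreover have "a k * g2\<^sup>2 - a (Suc k) * g1\<^sup>2 \<noteq> 0"
      using N0[OF k(1)] g by (simp add: field_simps)
    ultimately show ?thesis using 1 n by simp
  qed
  show "AE y in lborel. F1 y = 0" "AE y in lborel. F2 y = 0"
    using m0 unfolding m_def
    by (blast intro: AE_zero_of_inverse_power_moments[OF F(1) supp(1) \<open>0 < rmin\<close>]
        AE_zero_of_inverse_power_moments[OF F(2) supp(2) \<open>0 < rmin\<close>])+
qed

section \<open>Windowed moments for large exponents\<close>

lemma integral_indicator_Icc:
  fixes f :: "real \<Rightarrow> real"
  assumes "continuous_on {a..b} f"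
  shows "integrable lborel (\<lambda>x. indicator {a..b} x * f x)"
    and "(LINT x|lborel. indicator {a..b} x * f x) = integral {a..b} f"
  using borel_integrable_atLeastAtMost'[OF assms] set_borel_integral_eq_integral(2)[of "{a..b}" f]
  by (simp_all add: set_integrable_def set_lebesgue_integral_def)

context
  fixes rmin rmax :: real
  assumes r: "0 < rmin" "rmin < rmax"
begin

definition mass :: "nat \<Rightarrow> real" where
  "mass n = (LINT x|lborel. indicator {rmin..rmax} x * (1 / x) ^ (2 * n))"

text \<open>Divided by \<open>mass n\<close>, this is the mean distance from \<open>rmin\<close>
  under the weight \<open>(1 / x) ^ (2 * n)\<close>; it measures how strongly the weight
  concentrates at \<open>rmin\<close>.\<close>

definition first_moment :: "nat \<Rightarrow> real" where
  "first_moment n = (LINT x|lborel. indicator {rmin..rmax} x * ((x - rmin) * (1 / x) ^ (2 * n)))"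

text \<open>With \<open>x = y + g * \<tau>\<close> this is the moment over the window of the profile
  \<open>F\<close> shifted by \<open>g * \<tau>\<close>, written in the unshifted coordinate so that
  \<open>\<tau>\<close> occurs only in the weight.\<close>

definition window_moment :: "(real \<Rightarrow> real) \<Rightarrow> real \<Rightarrow> nat \<Rightarrow> real \<Rightarrow> real" where
  "window_moment F g n \<tau> = (LINT y|lborel. F y * (indicator {rmin..rmax} (y + g * \<tau>) * (1 / (y + g * \<tau>)) ^ (2 * n)))"

lemma continuous_on_inverse_power: "continuous_on {rmin..rmax} (\<lambda>x. (1 / x) ^ n)"
  using r by (intro continuous_intros) auto

lemma mass_pos: "0 < mass n"
proof -
  have "0 < (rmax - rmin) * (1 / rmax) ^ (2 * n)" using r by simp
  also have "\<dots> = integral {rmin..rmax} (\<lambda>_. (1 / rmax) ^ (2 * n))" using r by simp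
  also have "\<dots> \<le> integral {rmin..rmax} (\<lambda>x. (1 / x) ^ (2 * n))"
    using r by (intro integral_le integrable_continuous_real continuous_on_inverse_power power_mono)
      (auto simp: field_simps)
  finally show ?thesis by (simp add: mass_def integral_indicator_Icc continuous_on_inverse_power)
qed

text \<open>Integrate the derivative of \<open>(x - rmin) * (1 / x) ^ (2 * n - 1)\<close>.\<close>

lemma first_moment_le:
  assumes "n \<ge> 1"
  shows "(2 * real n - 1) * first_moment n \<le> rmax * mass n"
proof -
  \<comment> \<open>The exponent in the antiderivative; \<open>2 * n = Suc k\<close> relies on
    \<open>n \<ge> 1\<close>.\<close>
  define k where "k = 2 * n - 1"
  have k: "2 * n = Suc k" and rk: "real k = 2 * real n - 1" using assms by (auto simp: k_def)
  note c = continuous_on_inverse_power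
  let ?f = "\<lambda>x. (1 / x) ^ k - real k * ((x - rmin) * (1 / x) ^ Suc k)"
  have "(?f has_integral ((rmax - rmin) * (1 / rmax) ^ k - (rmin - rmin) * (1 / rmin) ^ k)) {rmin..rmax}"
  proof (rule fundamental_theorem_of_calculus)
    fix x assume "x \<in> {rmin..rmax}"
    then have x: "x > 0" using r by auto
    have D: "((\<lambda>x. (x - rmin) * (1 / x) ^ k) has_real_derivative
        (1 / x) ^ k + (x - rmin) * (real k * (1 / x) ^ (k - 1) * (- 1 / x\<^sup>2))) (at x within {rmin..rmax})"
      using x by (auto intro!: derivative_eq_intros simp: power2_eq_square)
    have *: "real k * (1 / x) ^ (k - 1) * (- 1 / x\<^sup>2) = - (real k * (1 / x) ^ Suc k)"
      using x by (cases k) (auto simp: power2_eq_square field_simps)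
    have "(1 / x) ^ k + (x - rmin) * (real k * (1 / x) ^ (k - 1) * (- 1 / x\<^sup>2)) = ?f x"
      unfolding * by (simp add: algebra_simps)
    from D[unfolded this] show "((\<lambda>x. (x - rmin) * (1 / x) ^ k) has_vector_derivative ?f x) (at x within {rmin..rmax})"
      by (simp only: has_real_derivative_iff_has_vector_derivative)
  qed (use r in simp)
  then have "integral {rmin..rmax} ?f = (rmax - rmin) * (1 / rmax) ^ k"
    by (simp add: integral_unique)
  \<comment> \<open>The boundary term at \<open>rmin\<close> has vanished; of the one at
    \<open>rmax\<close> only the sign is kept.\<close>
  then have "0 \<le> integral {rmin..rmax} ?f" using r by simp
  also have "integral {rmin..rmax} ?f = integral {rmin..rmax} (\<lambda>x. (1 / x) ^ k) - real k * first_moment n"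
  proof -
    have c1: "continuous_on {rmin..rmax} (\<lambda>x. (x - rmin) * (1 / x) ^ Suc k)"
      by (intro continuous_on_mult continuous_on_diff continuous_on_id continuous_on_const c)
    have "integral {rmin..rmax} ?f = integral {rmin..rmax} (\<lambda>x. (1 / x) ^ k) -
        integral {rmin..rmax} (\<lambda>x. real k * ((x - rmin) * (1 / x) ^ Suc k))"
      by (intro Henstock_Kurzweil_Integration.integral_diff integrable_continuous_real
          continuous_on_mult_left c c1)
    then show ?thesis
      unfolding first_moment_def k integral_indicator_Icc(2)[OF c1] by (simp only: integral_mult_right)
  qed
  also have "integral {rmin..rmax} (\<lambda>x. (1 / x) ^ k) \<le> integral {rmin..rmax} (\<lambda>x. rmax * (1 / x) ^ Suc k)"
  proof (intro integral_le integrable_continuous_real continuous_on_mult_left c)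
    fix x assume x: "x \<in> {rmin..rmax}"
    have "(1 / x) ^ k = x * (1 / x) ^ Suc k" using x r by simp
    also have "\<dots> \<le> rmax * (1 / x) ^ Suc k" using x r by (intro mult_right_mono) auto
    finally show "(1 / x) ^ k \<le> rmax * (1 / x) ^ Suc k" .
  qed
  also have "integral {rmin..rmax} (\<lambda>x. rmax * (1 / x) ^ Suc k) = rmax * mass n"
    by (simp add: mass_def k integral_indicator_Icc c del: power_Suc)
  finally show ?thesis by (simp add: rk)
qed

text \<open>Fubini's theorem and the substitution \<open>x = y + g * \<tau>\<close> produce the
  integral of \<open>w ((x - y) / g)\<close> against \<open>(1 / x) ^ (2 * n)\<close> over the
  window. Freezing \<open>x\<close> at \<open>rmin\<close> in \<open>w\<close> costs at most
  \<open>C * (x - rmin) / g\<close>, which integrates to the first moment; the second factor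
  \<open>1 / g\<close> comes from the substitution.\<close>

lemma weighted_window_moment:
  fixes F w :: "real \<Rightarrow> real"
  assumes F: "integrable lborel F" and "0 < g"
    and w: "\<And>x y. \<bar>w x - w y\<bar> \<le> C * \<bar>x - y\<bar>" "\<And>x. x \<notin> {0<..<\<sigma>} \<Longrightarrow> w x = 0"
  shows "\<bar>(LINT \<tau>|lborel. w \<tau> * window_moment F g n \<tau>) -
      mass n * ((LINT y|lborel. F y * w ((rmin - y) / g)) / g)\<bar>
    \<le> (C / g\<^sup>2 * (LINT y|lborel. \<bar>F y\<bar>)) * first_moment n"
proof -
  note [measurable] = borel_measurable_integrable[OF F]
  have cw: "continuous_on S w" for S by (rule Lipschitz_continuous_on[OF w(1)])
  have [measurable]: "w \<in> borel_measurable borel" using cw by (rule borel_measurable_continuous_onI)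
  have "bounded (w ` {0..\<sigma>})" by (intro compact_imp_bounded compact_continuous_image cw compact_Icc)
  then obtain B0 where B0: "\<And>x. x \<in> {0..\<sigma>} \<Longrightarrow> \<bar>w x\<bar> \<le> B0"
    unfolding bounded_iff by (metis imageI real_norm_def)
  define B where "B = max 0 B0"
  have B: "\<bar>w x\<bar> \<le> B" for x
    using B0[of x] w(2)[of x] by (cases "x \<in> {0..\<sigma>}") (auto simp: B_def)
  define p where "p = (\<lambda>x. indicator {rmin..rmax} x * (1 / x) ^ (2 * n) :: real)"
  have [measurable]: "p \<in> borel_measurable borel" unfolding p_def by measurable
  define P where "P = (1 / rmin) ^ (2 * n)"
  have p: "0 \<le> p x" "p x \<le> P" for x
  proof -
    show "0 \<le> p x" by (simp add: p_def)
    show "p x \<le> P"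
    proof (cases "x \<in> {rmin..rmax}")
      case True
      then show ?thesis unfolding p_def P_def using r by (simp add: power_mono frac_le)
    qed (use r in \<open>simp add: p_def P_def\<close>)
  qed
  have p_abs: "\<bar>p x\<bar> \<le> P" for x using p[of x] by simp
  have P0: "0 \<le> P" using r by (simp add: P_def)
  have B0: "0 \<le> B" by (simp add: B_def)
  let ?k = "\<lambda>\<tau> y. w \<tau> * (F y * p (y + g * \<tau>))"
  have ind: "integrable lborel (indicat_real {0..\<sigma>})"
    by (rule integrable_real_indicator) (auto simp: emeasure_lborel_Icc_eq)
  \<comment> \<open>\<open>w\<close> is bounded and lives on \<open>{0..\<sigma>}\<close>, which
    gives an integrable majorant on the product space.\<close>
  have dom: "integrable (lborel \<Otimes>\<^sub>M lborel) (\<lambda>(\<tau>, y). indicator {0..\<sigma>} \<tau> * (B * P * \<bar>F y\<bar>))"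
  proof (rule lborel_pair.Fubini_integrable)
    show "integrable lborel (\<lambda>x. LINT y|lborel. norm (case (x, y) of (\<tau>, y) \<Rightarrow> indicator {0..\<sigma>} \<tau> * (B * P * \<bar>F y\<bar>)))"
      using B0 P0 ind by (simp add: abs_mult)
    show "AE x in lborel. integrable lborel (\<lambda>y. case (x, y) of (\<tau>, y) \<Rightarrow> indicator {0..\<sigma>} \<tau> * (B * P * \<bar>F y\<bar>))"
      using F by simp
  qed measurable
  have int: "integrable (lborel \<Otimes>\<^sub>M lborel) (\<lambda>(\<tau>, y). ?k \<tau> y)"
  proof (rule Bochner_Integration.integrable_bound[OF dom])
    show "AE z in lborel \<Otimes>\<^sub>M lborel. norm (case z of (\<tau>, y) \<Rightarrow> ?k \<tau> y)
        \<le> norm (case z of (\<tau>, y) \<Rightarrow> indicator {0..\<sigma>} \<tau> * (B * P * \<bar>F y\<bar>))"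
    proof (intro AE_I2, clarify)
      fix \<tau> y :: real
      show "norm (?k \<tau> y) \<le> norm (indicator {0..\<sigma>} \<tau> * (B * P * \<bar>F y\<bar>))"
      proof (cases "\<tau> \<in> {0..\<sigma>}")
        case True
        have "\<bar>w \<tau>\<bar> * \<bar>p (y + g * \<tau>)\<bar> * \<bar>F y\<bar> \<le> B * P * \<bar>F y\<bar>"
          using B B0 p_abs by (intro mult_right_mono mult_mono) auto
        then show ?thesis using True B0 P0 by (simp add: abs_mult mult_ac)
      next
        case False
        then have "w \<tau> = 0" by (intro w(2)) auto
        then show ?thesis by simp
      qed
    qed
  qed measurable
  define I where "I = (\<lambda>y. LINT \<tau>|lborel. w \<tau> * p (y + g * \<tau>))"
  have Im [measurable]: "I \<in> borel_measurable borel"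
    unfolding I_def by measurable
  have "(LINT \<tau>|lborel. w \<tau> * window_moment F g n \<tau>) = (LINT \<tau>|lborel. LINT y|lborel. ?k \<tau> y)"
    by (simp add: window_moment_def p_def)
  also have "\<dots> = (LINT y|lborel. LINT \<tau>|lborel. ?k \<tau> y)"
    by (rule lborel_pair.Fubini_integral[OF int, symmetric])
  also have "\<dots> = (LINT y|lborel. F y * I y)"
    by (simp add: I_def mult.left_commute)
  finally have lhs: "(LINT \<tau>|lborel. w \<tau> * window_moment F g n \<tau>) = (LINT y|lborel. F y * I y)" .
  have pint: "integrable lborel (\<lambda>x. p x * c)" for c
    unfolding p_def using integral_indicator_Icc(1)[OF continuous_on_inverse_power] by simp
  have I: "I y = (LINT x|lborel. p x * w ((x - y) / g)) / g" for y
  proof -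
    have Iy: "I y = \<bar>1 / g\<bar> *\<^sub>R (LINT x|lborel. w (- y / g + 1 / g * x) * p (y + g * (- y / g + 1 / g * x)))"
      unfolding I_def using \<open>0 < g\<close> by (subst lborel_integral_real_affine[where c="1 / g" and t="- y / g"]) auto
    have a: "- y / g + 1 / g * x = (x - y) / g" "y + g * ((x - y) / g) = x" for x
      using \<open>0 < g\<close> by (simp_all add: field_simps)
    have "(\<lambda>x. w (- y / g + 1 / g * x) * p (y + g * (- y / g + 1 / g * x))) = (\<lambda>x. p x * w ((x - y) / g))"
      by (simp only: a) (simp only: mult.commute)
    with Iy show ?thesis using \<open>0 < g\<close> by simp
  qed
  let ?W = "\<lambda>y. w ((rmin - y) / g)"
  have diff: "\<bar>I y - mass n / g * ?W y\<bar> \<le> C / g\<^sup>2 * first_moment n" for y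
  proof -
    have wi: "integrable lborel (\<lambda>x. p x * w ((x - y) / g))"
      by (rule integrable_mult_bounded[where C=B]) (use pint[of 1] B in auto)
    have "I y - mass n / g * ?W y = ((LINT x|lborel. p x * w ((x - y) / g)) - (LINT x|lborel. p x * ?W y)) / g"
      by (simp add: I mass_def p_def diff_divide_distrib)
    also have "\<dots> = (LINT x|lborel. p x * w ((x - y) / g) - p x * ?W y) / g"
      by (subst Bochner_Integration.integral_diff[OF wi pint]) simp
    finally have eq: "\<bar>I y - mass n / g * ?W y\<bar> = \<bar>LINT x|lborel. p x * w ((x - y) / g) - p x * ?W y\<bar> / g"
      using \<open>0 < g\<close> by simp
    have "\<bar>LINT x|lborel. p x * w ((x - y) / g) - p x * ?W y\<bar>
        \<le> (LINT x|lborel. \<bar>p x * w ((x - y) / g) - p x * ?W y\<bar>)" by (rule integral_abs_bound)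
    also have "\<dots> \<le> (LINT x|lborel. C / g * (indicator {rmin..rmax} x * ((x - rmin) * (1 / x) ^ (2 * n))))"
    proof (rule integral_mono)
      show "integrable lborel (\<lambda>x. \<bar>p x * w ((x - y) / g) - p x * ?W y\<bar>)" using wi pint by simp
      show "integrable lborel (\<lambda>x. C / g * (indicator {rmin..rmax} x * ((x - rmin) * (1 / x) ^ (2 * n))))"
        by (intro integrable_mult_right integral_indicator_Icc(1) continuous_intros continuous_on_inverse_power)
      fix x
      show "\<bar>p x * w ((x - y) / g) - p x * ?W y\<bar> \<le> C / g * (indicator {rmin..rmax} x * ((x - rmin) * (1 / x) ^ (2 * n)))"
      proof (cases "x \<in> {rmin..rmax}")
        case True
        have "\<bar>w ((x - y) / g) - ?W y\<bar> \<le> C * \<bar>(x - y) / g - (rmin - y) / g\<bar>" by (rule w)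
        also have "(x - y) / g - (rmin - y) / g = (x - rmin) / g" by (simp add: diff_divide_distrib)
        finally have "p x * \<bar>w ((x - y) / g) - ?W y\<bar> \<le> p x * (C * \<bar>(x - rmin) / g\<bar>)"
          using p by (intro mult_left_mono) auto
        also have "\<bar>(x - rmin) / g\<bar> = (x - rmin) / g" using True \<open>0 < g\<close> by simp
        also have "p x * (C * ((x - rmin) / g)) = C / g * (indicator {rmin..rmax} x * ((x - rmin) * (1 / x) ^ (2 * n)))"
          using True by (simp add: p_def)
        finally show ?thesis
          using p(1)[of x] by (simp only: right_diff_distrib[symmetric] abs_mult abs_of_nonneg)
      qed (simp add: p_def)
    qed
    also have "\<dots> = C / g * first_moment n" by (simp only: first_moment_def integral_mult_right_zero)
    finally have "\<bar>LINT x|lborel. p x * w ((x - y) / g) - p x * ?W y\<bar> / g \<le> C / g * first_moment n / g"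
      using \<open>0 < g\<close> by (intro divide_right_mono) auto
    then show ?thesis unfolding eq by (simp add: power2_eq_square)
  qed
  have i1: "integrable lborel (\<lambda>y. F y * (mass n / g * ?W y))"
  proof (rule integrable_mult_bounded[OF F])
    show "\<bar>mass n / g * ?W y\<bar> \<le> \<bar>mass n / g\<bar> * B" for y unfolding abs_mult using B by (intro mult_left_mono) auto
  qed simp
  have i2: "integrable lborel (\<lambda>y. F y * (I y - mass n / g * ?W y))"
    by (rule integrable_mult_bounded[OF F _ diff]) simp
  have "(LINT y|lborel. F y * I y) - mass n * ((LINT y|lborel. F y * ?W y) / g)
      = (LINT y|lborel. F y * I y) - (LINT y|lborel. F y * (mass n / g * ?W y))"
  proof -
    have "(\<lambda>y. F y * (mass n / g * ?W y)) = (\<lambda>y. mass n / g * (F y * ?W y))" by (simp add: fun_eq_iff)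
    then show ?thesis by (simp only: integral_mult_right_zero) simp
  qed
  also have "\<dots> = (LINT y|lborel. F y * (I y - mass n / g * ?W y))"
    using Bochner_Integration.integral_add[OF i2 i1] by (simp add: algebra_simps)
  finally have "\<bar>(LINT y|lborel. F y * I y) - mass n * ((LINT y|lborel. F y * ?W y) / g)\<bar>
      = \<bar>LINT y|lborel. F y * (I y - mass n / g * ?W y)\<bar>" by simp
  also have "\<dots> \<le> (C / g\<^sup>2 * first_moment n) * (LINT y|lborel. \<bar>F y\<bar>)"
    by (rule integral_mult_bound[OF F _ diff]) simp
  finally show ?thesis unfolding lhs by (simp add: mult_ac)
qed

text \<open>Divided by the mass, the smoothed relation says that \<open>A1 + a n * A2\<close> is of
  order \<open>1 / n\<close>, since the first moment is of order \<open>mass n / n\<close>. As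
  \<open>a n\<close> tends to \<open>0\<close>, this gives \<open>A1 = 0\<close>; then
  \<open>n * a n * \<bar>A2\<bar>\<close> stays bounded, so \<open>A2 = 0\<close>.\<close>

lemma window_moments_zero_imp_weighted_zero:
  fixes F1 F2 w1 w2 :: "real \<Rightarrow> real" and a :: "nat \<Rightarrow> real"
  assumes F: "integrable lborel F1" "integrable lborel F2" and g: "0 < g1" "0 < g2"
    and a: "\<And>n. 0 \<le> a n" "\<And>n. a n \<le> 1" "a \<longlonglongrightarrow> 0" "filterlim (\<lambda>n. real n * a n) at_top sequentially"
    and zero: "\<And>n \<tau>. n \<ge> 1 \<Longrightarrow> \<tau> \<in> {0..\<sigma>} \<Longrightarrow>
      window_moment F1 g1 n \<tau> + a n * window_moment F2 g2 n \<tau> = 0"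
    and w: "\<And>x y. \<bar>w x - w y\<bar> \<le> C * \<bar>x - y\<bar>" "\<And>x. x \<notin> {0<..<\<sigma>} \<Longrightarrow> w x = 0"
  shows "(LINT y|lborel. F1 y * w ((rmin - y) / g1)) = 0"
    and "(LINT y|lborel. F2 y * w ((rmin - y) / g2)) = 0"
proof -
  define A1 where "A1 = (LINT y|lborel. F1 y * w ((rmin - y) / g1)) / g1"
  define A2 where "A2 = (LINT y|lborel. F2 y * w ((rmin - y) / g2)) / g2"
  define Q where "Q = (\<lambda>F g n. LINT \<tau>|lborel. w \<tau> * window_moment F g n \<tau>)"
  define c1 where "c1 = C / g1\<^sup>2 * (LINT y|lborel. \<bar>F1 y\<bar>)"
  define c2 where "c2 = C / g2\<^sup>2 * (LINT y|lborel. \<bar>F2 y\<bar>)"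
  have "0 \<le> C" using w(1)[of 1 0] by simp
  then have c: "0 \<le> c1" "0 \<le> c2" by (simp_all add: c1_def c2_def)
  have fm: "0 \<le> first_moment n" for n
    unfolding first_moment_def
    using r by (intro Bochner_Integration.integral_nonneg) (auto simp: indicator_def)
  have est: "\<bar>A1 + a n * A2\<bar> \<le> (c1 + c2) * rmax / real n" if n: "n \<ge> 1" for n
  proof -
    have "w \<tau> * window_moment F1 g1 n \<tau> = - (a n) * (w \<tau> * window_moment F2 g2 n \<tau>)" for \<tau>
    proof (cases "\<tau> \<in> {0..\<sigma>}")
      case True
      then have "window_moment F1 g1 n \<tau> = - (a n * window_moment F2 g2 n \<tau>)"
        using zero[OF n True] by linarith
      then show ?thesis by simp
    next
      case False
      then have "w \<tau> = 0" by (intro w(2)) auto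
      then show ?thesis by simp
    qed
    then have Q: "Q F1 g1 n = - (a n) * Q F2 g2 n" by (simp only: Q_def integral_mult_right_zero)
    have 1: "\<bar>Q F1 g1 n - mass n * A1\<bar> \<le> c1 * first_moment n"
      unfolding Q_def A1_def c1_def by (rule weighted_window_moment[OF F(1) g(1) w])
    have 2: "\<bar>Q F2 g2 n - mass n * A2\<bar> \<le> c2 * first_moment n"
      unfolding Q_def A2_def c2_def by (rule weighted_window_moment[OF F(2) g(2) w])
    have "mass n * (A1 + a n * A2) = - ((Q F1 g1 n - mass n * A1) + a n * (Q F2 g2 n - mass n * A2))"
      unfolding Q by (simp add: algebra_simps)
    then have "\<bar>mass n * (A1 + a n * A2)\<bar> \<le> \<bar>Q F1 g1 n - mass n * A1\<bar> + \<bar>a n * (Q F2 g2 n - mass n * A2)\<bar>"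
      by linarith
    also have "\<bar>a n * (Q F2 g2 n - mass n * A2)\<bar> \<le> 1 * \<bar>Q F2 g2 n - mass n * A2\<bar>"
      unfolding abs_mult using a by (intro mult_right_mono) auto
    finally have "mass n * \<bar>A1 + a n * A2\<bar> \<le> (c1 + c2) * first_moment n"
      using 1 2 mass_pos[of n] by (simp add: abs_mult distrib_right)
    moreover have "real n * first_moment n \<le> rmax * mass n"
    proof -
      have "real n * first_moment n \<le> (2 * real n - 1) * first_moment n"
        using n fm by (intro mult_right_mono) auto
      then show ?thesis using first_moment_le[OF n] by simp
    qed
    then have "(c1 + c2) * (real n * first_moment n) \<le> (c1 + c2) * (rmax * mass n)"
      using c by (intro mult_left_mono) auto
    ultimately have "real n * (mass n * \<bar>A1 + a n * A2\<bar>) \<le> (c1 + c2) * (rmax * mass n)"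
      using mult_left_mono[of "mass n * \<bar>A1 + a n * A2\<bar>" "(c1 + c2) * first_moment n" "real n"]
      by (simp add: mult.left_commute)
    then have "mass n * (real n * \<bar>A1 + a n * A2\<bar>) \<le> mass n * ((c1 + c2) * rmax)"
      by (simp add: mult_ac)
    then have "real n * \<bar>A1 + a n * A2\<bar> \<le> (c1 + c2) * rmax"
      using mass_pos[of n] by (simp only: mult_le_cancel_left_pos)
    then show ?thesis using n by (simp add: pos_le_divide_eq mult.commute)
  qed
  have ev: "\<forall>\<^sub>F n in sequentially. n \<ge> 1" by (rule eventually_ge_at_top)
  have "(\<lambda>n. A1 + a n * A2) \<longlonglongrightarrow> 0"
  proof (rule Lim_null_comparison)
    show "\<forall>\<^sub>F n in sequentially. norm (A1 + a n * A2) \<le> (c1 + c2) * rmax / real n"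
      using ev by eventually_elim (use est in simp)
    show "(\<lambda>n. (c1 + c2) * rmax / real n) \<longlonglongrightarrow> 0"
      by (rule lim_const_over_n)
  qed
  moreover have "(\<lambda>n. A1 + a n * A2) \<longlonglongrightarrow> A1 + 0 * A2" by (intro tendsto_intros a)
  ultimately have A1: "A1 = 0" using LIMSEQ_unique by fastforce
  have "A2 = 0"
  proof (rule ccontr)
    assume "A2 \<noteq> 0"
    have "\<forall>\<^sub>F n in sequentially. (c1 + c2) * rmax / \<bar>A2\<bar> + 1 \<le> real n * a n"
      using a(4) by (simp add: filterlim_at_top)
    then have "\<forall>\<^sub>F n in sequentially. False"
      using ev
    proof eventually_elim
      case (elim n)
      have "a n * \<bar>A2\<bar> \<le> (c1 + c2) * rmax / real n" using est[OF elim(2)] a(1)[of n] by (simp add: A1 abs_mult)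
      then have "real n * a n \<le> (c1 + c2) * rmax / \<bar>A2\<bar>" using elim(2) \<open>A2 \<noteq> 0\<close> by (simp add: field_simps)
      with elim(1) show False by simp
    qed
    then show False by simp
  qed
  with A1 show "(LINT y|lborel. F1 y * w ((rmin - y) / g1)) = 0"
    "(LINT y|lborel. F2 y * w ((rmin - y) / g2)) = 0"
    using g by (simp_all add: A1_def A2_def)
qed

text \<open>The point \<open>rmin - g * \<tau>\<close> reaches \<open>rmin\<close> at time
  \<open>\<tau>\<close>. So a test function \<open>u\<close> on the stretch before the window
  corresponds to the weight \<open>w \<tau> = u (rmin - g * \<tau>)\<close> on
  \<open>(0, \<sigma>)\<close>, and \<open>w ((rmin - y) / g)\<close> is again
  \<open>u y\<close>.\<close>

lemma window_moments_zero_imp_zero_before_window: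
  fixes F1 F2 :: "real \<Rightarrow> real" and a :: "nat \<Rightarrow> real"
  assumes F: "integrable lborel F1" "integrable lborel F2" and g: "0 < g1" "0 < g2"
    and a: "\<And>n. 0 \<le> a n" "\<And>n. a n \<le> 1" "a \<longlonglongrightarrow> 0" "filterlim (\<lambda>n. real n * a n) at_top sequentially"
    and zero: "\<And>n \<tau>. n \<ge> 1 \<Longrightarrow> \<tau> \<in> {0..\<sigma>} \<Longrightarrow>
      window_moment F1 g1 n \<tau> + a n * window_moment F2 g2 n \<tau> = 0"
  shows "AE y in lborel. y \<in> {rmin - g1 * \<sigma><..<rmin} \<longrightarrow> F1 y = 0"
    and "AE y in lborel. y \<in> {rmin - g2 * \<sigma><..<rmin} \<longrightarrow> F2 y = 0"
proof -
  have w: "\<bar>u (rmin - g * x) - u (rmin - g * y)\<bar> \<le> (C * g) * \<bar>x - y\<bar>"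
    if u: "\<And>x y. \<bar>u x - u y\<bar> \<le> C * \<bar>x - y\<bar>" and "0 < g" for u C g x y
  proof -
    have "\<bar>u (rmin - g * x) - u (rmin - g * y)\<bar> \<le> C * \<bar>(rmin - g * x) - (rmin - g * y)\<bar>" by (rule u)
    also have "(rmin - g * x) - (rmin - g * y) = g * (y - x)" by (simp add: algebra_simps)
    finally show ?thesis using \<open>0 < g\<close> by (simp add: abs_mult abs_minus_commute mult.assoc)
  qed
  have w0: "u (rmin - g * x) = 0"
    if u: "\<And>x. x \<notin> {rmin - g * \<sigma><..<rmin} \<Longrightarrow> u x = 0" and "0 < g" "x \<notin> {0<..<\<sigma>}" for u :: "real \<Rightarrow> real" and g x
  proof (rule u)
    show "rmin - g * x \<notin> {rmin - g * \<sigma><..<rmin}"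
      using \<open>0 < g\<close> \<open>x \<notin> {0<..<\<sigma>}\<close> by (auto simp: zero_less_mult_iff)
  qed
  show "AE y in lborel. y \<in> {rmin - g1 * \<sigma><..<rmin} \<longrightarrow> F1 y = 0"
  proof (rule AE_zero_of_Lipschitz_tests[OF F(1)])
    fix u C assume u: "\<And>x y. \<bar>u x - u y\<bar> \<le> C * \<bar>x - y\<bar>" "\<And>x. x \<notin> {rmin - g1 * \<sigma><..<rmin} \<Longrightarrow> u x = 0"
    have "(LINT y|lborel. F1 y * (\<lambda>x. u (rmin - g1 * x)) ((rmin - y) / g1)) = 0"
      by (rule window_moments_zero_imp_weighted_zero(1)[OF F g a zero, where C="C * g1"];
          (rule w[OF u(1) g(1)] w0[where u=u, OF u(2) g(1)]; assumption)?)
    then show "(LINT y|lborel. F1 y * u y) = 0" using g by simp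
  qed
  show "AE y in lborel. y \<in> {rmin - g2 * \<sigma><..<rmin} \<longrightarrow> F2 y = 0"
  proof (rule AE_zero_of_Lipschitz_tests[OF F(2)])
    fix u C assume u: "\<And>x y. \<bar>u x - u y\<bar> \<le> C * \<bar>x - y\<bar>" "\<And>x. x \<notin> {rmin - g2 * \<sigma><..<rmin} \<Longrightarrow> u x = 0"
    have "(LINT y|lborel. F2 y * (\<lambda>x. u (rmin - g2 * x)) ((rmin - y) / g2)) = 0"
      by (rule window_moments_zero_imp_weighted_zero(2)[OF F g a zero, where C="C * g2"];
          (rule w[OF u(1) g(2)] w0[where u=u, OF u(2) g(2)]; assumption)?)
    then show "(LINT y|lborel. F2 y * u y) = 0" using g by simp
  qed
qed

end

section \<open>The power series of the kernel\<close>

text \<open>Used where an equation holds for almost every \<open>l\<close> while the power series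
  runs in \<open>x = l\<^sup>2\<close>. Failure near zero would fill a whole interval of values of
  \<open>sqrt x\<close>, which has positive measure.\<close>

lemma AE_imp_frequently_sqrt_at_right:
  assumes "AE x in lborel. x \<in> {0<..<b} \<longrightarrow> P x" and "0 < b"
  shows "\<exists>\<^sub>F x in at_right (0::real). P (sqrt x)"
proof (rule ccontr)
  assume "\<not> ?thesis"
  then have "\<forall>\<^sub>F x in at_right (0::real). \<not> P (sqrt x)" by (simp add: frequently_def)
  then obtain c where c: "c > 0" "\<And>x. 0 < x \<Longrightarrow> x < c \<Longrightarrow> \<not> P (sqrt x)"
    unfolding eventually_at_right_field by blast
  define d where "d = min b (sqrt c)"
  have d: "d > 0" using c \<open>0 < b\<close> by (simp add: d_def)
  have "\<not> P x" if "x \<in> {0<..<d}" for x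
  proof -
    have "x\<^sup>2 < (sqrt c)\<^sup>2" using that by (intro power_strict_mono) (auto simp: d_def)
    then have "\<not> P (sqrt (x\<^sup>2))" using that c(1) by (intro c(2)) auto
    then show ?thesis using that by simp
  qed
  then have "AE x in lborel. x \<notin> {0<..<d}"
    using assms(1) by (auto simp: d_def elim!: eventually_mono)
  then have "emeasure lborel {0<..<d} = 0"
    by (subst (asm) AE_iff_measurable[of "{0<..<d}"]) auto
  then show False using d by simp
qed

text \<open>Coefficients of the kernel as a power series in \<open>(l / (2 * r))\<^sup>2\<close>;
  the constant term is zero because \<open>moment \<eta> 0 = 1\<close> cancels the leading
  \<open>1\<close> of the kernel.\<close>

definition kernel_coeff :: "real \<Rightarrow> nat \<Rightarrow> real" where
  "kernel_coeff \<eta> k = (if k = 0 then 0 else - ((1/2 gchoose k) * (- 1) ^ k * moment \<eta> k))"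

text \<open>A zero would need one of the factors \<open>1/2 - i\<close> to vanish, which parity
  excludes.\<close>

lemma gbinomial_half_nonzero: "((1/2 :: real) gchoose k) \<noteq> 0"
proof -
  have "(1/2 :: real) \<noteq> real i" for i
  proof
    assume "(1/2 :: real) = real i"
    then have "real (2 * i) = real 1" by simp
    then have "2 * i = 1" by (simp only: of_nat_eq_iff)
    then show False by presburger
  qed
  then show ?thesis by (auto simp: gbinomial_prod_rev)
qed

lemma summable_kernel_coeff:
  assumes "\<eta> \<ge> 1" "0 \<le> z" "z < 1"
  shows "summable (\<lambda>k. \<bar>kernel_coeff \<eta> k\<bar> * z ^ k)"
proof -
  obtain y where y: "z < y" "y < 1" using dense[OF assms(3)] by blast
  have "summable (\<lambda>k. ((1/2) gchoose k) * y ^ k)" using sqrt_series[of y] y assms by (auto simp: sums_iff)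
  then have "summable (\<lambda>k. norm (((1/2) gchoose k) * z ^ k))" by (rule powser_insidea) (use y assms in auto)
  then have "summable (\<lambda>k. \<bar>(1/2) gchoose k\<bar> * z ^ k)" using assms by (simp add: abs_mult)
  then show ?thesis
  proof (rule summable_comparison_test'[of _ 0])
    fix k
    have "\<bar>kernel_coeff \<eta> k\<bar> \<le> \<bar>(1/2) gchoose k\<bar>"
      using moment_bounds[OF assms(1), of k]
      by (auto simp: kernel_coeff_def abs_mult power_abs mult_left_le)
    then show "norm (\<bar>kernel_coeff \<eta> k\<bar> * z ^ k) \<le> \<bar>(1/2) gchoose k\<bar> * z ^ k"
      using assms by (auto simp: abs_mult intro!: mult_right_mono)
  qed
qed

text \<open>\<open>l < 2 * rmin\<close> places \<open>(l / (2 * r))\<^sup>2\<close> below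
  \<open>1\<close> for every \<open>r\<close> in the window and, with \<open>\<eta> \<ge> 1\<close>,
  keeps \<open>l\<close> in the range where the kernel is given by its integral.\<close>

lemma kernel_eq_series:
  assumes "\<eta> \<ge> 1" "0 < rmin" "r \<in> {rmin..rmax}" "0 < l" "l < 2 * rmin"
  shows "kernel rmin rmax \<eta> l r = (\<Sum>k. kernel_coeff \<eta> k * (l\<^sup>2 * (1 / (2 * r))\<^sup>2) ^ k)"
proof -
  let ?z = "l\<^sup>2 * (1 / (2 * r))\<^sup>2"
  have r: "0 < r" "rmin \<le> r" "r \<le> rmax" using assms by auto
  have "2 * rmax * 1 \<le> 2 * rmax * \<eta>" using assms r by (intro mult_left_mono) auto
  moreover have "l \<le> 2 * rmax * 1" using assms(5) r by linarith
  ultimately have "l \<le> 2 * rmax * \<eta>" by (rule order_trans[rotated])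
  then have l: "l \<in> {0..2 * rmax * \<eta>}" using assms(4) by simp
  have z: "?z = (l / (2 * r))\<^sup>2" by (simp add: power_divide)
  have "\<bar>l / (2 * r)\<bar> < 1" using assms r by (simp add: field_simps)
  then have z1: "0 \<le> ?z" "?z < 1" unfolding z by (simp_all add: abs_square_less_1)
  have ker: "kernel rmin rmax \<eta> l r = 1 - dir_avg \<eta> (\<lambda>a. sqrt (max 0 (1 - ?z * a)))"
    using assms l by (simp only: kernel_def dir_avg_def z simp_thms if_True)
  let ?b = "\<lambda>k. ((1/2) gchoose k) * (- 1) ^ k * moment \<eta> k * ?z ^ k"
  have "?b sums dir_avg \<eta> (\<lambda>a. sqrt (max 0 (1 - ?z * a)))"
    by (rule dir_avg_sqrt_sums[OF assms(1) z1])
  then have "(\<lambda>k. (if k = 0 then 1 else 0) - ?b k) sums (1 - dir_avg \<eta> (\<lambda>a. sqrt (max 0 (1 - ?z * a))))"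
    using sums_single[of 0 "\<lambda>_. 1::real"] by (intro sums_diff) auto
  also have "(\<lambda>k. (if k = 0 then 1 else 0) - ?b k) = (\<lambda>k. kernel_coeff \<eta> k * ?z ^ k)"
    using moment_0[OF assms(1)] by (auto simp: kernel_coeff_def fun_eq_iff)
  finally show ?thesis unfolding ker by (simp add: sums_iff)
qed

text \<open>On the window the kernel agrees with its series, a Borel function of \<open>x\<close>,
  which also settles measurability. There \<open>(1 / (2 * x))\<^sup>2\<close> is at most its value
  at \<open>rmin\<close>, so \<open>l < 2 * rmin\<close> permits termwise integration.\<close>

lemma kernel_integral_sums:
  assumes \<eta>: "\<eta> \<ge> 1" and r: "0 < rmin" "rmin < rmax" and l: "0 < l" "l < 2 * rmin"
    and p: "p \<in> borel_measurable borel" "integrable lborel p"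
    and f: "f \<in> borel_measurable (lebesgue_on {rmin..rmax})"
    and eq: "AE x in lborel. x \<in> {rmin..rmax} \<longrightarrow> f x = p x"
  shows "(\<lambda>k. (kernel_coeff \<eta> k * (LINT x|lborel. (indicator {rmin..rmax} x * p x) * ((1 / (2 * x))\<^sup>2) ^ k)) * (l\<^sup>2) ^ k)
    sums (LINT x|lebesgue_on {rmin..rmax}. kernel rmin rmax \<eta> l x * f x)"
proof -
  note [measurable] = p(1)
  let ?q = "\<lambda>x::real. (1 / (2 * x))\<^sup>2"
  define h where "h = (\<lambda>x. \<Sum>k. kernel_coeff \<eta> k * (l\<^sup>2 * ?q x) ^ k)"
  have h [measurable]: "h \<in> borel_measurable borel" unfolding h_def by measurable
  have hk: "kernel rmin rmax \<eta> l x = h x" if "x \<in> {rmin..rmax}" for x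
    unfolding h_def by (rule kernel_eq_series[OF \<eta> r(1) that l])
  have "h \<in> borel_measurable (lebesgue_on {rmin..rmax})"
    by (rule measurable_restrict_space1) (simp add: measurable_completion)
  then have "(\<lambda>x. h x * f x) \<in> borel_measurable (lebesgue_on {rmin..rmax})" using f by simp
  then have m: "(\<lambda>x. kernel rmin rmax \<eta> l x * f x) \<in> borel_measurable (lebesgue_on {rmin..rmax})"
    by (rule measurable_cong[THEN iffD1, rotated]) (simp add: hk)
  have "(LINT x|lebesgue_on {rmin..rmax}. kernel rmin rmax \<eta> l x * f x) =
      (LINT x|lborel. indicator {rmin..rmax} x * (h x * p x))"
    by (rule integral_lebesgue_on_eq[OF _ m]) (use eq hk in \<open>auto elim!: eventually_mono\<close>)
  also have "\<dots> = (LINT x|lborel. (indicator {rmin..rmax} x * p x) * h x)"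
    by (simp add: mult_ac)
  finally have int: "(LINT x|lebesgue_on {rmin..rmax}. kernel rmin rmax \<eta> l x * f x) =
      (LINT x|lborel. (indicator {rmin..rmax} x * p x) * h x)" .
  show ?thesis
    unfolding int h_def
  proof (rule powser_integral_sums[where Q="(1 / (2 * rmin))\<^sup>2"])
    show "integrable lborel (\<lambda>x. indicator {rmin..rmax} x * p x)"
      using integrable_mult_indicator[of "{rmin..rmax}" lborel p] p by simp
    show "AE x in lborel. indicator {rmin..rmax} x * p x \<noteq> 0 \<longrightarrow> \<bar>?q x\<bar> \<le> (1 / (2 * rmin))\<^sup>2"
      using r by (intro AE_I2) (auto simp: indicator_def intro!: power_mono frac_le split: if_splits)
    have "(l / (2 * rmin))\<^sup>2 < 1" using l r by (simp add: power_less_one_iff)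
    then show "l\<^sup>2 * (1 / (2 * rmin))\<^sup>2 < 1" by (simp add: power_divide)
  qed (use summable_kernel_coeff[OF \<eta>] in auto)
qed

text \<open>Comparing coefficients in \<open>l\<^sup>2\<close>: both components share the nonzero
  factor \<open>(1/2 gchoose n) * (- 1) ^ n * (1 / 4) ^ n\<close>, up to sign, and only
  \<open>moment\<close> distinguishes the shapes. The order \<open>n = 0\<close> carries no
  information, as the kernels have no constant term.\<close>

lemma K_op_zero_imp_moment_relation:
  fixes p :: "2 \<Rightarrow> real \<Rightarrow> real"
  assumes \<eta>: "\<And>i. \<eta> i \<ge> 1" and r: "0 < rmin" "rmin < rmax" and "0 < lmax"
    and p: "\<And>i. p i \<in> borel_measurable borel" "\<And>i. integrable lborel (p i)"
    and f: "\<And>i. f i \<in> borel_measurable (lebesgue_on {rmin..rmax})"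
    and eq: "\<And>i. AE x in lborel. x \<in> {rmin..rmax} \<longrightarrow> f i x = p i x"
    and K0: "AE l in lebesgue_on {0<..<lmax}. K_op rmin rmax \<eta> f l = 0"
    and n: "n \<ge> 1"
  shows "(\<Sum>i\<in>UNIV. moment (\<eta> i) n * (LINT x|lborel. p i x * (indicator {rmin..rmax} x * (1 / x) ^ (2 * n)))) = 0"
proof -
  let ?X = "\<lambda>i k. LINT x|lborel. (indicator {rmin..rmax} x * p i x) * ((1 / (2 * x))\<^sup>2) ^ k"
  have "(\<Sum>i\<in>UNIV. kernel_coeff (\<eta> i) n * ?X i n) = 0"
  proof (rule powser_coeff_eq_0[where S="\<lambda>x. K_op rmin rmax \<eta> f (sqrt x)" and \<rho>="(2 * rmin)\<^sup>2"
        and A="\<lambda>k. \<Sum>i\<in>UNIV. kernel_coeff (\<eta> i) k * ?X i k"])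
    show "0 < (2 * rmin)\<^sup>2" using r by simp
    fix x :: real assume x: "0 < x" "x < (2 * rmin)\<^sup>2"
    have l: "0 < sqrt x" "sqrt x < 2 * rmin" using x r by (auto simp: real_less_lsqrt)
    have "(\<lambda>k. \<Sum>i\<in>UNIV. (kernel_coeff (\<eta> i) k * ?X i k) * ((sqrt x)\<^sup>2) ^ k) sums K_op rmin rmax \<eta> f (sqrt x)"
      unfolding K_op_def by (intro sums_sum kernel_integral_sums \<eta> r l p f eq)
    then show "(\<lambda>k. (\<Sum>i\<in>UNIV. kernel_coeff (\<eta> i) k * ?X i k) * x ^ k) sums K_op rmin rmax \<eta> f (sqrt x)"
      using x by (simp add: sum_distrib_right)
  next
    show "\<exists>\<^sub>F x in at_right 0. K_op rmin rmax \<eta> f (sqrt x) = 0"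
      by (rule AE_imp_frequently_sqrt_at_right[OF _ \<open>0 < lmax\<close>]) (use K0 in \<open>simp add: AE_lebesgue_on_iff\<close>)
  qed
  moreover have "?X i n = (1 / 4) ^ n * (LINT x|lborel. p i x * (indicator {rmin..rmax} x * (1 / x) ^ (2 * n)))" for i
  proof -
    have "((1 / (2 * x))\<^sup>2) ^ n = (1 / 4) ^ n * (1 / x) ^ (2 * n)" for x :: real
      by (simp add: power_mult power_mult_distrib[symmetric] power2_eq_square)
    then have "?X i n = (LINT x|lborel. (1 / 4) ^ n * (p i x * (indicator {rmin..rmax} x * (1 / x) ^ (2 * n))))"
      by (simp add: mult_ac)
    then show ?thesis by (simp only: integral_mult_right_zero)
  qed
  ultimately have "(- ((1/2 gchoose n) * (- 1) ^ n) * (1 / 4) ^ n) *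
      (\<Sum>i\<in>UNIV. moment (\<eta> i) n * (LINT x|lborel. p i x * (indicator {rmin..rmax} x * (1 / x) ^ (2 * n)))) = 0"
    using n by (simp add: kernel_coeff_def sum_distrib_left mult_ac)
  moreover have "- ((1/2 gchoose n) * (- 1) ^ n) * (1 / 4) ^ n \<noteq> (0::real)"
    using gbinomial_half_nonzero by simp
  ultimately show ?thesis by (simp only: mult_eq_0_iff simp_thms)
qed

section \<open>Almost everywhere statements under shifts and left limits\<close>

lemma AE_lborel_shift:
  fixes c :: real
  assumes "AE x in lborel. P x"
  shows "AE x in lborel. P (x + c)"
proof -
  have "AE x in lebesgue. P x" using assms by (simp only: AE_completion_iff)
  then obtain N where N: "negligible N" "{x. \<not> P x} \<subseteq> N"
    unfolding eventually_ae_filter_negligible by blast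
  have "negligible ((+) (- c) ` N)" using N(1) by (rule negligible_translation)
  moreover have "{x. \<not> P (x + c)} \<subseteq> (+) (- c) ` N"
  proof
    fix x assume "x \<in> {x. \<not> P (x + c)}"
    then have "x + c \<in> N" using N(2) by auto
    then show "x \<in> (+) (- c) ` N" by (intro image_eqI[of _ _ "x + c"]) auto
  qed
  ultimately have "AE x in lebesgue. P (x + c)"
    unfolding eventually_ae_filter_negligible by blast
  then show ?thesis by (simp add: AE_completion_iff)
qed

lemma borel_measurable_lebesgue_on_AE:
  fixes f p :: "real \<Rightarrow> real"
  assumes [measurable]: "S \<in> sets borel" "p \<in> borel_measurable borel" and eq: "AE x in lborel. x \<in> S \<longrightarrow> f x = p x"
  shows "f \<in> borel_measurable (lebesgue_on S)"
proof -
  have "(\<lambda>x. indicator S x * p x) \<in> borel_measurable lebesgue"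
    by (rule measurable_completion) measurable
  moreover have "AE x in lebesgue. indicator S x * p x = indicator S x * f x"
    using eq unfolding AE_completion_iff by eventually_elim (auto simp: indicator_def)
  ultimately have "(\<lambda>x. indicator S x * f x) \<in> borel_measurable lebesgue"
    by (rule borel_measurable_AE)
  then show ?thesis by (subst borel_measurable_restrict_space_iff) auto
qed

text \<open>Each left limit belongs to its own representative \<open>k\<close>, so pointwise values
  of \<open>h\<close> cannot be used. Instead the bound \<open>\<bar>h y\<bar> \<le> e\<close> is
  pushed leftwards from \<open>d\<close>: if it reached only down to some \<open>m > c\<close>, the
  left limit at \<open>m\<close> would carry it further.\<close>

lemma AE_zero_of_left_limits:
  fixes h :: "real \<Rightarrow> real"
  assumes ac: "a \<le> c" "c \<le> d"
    and lim: "\<And>x. c < x \<Longrightarrow> x \<le> d \<Longrightarrow>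
      \<exists>k. (AE y in lborel. y \<in> {a<..<x} \<longrightarrow> h y = k y) \<and> (k \<longlongrightarrow> 0) (at_left x)"
  shows "AE y in lborel. y \<in> {c<..<d} \<longrightarrow> h y = 0"
proof -
  have small: "AE y in lborel. y \<in> {c<..<d} \<longrightarrow> \<bar>h y\<bar> \<le> e" if e: "e > 0" for e
  proof -
    define M where "M = {x \<in> {c..d}. AE y in lborel. y \<in> {x<..<d} \<longrightarrow> \<bar>h y\<bar> \<le> e}"
    have M: "d \<in> M" "bdd_below M" using ac by (auto simp: M_def)
    define m where "m = Inf M"
    have m: "c \<le> m" "m \<le> d"
      using M by (auto simp: m_def M_def intro!: cInf_greatest cInf_lower)
    have "\<exists>x\<in>M. x < m + 1 / real (Suc n)" for n
      using cInf_lessD[of M "m + 1 / real (Suc n)"] M by (auto simp: m_def)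
    then obtain x where x: "\<And>n. x n \<in> M" "\<And>n. x n < m + 1 / real (Suc n)" by metis
    \<comment> \<open>Only countably many exceptional sets are united, so the bound passes to the
      infimum itself.\<close>
    have "AE y in lborel. \<forall>n. y \<in> {x n<..<d} \<longrightarrow> \<bar>h y\<bar> \<le> e"
      using x(1) by (subst AE_all_countable) (auto simp: M_def)
    then have Pm: "AE y in lborel. y \<in> {m<..<d} \<longrightarrow> \<bar>h y\<bar> \<le> e"
    proof eventually_elim
      case (elim y)
      show ?case
      proof
        assume y: "y \<in> {m<..<d}"
        then obtain n where "1 / real (Suc n) < y - m" using nat_approx_posE[of "y - m"] by auto
        then show "\<bar>h y\<bar> \<le> e" using elim[rule_format, of n] x(2)[of n] y by auto
      qed
    qed
    have "m = c"
    proof (rule ccontr)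
      assume "m \<noteq> c"
      then obtain k where hk: "AE y in lborel. y \<in> {a<..<m} \<longrightarrow> h y = k y" and k: "(k \<longlongrightarrow> 0) (at_left m)"
        using lim[of m] m by auto
      have "\<forall>\<^sub>F y in at_left m. \<bar>k y\<bar> < e" using tendstoD[OF k e] by (simp add: dist_real_def)
      then obtain b where b: "b < m" "\<And>y. b < y \<Longrightarrow> y < m \<Longrightarrow> \<bar>k y\<bar> < e"
        unfolding eventually_at_left_field by blast
      define b' where "b' = max b c"
      have b': "b' < m" "c \<le> b'" using b m \<open>m \<noteq> c\<close> by (auto simp: b'_def)
      have "AE y in lborel. y \<noteq> m" by (rule AE_lborel_singleton)
      then have "AE y in lborel. y \<in> {b'<..<d} \<longrightarrow> \<bar>h y\<bar> \<le> e"
        using Pm hk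
      proof eventually_elim
        case (elim y)
        show ?case
        proof
          assume y: "y \<in> {b'<..<d}"
          show "\<bar>h y\<bar> \<le> e"
          proof (cases "y < m")
            case True
            then show ?thesis using elim(3) y b(2)[of y] ac by (auto simp: b'_def)
          next
            case False
            then show ?thesis using elim y by auto
          qed
        qed
      qed
      then have "b' \<in> M" using b' m by (simp add: M_def)
      then have "m \<le> b'" unfolding m_def using M(2) by (rule cInf_lower)
      with b' show False by simp
    qed
    with Pm show ?thesis by simp
  qed
  have "AE y in lborel. \<forall>n::nat. y \<in> {c<..<d} \<longrightarrow> \<bar>h y\<bar> \<le> 1 / real (Suc n)"
    by (subst AE_all_countable, intro allI small) simp
  then show ?thesis
  proof eventually_elim
    case (elim y)
    show ?case
    proof (intro impI, rule ccontr)
      assume y: "y \<in> {c<..<d}" and "h y \<noteq> 0"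
      then obtain n where "1 / real (Suc n) < \<bar>h y\<bar>" using nat_approx_posE[of "\<bar>h y\<bar>"] by auto
      then show False using elim[rule_format, OF y, of n] by simp
    qed
  qed
qed

lemma moment_sphere: "moment 1 n = 1"
  using dir_avg_const[of 1 1] by (simp add: moment_def dir_avg_def)

section \<open>Uniqueness\<close>

text \<open>Since the rates are proportional, the single clock
  \<open>integral {0..t} (G 1) / g 1\<close> serves both components. Its final value is positive
  because \<open>G 1\<close> has a positive minimum on the compact interval.\<close>

lemma common_time_change:
  fixes G :: "2 \<Rightarrow> real \<Rightarrow> real"
  assumes "0 < T" and C1: "\<And>i. C1_on (G i) {0..T}" and pos: "\<And>i t. t \<in> {0..T} \<Longrightarrow> G i t > 0"
    and g: "\<And>i. g i > 0" and ratio: "\<And>t. t \<in> {0..T} \<Longrightarrow> g 2 * G 1 t = g 1 * G 2 t"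
  obtains \<tau> where "\<And>i t. t \<in> {0..T} \<Longrightarrow> integral {0..t} (G i) = g i * \<tau> t"
    "continuous_on {0..T} \<tau>" "\<tau> 0 = 0" "\<And>t. t \<in> {0..T} \<Longrightarrow> 0 \<le> \<tau> t \<and> \<tau> t \<le> \<tau> T" "0 < \<tau> T"
    "\<And>i t. t \<in> {0..T} \<Longrightarrow> ((\<lambda>t. g i * \<tau> t) has_real_derivative G i t) (at t within {0..T})"
proof
  define \<tau> where "\<tau> = (\<lambda>t. integral {0..t} (G 1) / g 1)"
  have cG: "continuous_on {0..T} (G i)" for i
    using C1[of i] unfolding C1_on_def has_C1_deriv_on_def by (blast intro: DERIV_continuous_on)
  have int: "G i integrable_on {0..t}" if "t \<in> {0..T}" for i t
    using cG by (rule integrable_continuous_real[OF continuous_on_subset]) (use that in auto)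
  show S: "integral {0..t} (G i) = g i * \<tau> t" if t: "t \<in> {0..T}" for i t
  proof -
    have "g 2 * integral {0..t} (G 1) = integral {0..t} (\<lambda>s. g 2 * G 1 s)" by simp
    also have "\<dots> = integral {0..t} (\<lambda>s. g 1 * G 2 s)"
      by (rule integral_cong) (use ratio t in auto)
    also have "\<dots> = g 1 * integral {0..t} (G 2)" by simp
    finally have "integral {0..t} (G 2) = g 2 * \<tau> t" using g[of 1] by (simp add: \<tau>_def field_simps)
    moreover have "integral {0..t} (G 1) = g 1 * \<tau> t" using g[of 1] by (simp add: \<tau>_def)
    ultimately show ?thesis using exhaust_2[of i] by auto
  qed
  show "\<tau> 0 = 0" by (simp add: \<tau>_def)
  show der: "((\<lambda>t. g i * \<tau> t) has_real_derivative G i t) (at t within {0..T})" if t: "t \<in> {0..T}" for i t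
    using integral_has_real_derivative[OF cG t, of i]
    by (rule has_field_derivative_transform_within[OF _ zero_less_one t]) (simp add: S)
  have "continuous_on {0..T} (\<lambda>t. g 1 * \<tau> t)" using der by (rule DERIV_continuous_on)
  then have "continuous_on {0..T} (\<lambda>t. g 1 * \<tau> t * (1 / g 1))" by (rule continuous_on_mult_right)
  moreover have "(\<lambda>t. g 1 * \<tau> t * (1 / g 1)) = \<tau>" using g[of 1] by auto
  ultimately show "continuous_on {0..T} \<tau>" by (simp only:)
  have nonneg: "0 \<le> integral {0..t} (G 1)" if "t \<in> {0..T}" for t
    by (rule Henstock_Kurzweil_Integration.integral_nonneg[OF int[OF that]]) (use pos that in \<open>auto intro: less_imp_le\<close>)
  show "0 \<le> \<tau> t \<and> \<tau> t \<le> \<tau> T" if t: "t \<in> {0..T}" for t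
  proof
    show "0 \<le> \<tau> t" using nonneg[OF t] g[of 1] by (simp add: \<tau>_def)
    have "integral {0..t} (G 1) \<le> integral {0..T} (G 1)"
      using t \<open>0 < T\<close> by (intro integral_subset_le int) (auto intro: less_imp_le[OF pos])
    then show "\<tau> t \<le> \<tau> T" using g[of 1] by (simp add: \<tau>_def divide_right_mono)
  qed
  obtain s where s: "s \<in> {0..T}" "\<And>t. t \<in> {0..T} \<Longrightarrow> G 1 s \<le> G 1 t"
    using continuous_attains_inf[OF compact_Icc _ cG[of 1]] \<open>0 < T\<close> by auto
  have "0 < T * G 1 s" using \<open>0 < T\<close> pos[OF s(1)] by simp
  also have "\<dots> = integral {0..T} (\<lambda>_. G 1 s)" using \<open>0 < T\<close> by simp
  also have "\<dots> \<le> integral {0..T} (G 1)" by (rule integral_le) (use s int \<open>0 < T\<close> in auto)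
  finally show "0 < \<tau> T" using g[of 1] by (simp add: \<tau>_def)
qed

theorem theorem4p3:
  fixes rmin rmax tmax r0 r1 lmax :: real
    and \<eta> g :: "2 \<Rightarrow> real"
    and G :: "2 \<Rightarrow> real \<Rightarrow> real"
    and \<psi>0 :: "2 \<Rightarrow> real \<Rightarrow> real"
    and \<psi> :: "real \<Rightarrow> 2 \<Rightarrow> real \<Rightarrow> real"
  assumes "0 < rmin" and "rmin < rmax" and "0 < tmax"
    and "\<eta> 1 = 1" and "\<eta> 2 > 1"
    and "\<And>i. C1_on (G i) {0..tmax}"
    and "\<And>i t. t \<in> {0..tmax} \<Longrightarrow> G i t > 0"
    and "\<And>i. g i > 0"
    and "\<And>t. t \<in> {0..tmax} \<Longrightarrow> g 2 * G 1 t = g 1 * G 2 t"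
    and "r0 = rmin - (MAX i. integral {0..tmax} (G i))"
    and "r1 = rmax"
    and "lmax = 2 * rmax * max (\<eta> 1) (\<eta> 2)"
    and "\<And>i. \<psi>0 i \<in> sobolev_H 2 r0 r1"
    and "\<And>i. AE r in lebesgue_on {r0..<rmin - integral {0..tmax} (G i)}. \<psi>0 i r = 0"
    and "transport_solution tmax r0 r1 G \<psi>0 \<psi>"
    and "\<And>i t. t \<in> {0..tmax} \<Longrightarrow> has_left_value r0 r1 (\<psi> t i) 0"
  shows "(\<forall>t\<in>{0..tmax}. AE l in lebesgue_on {0<..<lmax}. K_op rmin rmax \<eta> (\<psi> t) l = 0)
           \<longrightarrow> X2_eq r0 r1 \<psi>0 (\<lambda>i r. 0)"
proof
  assume K0: "\<forall>t\<in>{0..tmax}. AE l in lebesgue_on {0<..<lmax}. K_op rmin rmax \<eta> (\<psi> t) l = 0"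
  note r = \<open>0 < rmin\<close> \<open>rmin < rmax\<close> and g = \<open>\<And>i. g i > 0\<close> and sol = \<open>transport_solution tmax r0 r1 G \<psi>0 \<psi>\<close>
  obtain \<tau> where S: "\<And>i t. t \<in> {0..tmax} \<Longrightarrow> integral {0..t} (G i) = g i * \<tau> t"
    and c\<tau>: "continuous_on {0..tmax} \<tau>" and \<tau>0: "\<tau> 0 = 0"
    and \<tau>b: "\<And>t. t \<in> {0..tmax} \<Longrightarrow> 0 \<le> \<tau> t \<and> \<tau> t \<le> \<tau> tmax" and \<tau>pos: "0 < \<tau> tmax"
    and d\<tau>: "\<And>i t. t \<in> {0..tmax} \<Longrightarrow> ((\<lambda>t. g i * \<tau> t) has_real_derivative G i t) (at t within {0..tmax})"
    using common_time_change[OF \<open>0 < tmax\<close> assms(6-9)] by metis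
  define \<sigma> where "\<sigma> = \<tau> tmax"
  have Smax: "integral {0..tmax} (G i) = g i * \<sigma>" for i using S[of tmax i] \<open>0 < tmax\<close> by (simp add: \<sigma>_def)
  \<comment> \<open>\<open>r0\<close> lies below \<open>rmin\<close> by the largest total shift, so
    points of the window shifted back never pass \<open>r0\<close>.\<close>
  have r0: "r0 \<le> rmin - g i * \<sigma>" for i
  proof -
    have "g i * \<sigma> \<le> (MAX i. g i * \<sigma>)" by (rule Max_ge) auto
    then show ?thesis unfolding \<open>r0 = _\<close> Smax by linarith
  qed
  have gs: "0 < g i * \<sigma>" for i using g[of i] \<tau>pos by (simp add: \<sigma>_def)
  have shift: "0 \<le> g i * \<tau> t" "g i * \<tau> t \<le> g i * \<sigma>" if "t \<in> {0..tmax}" for i t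
    using \<tau>b[OF that] g[of i] by (simp_all add: \<sigma>_def)
  \<comment> \<open>Every clock value is attained, so relations for all \<open>t\<close> become
    relations for all \<open>s \<in> {0..\<sigma>}\<close>.\<close>
  have onto: "\<exists>t\<in>{0..tmax}. \<tau> t = s" if "0 \<le> s" "s \<le> \<sigma>" for s
  proof -
    have "\<exists>t. 0 \<le> t \<and> t \<le> tmax \<and> \<tau> t = s"
      using that \<open>0 < tmax\<close> by (intro IVT' c\<tau>) (simp_all add: \<tau>0 \<sigma>_def)
    then show ?thesis by auto
  qed
  have r01: "r0 < r1" "rmin \<le> r1" using r0[of 1] gs[of 1] r \<open>r1 = rmax\<close> by auto

  have "\<psi>0 i \<in> L2 r0 r1" for i
    using assms(13)[of i] by (auto simp: numeral_2_eq_2 has_L2_weak_deriv_def)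
  then have "\<exists>h. h \<in> borel_measurable borel \<and> integrable lborel h \<and> (\<forall>x. x \<notin> {r0<..<r1} \<longrightarrow> h x = 0) \<and>
      (AE x in lborel. x \<in> {r0<..<r1} \<longrightarrow> \<psi>0 i x = h x)" for i
    by (metis L2_borel_representative)
  then obtain h where h: "\<And>i. h i \<in> borel_measurable borel" "\<And>i. integrable lborel (h i)"
    "\<And>i x. x \<notin> {r0<..<r1} \<Longrightarrow> h i x = 0" "\<And>i. AE x in lborel. x \<in> {r0<..<r1} \<longrightarrow> \<psi>0 i x = h i x"
    by metis
  note [measurable] = h(1)

  \<comment> \<open>All shifts stay below \<open>r1 - r0\<close>, so the profile wraps around at
    most once; on \<open>(r0, r1)\<close> the cut-off at \<open>r1\<close> is automatic.\<close>
  have repr: "AE x in lborel. x \<in> {r0<..<r1} \<longrightarrow>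
      \<psi> t i x = h i (x - g i * \<tau> t) + h i (x - g i * \<tau> t + (r1 - r0)) * indicator {r0<..} x"
    if t: "t \<in> {0..tmax}" for t i
  proof -
    have "\<psi> t i \<in> L2 r0 r1" using sol t by (simp add: transport_solution_def)
    then have "\<exists>p. p \<in> borel_measurable borel \<and> integrable lborel p \<and> (\<forall>x. x \<notin> {r0<..<r1} \<longrightarrow> p x = 0) \<and>
      (AE x in lborel. x \<in> {r0<..<r1} \<longrightarrow> \<psi> t i x = p x)"
      by (metis L2_borel_representative)
    then obtain p where p: "p \<in> borel_measurable borel" "integrable lborel p" "\<And>x. x \<notin> {r0<..<r1} \<Longrightarrow> p x = 0"
      "AE x in lborel. x \<in> {r0<..<r1} \<longrightarrow> \<psi> t i x = p x" by metis
    have "g i * \<tau> t < r1 - r0" using shift[OF t, of i] r0[of i] r \<open>r1 = rmax\<close> by linarith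
    then have "AE x in lborel. p x = h i (x - g i * \<tau> t) * indicator {..<r1} x +
        h i (x - g i * \<tau> t + (r1 - r0)) * indicator {r0<..} x"
      by (intro transport_solution_representation[OF sol r01(1) _ d\<tau> t shift(1)[OF t] _ p h(1-4)])
         (simp_all add: \<tau>0)
    with p(4) show ?thesis by eventually_elim (auto simp: indicator_def)
  qed

  have zero_right: "AE y in lborel. y \<in> {rmax - g i * \<sigma><..<rmax} \<longrightarrow> h i y = 0" for i
  proof (rule AE_zero_of_left_limits[where a=r0])
    show "r0 \<le> rmax - g i * \<sigma>" "rmax - g i * \<sigma> \<le> rmax" using r0[of i] r gs[of i] by auto
    fix x assume x: "rmax - g i * \<sigma> < x" "x \<le> rmax"
    \<comment> \<open>The point \<open>x\<close> arrives at \<open>rmax\<close> when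
      \<open>g i * \<tau> t = rmax - x\<close>; the left value of \<open>\<psi> t i\<close> at
      \<open>rmax\<close> is then the left limit of \<open>h i\<close> at \<open>x\<close>.\<close>
    have "0 \<le> (rmax - x) / g i" "(rmax - x) / g i \<le> \<sigma>" using x g[of i] by (auto simp: field_simps)
    then obtain t where t: "t \<in> {0..tmax}" and "\<tau> t = (rmax - x) / g i" using onto by blast
    then have s: "g i * \<tau> t = rmax - x" using g[of i] by simp
    obtain f where f: "AE y in lborel. y \<in> {r0<..<r1} \<longrightarrow> \<psi> t i y = f y" "(f \<longlongrightarrow> 0) (at_left r1)"
      using assms(16)[OF t, of i] by (auto simp: has_left_value_def AE_lebesgue_on_iff)
    \<comment> \<open>Right of \<open>r0 + (rmax - x)\<close> the re-entering summand is evaluated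
      beyond \<open>r1\<close> and vanishes.\<close>
    have "AE y in lborel. y \<in> {r0 + (rmax - x)<..<r1} \<longrightarrow> h i (y - (rmax - x)) = f y"
      using f(1) repr[OF t, of i]
    proof eventually_elim
      case (elim y)
      show ?case
      proof
        assume y: "y \<in> {r0 + (rmax - x)<..<r1}"
        then have "y \<in> {r0<..<r1}" using x by auto
        moreover have "h i (y - (rmax - x) + (r1 - r0)) = 0" using y by (intro h(3)) auto
        ultimately show "h i (y - (rmax - x)) = f y" using elim by (simp add: s)
      qed
    qed
    from AE_lborel_shift[OF this, of "rmax - x"]
    have "AE y in lborel. y \<in> {r0<..<x} \<longrightarrow> h i y = f (y + (rmax - x))"
      by eventually_elim (auto simp: \<open>r1 = rmax\<close>)
    moreover have "((\<lambda>y. f (y + (rmax - x))) \<longlongrightarrow> 0) (at_left x)"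
    proof (rule filterlim_compose[OF f(2)])
      have "((\<lambda>y. y + (rmax - x)) \<longlongrightarrow> x + (rmax - x)) (at_left x)" by (intro tendsto_intros)
      then show "filterlim (\<lambda>y. y + (rmax - x)) (at_left r1) (at_left x)"
        by (simp add: filterlim_at eventually_at_filter \<open>r1 = rmax\<close>)
    qed
    ultimately show "\<exists>k. (AE y in lborel. y \<in> {r0<..<x} \<longrightarrow> h i y = k y) \<and> (k \<longlongrightarrow> 0) (at_left x)"
      by (intro exI[of _ "\<lambda>y. f (y + (rmax - x))"] conjI)
  qed

  have \<eta>: "\<eta> i \<ge> 1" for i using exhaust_2[of i] \<open>\<eta> 1 = 1\<close> \<open>\<eta> 2 > 1\<close> by auto
  let ?a = "moment (\<eta> 2)"
  have window: "window_moment rmin rmax (h 1) (g 1) n s + ?a n * window_moment rmin rmax (h 2) (g 2) n s = 0"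
    if n: "n \<ge> 1" and s: "s \<in> {0..\<sigma>}" for n s
  proof -
    obtain t where t: "t \<in> {0..tmax}" and ts: "\<tau> t = s" using onto[of s] s by auto
    let ?p = "\<lambda>i x. h i (x - g i * s)"
    \<comment> \<open>On the window nothing has re-entered: \<open>x - g i * s \<ge> r0\<close> puts
      the second argument at or beyond \<open>r1\<close>, where \<open>h i\<close> is zero. The end
      point \<open>r1\<close> is a null set.\<close>
    have rep: "AE x in lborel. x \<in> {rmin..rmax} \<longrightarrow> \<psi> t i x = ?p i x" for i
      using repr[OF t, of i] AE_lborel_singleton[of r1]
    proof eventually_elim
      case (elim x)
      show ?case
      proof
        assume x: "x \<in> {rmin..rmax}"
        have "r0 < rmin" using r0[of i] gs[of i] by linarith
        then have "x \<in> {r0<..<r1}" using x elim(2) \<open>r1 = rmax\<close> by auto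
        moreover have "x - g i * \<tau> t \<ge> r0" using x r0[of i] shift[OF t, of i] by auto
        then have "h i (x - g i * \<tau> t + (r1 - r0)) = 0" by (intro h(3)) auto
        ultimately show "\<psi> t i x = ?p i x" using elim(1) ts by simp
      qed
    qed
    have "(\<Sum>i\<in>UNIV. moment (\<eta> i) n * (LINT x|lborel. ?p i x * (indicator {rmin..rmax} x * (1 / x) ^ (2 * n)))) = 0"
    proof (rule K_op_zero_imp_moment_relation[OF \<eta> r, where f="\<psi> t"])
      show "0 < lmax"
        unfolding \<open>lmax = _\<close> using r \<open>\<eta> 1 = 1\<close> by (intro mult_pos_pos) (auto simp: less_max_iff_disj)
      show "?p i \<in> borel_measurable borel" for i by measurable
      show "integrable lborel (?p i)" for i
        using lborel_integrable_real_affine[OF h(2)[of i], of 1 "- (g i * s)"] by (simp add: add.commute)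
      show "\<psi> t i \<in> borel_measurable (lebesgue_on {rmin..rmax})" for i
        by (rule borel_measurable_lebesgue_on_AE[OF _ _ rep]) auto
      show "AE l in lebesgue_on {0<..<lmax}. K_op rmin rmax \<eta> (\<psi> t) l = 0"
        by (rule bspec[OF K0 t])
    qed (rule rep n)+
    moreover have "(LINT x|lborel. ?p i x * (indicator {rmin..rmax} x * (1 / x) ^ (2 * n))) =
        window_moment rmin rmax (h i) (g i) n s" for i
      unfolding window_moment_def[OF r]
      by (subst lborel_integral_real_affine[where c=1 and t="g i * s"]) (simp_all add: add.commute)
    ultimately show ?thesis using \<open>\<eta> 1 = 1\<close> by (simp add: sum_2 moment_sphere)
  qed

  note a = moment_tendsto_0[OF \<eta> \<open>\<eta> 2 > 1\<close>] filterlim_mult_moment_at_top[OF \<eta>]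
  \<comment> \<open>These are the values that would enter through \<open>rmin\<close> before the
    clock reaches \<open>\<sigma>\<close>.\<close>
  have zero_left: "AE y in lborel. y \<in> {rmin - g i * \<sigma><..<rmin} \<longrightarrow> h i y = 0" for i
  proof -
    note W = window_moments_zero_imp_zero_before_window[OF r h(2) h(2) g g moment_bounds[OF \<eta>] a window]
    have "AE y in lborel. y \<in> {rmin - g 1 * \<sigma><..<rmin} \<longrightarrow> h 1 y = 0"
      by (rule W(1); assumption)
    moreover have "AE y in lborel. y \<in> {rmin - g 2 * \<sigma><..<rmin} \<longrightarrow> h 2 y = 0"
      by (rule W(2); assumption)
    ultimately show ?thesis using exhaust_2[of i] by (elim disjE) (simp_all only:)
  qed
  \<comment> \<open>Left of \<open>rmin\<close> the profile vanishes by the hypothesis on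
    \<open>\<psi>0\<close> and by \<open>zero_left\<close>, right of
    \<open>rmax - g i * \<sigma>\<close> by \<open>zero_right\<close>; so the cut changes only a
    null set.\<close>
  define F where "F = (\<lambda>i y. h i y * indicator {rmin..rmax - g i * \<sigma>} y)"
  have hF: "AE y in lborel. h i y = F i y" for i
  proof -
    have "AE y in lborel. y \<in> {r0..<rmin - g i * \<sigma>} \<longrightarrow> \<psi>0 i y = 0"
      using assms(14)[of i] by (simp add: Smax AE_lebesgue_on_iff)
    then show ?thesis
      using h(4)[of i] zero_left[of i] zero_right[of i] AE_lborel_singleton[of "rmin - g i * \<sigma>"]
    proof eventually_elim
      case (elim y)
      show ?case
      proof (cases "y \<in> {r0<..<r1} \<and> y \<notin> {rmin..rmax - g i * \<sigma>}")
        case True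
        then show ?thesis using elim \<open>r1 = rmax\<close> by (auto simp: F_def indicator_def not_le)
      next
        case False
        then show ?thesis using h(3)[of y i] by (auto simp: F_def)
      qed
    qed
  qed
  have Fint: "integrable lborel (F i)" for i
    unfolding F_def by (rule integrable_mult_bounded[OF h(2), where C=1]) auto
  have Fsupp: "F i y = 0" if "y \<notin> {rmin..rmax}" for i y
    using that gs[of i] by (auto simp: F_def indicator_def)
  \<comment> \<open>On the support of \<open>F i\<close> the shifted point
    \<open>y + g i * s\<close> stays in \<open>{rmin..rmax}\<close> for all these \<open>s\<close>.
    The window indicator disappears, and the integral can be expanded in powers of
    \<open>s\<close>.\<close>
  have Fwindow: "window_moment rmin rmax (h i) (g i) n s = (LINT y|lborel. F i y * (1 / (y + g i * s)) ^ (2 * n))"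
    if s: "0 \<le> s" "s \<le> \<sigma>" for i n s
    unfolding window_moment_def[OF r]
  proof (rule integral_cong_AE)
    have gs': "g i * s \<le> g i * \<sigma>" "0 \<le> g i * s" using s g[of i] by auto
    show "AE y in lborel. h i y * (indicator {rmin..rmax} (y + g i * s) * (1 / (y + g i * s)) ^ (2 * n)) =
        F i y * (1 / (y + g i * s)) ^ (2 * n)"
      using hF[of i] by eventually_elim (use gs' in \<open>auto simp: F_def indicator_def\<close>)
    show "(\<lambda>y. F i y * (1 / (y + g i * s)) ^ (2 * n)) \<in> borel_measurable lborel"
      unfolding F_def by measurable
  qed measurable
  have F0: "AE y in lborel. F i y = 0" for i
  proof -
    have zero: "(LINT y|lborel. F 1 y * (1 / (y + g 1 * s)) ^ (2 * n)) +
        ?a n * (LINT y|lborel. F 2 y * (1 / (y + g 2 * s)) ^ (2 * n)) = 0"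
      if "n \<ge> 1" "0 \<le> s" "s < \<sigma>" for n s
      using window[of n s] that by (simp add: Fwindow)
    note Z = two_functions_zero_of_shifted_moments[where R=rmax, OF Fint Fint Fsupp Fsupp \<open>0 < rmin\<close> g g
        \<tau>pos[folded \<sigma>_def] moment_pos[OF \<eta>] a moment_log_convex[OF \<eta>] zero]
    have "AE y in lborel. F 1 y = 0" by (rule Z(1); assumption)
    moreover have "AE y in lborel. F 2 y = 0" by (rule Z(2); assumption)
    ultimately show ?thesis using exhaust_2[of i] by (elim disjE) (simp_all only:)
  qed
  have "AE y in lborel. y \<in> {r0<..<r1} \<longrightarrow> \<psi>0 i y = 0" for i
    using F0[of i] hF[of i] h(4)[of i] by eventually_elim auto
  then show "X2_eq r0 r1 \<psi>0 (\<lambda>i r. 0)"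
    by (simp add: X2_eq_def AE_lebesgue_on_iff)
qed

end
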